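(* If a set of Verblunsky coefficients or Jacobi parameters is asymptotic to an isospectral torus, then the essential spectrum of the corresponding CMV or Jacobi matrix is identical to the common essential spectrum of the isospectral torus. Precisely: (CMV case) Let $\{\alpha_n\}_{n=0}^\infty\subset\mathbb{D}$ be a periodic sequence of Verblunsky coefficients, $\alpha_{n+p}=\alpha_n$ for all $n\ge 0$ and some $p\ge 1$, with isospectral torus $T_\alpha$. If $\{\gamma_n\}_{n=0}^\infty\subset\mathbb{D}$ is asymptotic to $T_\alpha$, then $$\sigma_{\mathrm{ess}}\bigl(\mathcal{C}(\{\gamma_n\}_{n=0}^\infty)\bigr)=\sigma_{\mathrm{ess}}\bigl(\mathcal{C}(\{\alpha_n\}_{n=0}^\infty)\bigr).$$ (Jacobi case) Let $\tilde J$ be a two-sided periodic Jacobi matrix with isospectral torus $T$. If $J$ is a (one-sided) Jacobi matrix whose Jacobi parameters $\{a_n,b_n\}_{n=1}^\infty$ are asymptotic to $T$, then $$\sigma_{\mathrm{ess}}(J)=\sigma(\tilde J).$$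
   Context: $\mathbb{D}=\{z\in\mathbb{C}:|z|<1\}$. $\sigma,\sigma_{\mathrm{ess}}$ denote spectrum and essential spectrum. CMV matrices. For $\alpha\in\mathbb{D}$ put $\rho=(1-|\alpha|^2)^{1/2}$ and $\Theta(\alpha)=\begin{pmatrix}\bar\alpha&\rho\\ \rho&-\alpha\end{pmatrix}$. For a sequence $\{\alpha_j\}_{j=0}^\infty\subset\mathbb{D}$ (Verblunsky coefficients) write $\Theta_j=\Theta(\alpha_j)$, $\mathcal{L}=\Theta_0\oplus\Theta_2\oplus\Theta_4\oplus\cdots$, $\mathcal{M}=\mathbf{1}\oplus\Theta_1\oplus\Theta_3\oplus\cdots$ with $\mathbf 1$ the $1\times1$ identity; the CMV matrix is the unitary operator $\mathcal{C}(\{\alpha_j\})=\mathcal{L}\mathcal{M}$ on $\ell^2(\{0,1,2,\dots\})$. Isospectral torus (CMV). For a $p$-periodic sequence $\alpha$ in $\mathbb{D}$ let $\Delta(z;\alpha)=z^{-p/2}\,\mathrm{Tr}(T_p(z))$, where $T_p(z)=A(\alpha_{p-1},z)\cdots A(\alpha_0,z)$ is the transfer matrix with $A(\alpha,z)=\rho^{-1}\begin{pmatrix}z&-\bar\alpha\\ -\alpha z&1\end{pmatrix}$ (for $p$ odd a fixed branch of $z^{-p/2}$ is used). Then $T_\alpha=\{\beta\in\mathbb{D}^p:\Delta(z;\{\beta_{n\bmod p}\}_{n=0}^\infty)=\Delta(z;\alpha)\text{ for all }z\in\mathbb{C}\setminus\{0\}\}$; elements of $T_\alpha$ are identified with $p$-periodic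 sequences. For sequences $\kappa,\lambda$ in $\mathbb{D}$ put $d(\kappa,\lambda)=\sum_{n=0}^\infty e^{-n}|\kappa_n-\lambda_n|$ and $d(\kappa,T_\alpha)=\inf_{\beta\in T_\alpha}d(\kappa,\beta)$. The sequence $\gamma$ is asymptotic to $T_\alpha$ if $\lim_{m\to\infty}d(\{\gamma_{n+m}\}_{n=0}^\infty,T_\alpha)=0$. (All $\beta\in T_\alpha$ have the same $\sigma_{\mathrm{ess}}(\mathcal{C}(\beta))$.) Jacobi matrices. A Jacobi matrix with parameters $a_n>0$, $b_n\in\mathbb{R}$ acts by $(Ju)(n)=a_nu(n+1)+b_nu(n)+a_{n-1}u(n-1)$; one-sided on $\ell^2(\{1,2,\dots\})$ (dropping the $a_0u(0)$ term), two-sided on $\ell^2(\mathbb{Z})$. For a $p$-periodic two-sided Jacobi matrix $\tilde J$, the discriminant is $\Delta(x)=\mathrm{Tr}(A_p(x)\cdots A_1(x))$, $A_j(x)=\frac{1}{a_j}\begin{pmatrix}x-b_j&-a_{j-1}\\ {a_j}&0\end{pmatrix}$, and the isospectral torus $T$ of $\tilde J$ is the set of all $p$-periodic two-sided parameter sequences $(\tilde a,\tilde b)$ (with $\tilde a_n>0$, $\tilde b_n\in\mathbb{R}$) with the same discriminant as $\tilde J$; all of them define two-sided Jacobi matrices with spectrum $\sigma(\tilde J)$. The parameters $\{a_n,b_n\}$ are asymptotic to $T$ if $$\lim_{n\to\infty}\ \min_{(\tilde a,\tilde b)\in T}\ \sum_{\ell=1}^\infty\bigl[|a_{n+\ell}-\tilde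 a_\ell|+|b_{n+\ell}-\tilde b_\ell|\bigr]e^{-\ell}=0.$$ *)

theory Defs
  imports "HOL-Analysis.Analysis"
begin

text \<open>Vectors of \<open>\<ell>\<^sup>2(I)\<close> are functions on the whole index type that vanish outside \<open>I\<close>.\<close>

definition ell2 :: "'i set \<Rightarrow> ('i \<Rightarrow> complex) set" where
  "ell2 I = {u. (\<forall>i. i \<notin> I \<longrightarrow> u i = 0) \<and> (\<lambda>i. (cmod (u i))\<^sup>2) summable_on UNIV}"

definition ell2_norm :: "('i \<Rightarrow> complex) \<Rightarrow> real" where
  "ell2_norm u = sqrt (\<Sum>\<^sub>\<infinity>i. (cmod (u i))\<^sup>2)"

definition bounded_op :: "'i set \<Rightarrow> (('i \<Rightarrow> complex) \<Rightarrow> ('i \<Rightarrow> complex)) \<Rightarrow> bool" where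
  "bounded_op I A \<longleftrightarrow>
     (\<forall>u\<in>ell2 I. A u \<in> ell2 I) \<and>
     (\<forall>u\<in>ell2 I. \<forall>v\<in>ell2 I. A (\<lambda>i. u i + v i) = (\<lambda>i. A u i + A v i)) \<and>
     (\<forall>c. \<forall>u\<in>ell2 I. A (\<lambda>i. c * u i) = (\<lambda>i. c * A u i)) \<and>
     (\<exists>C. \<forall>u\<in>ell2 I. ell2_norm (A u) \<le> C * ell2_norm u)"

definition shifted ::
  "(('i \<Rightarrow> complex) \<Rightarrow> ('i \<Rightarrow> complex)) \<Rightarrow> complex \<Rightarrow> ('i \<Rightarrow> complex) \<Rightarrow> ('i \<Rightarrow> complex)" where
  "shifted A z u = (\<lambda>i. A u i - z * u i)"

definition invertible_op :: "'i set \<Rightarrow> (('i \<Rightarrow> complex) \<Rightarrow> ('i \<Rightarrow> complex)) \<Rightarrow> bool" where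
  "invertible_op I A \<longleftrightarrow>
     bounded_op I A \<and> bij_betw A (ell2 I) (ell2 I) \<and>
     (\<exists>C. \<forall>u\<in>ell2 I. ell2_norm u \<le> C * ell2_norm (A u))"

definition lin_combs :: "('i \<Rightarrow> complex) set \<Rightarrow> ('i \<Rightarrow> complex) set" where
  "lin_combs B = {w. \<exists>c. w = (\<lambda>i. \<Sum>b\<in>B. c b * b i)}"

text \<open>The three clauses after boundedness: finite-dimensional kernel, closed range, and range of
  finite codimension.\<close>

definition fredholm :: "'i set \<Rightarrow> (('i \<Rightarrow> complex) \<Rightarrow> ('i \<Rightarrow> complex)) \<Rightarrow> bool" where
  "fredholm I A \<longleftrightarrow>
     bounded_op I A \<and>
     (\<exists>B. finite B \<and> B \<subseteq> ell2 I \<and> {u \<in> ell2 I. A u = (\<lambda>i. 0)} \<subseteq> lin_combs B) \<and>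
     (\<forall>f. \<forall>v\<in>ell2 I. (\<forall>k. f k \<in> A ` ell2 I) \<and>
         (\<lambda>k::nat. ell2_norm (\<lambda>i. f k i - v i)) \<longlonglongrightarrow> 0 \<longrightarrow> v \<in> A ` ell2 I) \<and>
     (\<exists>B. finite B \<and> B \<subseteq> ell2 I \<and>
         (\<forall>v\<in>ell2 I. \<exists>r\<in>A ` ell2 I. \<exists>w\<in>lin_combs B. v = (\<lambda>i. r i + w i)))"

definition spectrum_op :: "'i set \<Rightarrow> (('i \<Rightarrow> complex) \<Rightarrow> ('i \<Rightarrow> complex)) \<Rightarrow> complex set" where
  "spectrum_op I A = {z. \<not> invertible_op I (shifted A z)}"

text \<open>For the normal operators considered below, the set of \<open>z\<close> with \<open>A - z\<close> not Fredholm is also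
  the spectrum with the isolated eigenvalues of finite multiplicity removed.\<close>

definition ess_spectrum :: "'i set \<Rightarrow> (('i \<Rightarrow> complex) \<Rightarrow> ('i \<Rightarrow> complex)) \<Rightarrow> complex set" where
  "ess_spectrum I A = {z. \<not> fredholm I (shifted A z)}"

definition rho :: "complex \<Rightarrow> real" where
  "rho \<alpha> = sqrt (1 - (cmod \<alpha>)\<^sup>2)"

definition Theta :: "complex \<Rightarrow> complex^2^2" where
  "Theta \<alpha> = vector [vector [cnj \<alpha>, of_real (rho \<alpha>)], vector [of_real (rho \<alpha>), - \<alpha>]]"

text \<open>\<open>\<Theta>\<^sub>j\<close> acts on the coordinates \<open>j\<close> and \<open>j + 1\<close>, for even \<open>j\<close> in \<open>\<L>\<close> and for odd \<open>j\<close> in \<open>\<M>\<close>.\<close>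

definition cmv_L :: "(nat \<Rightarrow> complex) \<Rightarrow> (nat \<Rightarrow> complex) \<Rightarrow> (nat \<Rightarrow> complex)" where
  "cmv_L \<alpha> u n =
     (if even n then Theta (\<alpha> n) $ 1 $ 1 * u n + Theta (\<alpha> n) $ 1 $ 2 * u (n + 1)
      else Theta (\<alpha> (n - 1)) $ 2 $ 1 * u (n - 1) + Theta (\<alpha> (n - 1)) $ 2 $ 2 * u n)"

definition cmv_M :: "(nat \<Rightarrow> complex) \<Rightarrow> (nat \<Rightarrow> complex) \<Rightarrow> (nat \<Rightarrow> complex)" where
  "cmv_M \<alpha> u n =
     (if n = 0 then u 0
      else if odd n then Theta (\<alpha> n) $ 1 $ 1 * u n + Theta (\<alpha> n) $ 1 $ 2 * u (n + 1)
      else Theta (\<alpha> (n - 1)) $ 2 $ 1 * u (n - 1) + Theta (\<alpha> (n - 1)) $ 2 $ 2 * u n)"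

definition cmv :: "(nat \<Rightarrow> complex) \<Rightarrow> (nat \<Rightarrow> complex) \<Rightarrow> (nat \<Rightarrow> complex)" where
  "cmv \<alpha> u = cmv_L \<alpha> (cmv_M \<alpha> u)"

definition szego_step :: "complex \<Rightarrow> complex \<Rightarrow> complex^2^2" where
  "szego_step \<alpha> z = inverse (rho \<alpha>) *\<^sub>R vector [vector [z, - cnj \<alpha>], vector [- \<alpha> * z, 1]]"

primrec cmv_transfer :: "nat \<Rightarrow> (nat \<Rightarrow> complex) \<Rightarrow> complex \<Rightarrow> complex^2^2" where
  "cmv_transfer 0 \<alpha> z = mat 1"
| "cmv_transfer (Suc n) \<alpha> z = szego_step (\<alpha> n) z ** cmv_transfer n \<alpha> z"

text \<open>The complex power is the principal branch, which is the branch fixed for odd \<open>p\<close>.\<close>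

definition cmv_discriminant :: "nat \<Rightarrow> (nat \<Rightarrow> complex) \<Rightarrow> complex \<Rightarrow> complex" where
  "cmv_discriminant p \<alpha> z = z powr (- of_nat p / 2) * trace (cmv_transfer p \<alpha> z)"

definition periodic_verblunsky :: "nat \<Rightarrow> (nat \<Rightarrow> complex) \<Rightarrow> bool" where
  "periodic_verblunsky p \<alpha> \<longleftrightarrow> (\<forall>n. cmod (\<alpha> n) < 1) \<and> (\<forall>n. \<alpha> (n + p) = \<alpha> n)"

text \<open>The elements of the torus, points of \<open>\<D>\<^sup>p\<close>, are represented by their \<open>p\<close>-periodic extensions.\<close>

definition cmv_torus :: "nat \<Rightarrow> (nat \<Rightarrow> complex) \<Rightarrow> (nat \<Rightarrow> complex) set" where
  "cmv_torus p \<alpha> = {\<beta>. periodic_verblunsky p \<beta> \<and>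
     (\<forall>z. z \<noteq> 0 \<longrightarrow> cmv_discriminant p \<beta> z = cmv_discriminant p \<alpha> z)}"

definition verblunsky_dist :: "(nat \<Rightarrow> complex) \<Rightarrow> (nat \<Rightarrow> complex) \<Rightarrow> real" where
  "verblunsky_dist \<kappa> \<mu> = (\<Sum>n. exp (- real n) * cmod (\<kappa> n - \<mu> n))"

definition cmv_asymptotic :: "(nat \<Rightarrow> complex) \<Rightarrow> (nat \<Rightarrow> complex) set \<Rightarrow> bool" where
  "cmv_asymptotic \<gamma> T \<longleftrightarrow>
     (\<lambda>m. INF \<beta>\<in>T. verblunsky_dist (\<lambda>n. \<gamma> (n + m)) \<beta>) \<longlonglongrightarrow> 0"

text \<open>On \<open>\<ell>\<^sup>2({1, 2, \<dots>})\<close>, realised as \<open>ell2 {1..}\<close> over the naturals; the values \<open>a 0\<close> and \<open>b 0\<close>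
  are not used.\<close>

definition jacobi_half :: "(nat \<Rightarrow> real) \<Rightarrow> (nat \<Rightarrow> real) \<Rightarrow> (nat \<Rightarrow> complex) \<Rightarrow> (nat \<Rightarrow> complex)" where
  "jacobi_half a b u n =
     (if n = 0 then 0
      else of_real (a n) * u (n + 1) + of_real (b n) * u n +
           (if n = 1 then 0 else of_real (a (n - 1)) * u (n - 1)))"

definition jacobi_full :: "(int \<Rightarrow> real) \<Rightarrow> (int \<Rightarrow> real) \<Rightarrow> (int \<Rightarrow> complex) \<Rightarrow> (int \<Rightarrow> complex)" where
  "jacobi_full a b u n =
     of_real (a n) * u (n + 1) + of_real (b n) * u n + of_real (a (n - 1)) * u (n - 1)"

definition jacobi_step :: "(int \<Rightarrow> real) \<Rightarrow> (int \<Rightarrow> real) \<Rightarrow> int \<Rightarrow> real \<Rightarrow> real^2^2" where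
  "jacobi_step a b j x = (1 / a j) *\<^sub>R vector [vector [x - b j, - a (j - 1)], vector [a j, 0]]"

primrec jacobi_transfer :: "nat \<Rightarrow> (int \<Rightarrow> real) \<Rightarrow> (int \<Rightarrow> real) \<Rightarrow> real \<Rightarrow> real^2^2" where
  "jacobi_transfer 0 a b x = mat 1"
| "jacobi_transfer (Suc n) a b x = jacobi_step a b (int (Suc n)) x ** jacobi_transfer n a b x"

definition jacobi_discriminant :: "nat \<Rightarrow> (int \<Rightarrow> real) \<Rightarrow> (int \<Rightarrow> real) \<Rightarrow> real \<Rightarrow> real" where
  "jacobi_discriminant p a b x = trace (jacobi_transfer p a b x)"

definition periodic_jacobi :: "nat \<Rightarrow> (int \<Rightarrow> real) \<Rightarrow> (int \<Rightarrow> real) \<Rightarrow> bool" where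
  "periodic_jacobi p a b \<longleftrightarrow>
     (\<forall>n. a n > 0) \<and> (\<forall>n. a (n + int p) = a n) \<and> (\<forall>n. b (n + int p) = b n)"

definition jacobi_torus ::
  "nat \<Rightarrow> (int \<Rightarrow> real) \<Rightarrow> (int \<Rightarrow> real) \<Rightarrow> ((int \<Rightarrow> real) \<times> (int \<Rightarrow> real)) set" where
  "jacobi_torus p a b = {(a', b'). periodic_jacobi p a' b' \<and>
     (\<forall>x. jacobi_discriminant p a' b' x = jacobi_discriminant p a b x)}"

text \<open>The weighted sum is taken in \<^typ>\<open>ennreal\<close>, because nothing bounds the parameters \<open>a\<close> and
  \<open>b\<close> a priori.  With \<open>k = \<ell> - 1\<close> the sum runs over \<open>\<ell> \<ge> 1\<close>.\<close>

definition jacobi_dist ::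
  "(nat \<Rightarrow> real) \<Rightarrow> (nat \<Rightarrow> real) \<Rightarrow> nat \<Rightarrow> (int \<Rightarrow> real) \<Rightarrow> (int \<Rightarrow> real) \<Rightarrow> ennreal" where
  "jacobi_dist a b n a' b' =
     (\<Sum>k. ennreal ((\<bar>a (n + Suc k) - a' (int (Suc k))\<bar> + \<bar>b (n + Suc k) - b' (int (Suc k))\<bar>)
                     * exp (- real (Suc k))))"

definition jacobi_asymptotic ::
  "(nat \<Rightarrow> real) \<Rightarrow> (nat \<Rightarrow> real) \<Rightarrow> ((int \<Rightarrow> real) \<times> (int \<Rightarrow> real)) set \<Rightarrow> bool" where
  "jacobi_asymptotic a b T \<longleftrightarrow> (\<lambda>n. INF (a', b')\<in>T. jacobi_dist a b n a' b') \<longlonglongrightarrow> 0"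

end

theory Submission
  imports Defs
begin

text \<open>
  All members of an isospectral torus share, at every spectral parameter \<open>z\<close>, the trace \<open>t\<close> and the
  determinant \<open>D\<close> of the transfer matrix over one period, and the torus is bounded.  If the
  coefficients are asymptotic to the torus, then far out every window of the transfer matrices is close to
  a periodic one with these invariants.  When the characteristic polynomial \<open>\<nu>\<^sup>2 - t \<nu> + D\<close> has a root on
  the unit circle, truncated Floquet solutions form a Weyl sequence; a Weyl sequence with disjoint
  supports excludes closed range, because the formal solutions of the difference equation form a
  space of dimension at most one.  Otherwise Cayley--Hamilton yields a constant-coefficient recurrence over
  two periods that is bounded below, so the operator and its adjoint are bounded below near infinity,
  and the operator is Fredholm by Lax--Milgram.  Hence the essential spectrum depends on \<open>t\<close> and \<open>D\<close> only.
  The same dichotomy decides invertibility of the two-sided periodic Jacobi matrix.  Non-real \<open>z\<close>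
  (Jacobi) and \<open>|z| \<noteq> 1\<close> (CMV) are trivially outside the spectrum, by self-adjointness and unitarity.
\<close>

section \<open>The Hilbert space of square summable functions\<close>

text \<open>Being asymptotic to the torus fixes no limit point: the best approximating torus element
  may change from window to window, so the operator need not be a compact perturbation of a periodic
  one and Weyl's theorem on compact perturbations does not apply. Eigenvectors of the one-period
  matrix cannot be followed either, since they depend on the torus element. Cayley--Hamilton removes
  this dependence: its coefficients are \<open>t\<close> and \<open>D\<close> only, so the
  two-period recurrence is the same in every window, and closeness to the varying models merely adds
  a small error. Boundedness of the torus supplies the uniformity: it keeps \<open>a\<close>
  (Jacobi) away from 0 and the Verblunsky coefficients (CMV) away from the unit circle, where the
  step matrices blow up. The discriminant alone must yield these bounds; they are read off from its
  leading coefficients in \<open>x\<close> (Jacobi) and from the trace at \<open>z = 0\<close>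
  (CMV). As the kernel is at most one-dimensional, failure of the Fredholm property is obtained from
  a range that is not closed.\<close>

lemma ell2_UNIV_iff: "u \<in> ell2 UNIV \<longleftrightarrow> (\<lambda>i. (cmod (u i))\<^sup>2) summable_on UNIV"
  by (simp add: ell2_def)

lemma ell2_iff: "u \<in> ell2 I \<longleftrightarrow> u \<in> ell2 UNIV \<and> (\<forall>i. i \<notin> I \<longrightarrow> u i = 0)"
  by (auto simp: ell2_def)

lemma cmod_mult_le_sum_squares: "cmod (a * b) \<le> (cmod a)\<^sup>2 + (cmod b)\<^sup>2"
proof -
  have "0 \<le> (cmod a - cmod b)\<^sup>2" by simp
  then have "2 * (cmod a * cmod b) \<le> (cmod a)\<^sup>2 + (cmod b)\<^sup>2"
    by (simp add: power2_diff)
  moreover have "0 \<le> cmod a * cmod b" by simp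
  ultimately show ?thesis unfolding norm_mult by linarith
qed

lemma Re_mult_cnj_self: "Re (z * cnj z) = (cmod z)\<^sup>2"
  by (simp add: cmod_power2 flip: power2_eq_square)

lemma ell2_mult_abs_summable:
  assumes "u \<in> ell2 UNIV" "v \<in> ell2 UNIV"
  shows "(\<lambda>i. norm (u i * cnj (v i))) summable_on UNIV"
proof (rule Infinite_Sum.abs_summable_on_comparison_test')
  show "(\<lambda>i. (cmod (u i))\<^sup>2 + (cmod (v i))\<^sup>2) summable_on UNIV"
    using assms by (intro summable_on_add) (auto simp: ell2_UNIV_iff)
  show "norm (u i * cnj (v i)) \<le> (cmod (u i))\<^sup>2 + (cmod (v i))\<^sup>2" for i
    using cmod_mult_le_sum_squares[of "u i" "cnj (v i)"] by simp
qed

lemma ell2_mult_summable: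
  assumes "u \<in> ell2 UNIV" "v \<in> ell2 UNIV"
  shows "(\<lambda>i. u i * cnj (v i)) summable_on UNIV"
  using abs_summable_summable[OF ell2_mult_abs_summable[OF assms]] .

lemma ell2_Re_summable:
  assumes "u \<in> ell2 UNIV" "v \<in> ell2 UNIV"
  shows "(\<lambda>i. Re (u i * cnj (v i))) summable_on UNIV"
  using summable_on_Re[OF ell2_mult_summable[OF assms]] .

lemma ell2_comparison:
  assumes "v \<in> ell2 UNIV" "\<And>i. cmod (u i) \<le> C * cmod (v i)"
  shows "u \<in> ell2 UNIV"
  unfolding ell2_UNIV_iff
proof (rule summable_on_comparison_test)
  show "(\<lambda>i. C\<^sup>2 * (cmod (v i))\<^sup>2) summable_on UNIV"
    using assms(1) by (intro summable_on_cmult_right) (simp add: ell2_UNIV_iff)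
  show "(cmod (u i))\<^sup>2 \<le> C\<^sup>2 * (cmod (v i))\<^sup>2" for i
    using power_mono[OF assms(2)[of i], of 2] by (simp add: power_mult_distrib)
qed auto

lemma ell2_add:
  assumes "u \<in> ell2 UNIV" "v \<in> ell2 UNIV"
  shows "(\<lambda>i. u i + v i) \<in> ell2 UNIV"
  unfolding ell2_UNIV_iff
proof (rule summable_on_comparison_test)
  show "(\<lambda>i. 2 * (cmod (u i))\<^sup>2 + 2 * (cmod (v i))\<^sup>2) summable_on UNIV"
    using assms by (intro summable_on_add summable_on_cmult_right) (simp_all add: ell2_UNIV_iff)
  show "(cmod (u i + v i))\<^sup>2 \<le> 2 * (cmod (u i))\<^sup>2 + 2 * (cmod (v i))\<^sup>2" for i
  proof -
    have "(cmod (u i + v i))\<^sup>2 \<le> (cmod (u i) + cmod (v i))\<^sup>2"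
      by (intro power_mono norm_triangle_ineq) simp
    also have "\<dots> \<le> 2 * (cmod (u i))\<^sup>2 + 2 * (cmod (v i))\<^sup>2"
      using sum_squares_bound[of "cmod (u i)" "cmod (v i)"] by (simp add: power2_sum)
    finally show ?thesis .
  qed
qed auto

lemma ell2_cmult: "u \<in> ell2 UNIV \<Longrightarrow> (\<lambda>i. c * u i) \<in> ell2 UNIV"
  by (rule ell2_comparison[where C = "cmod c" and v = u]) (simp_all add: norm_mult)

lemma ell2_zero: "(\<lambda>i. 0) \<in> ell2 I"
  by (simp add: ell2_def)

lemma ell2_uminus: "u \<in> ell2 UNIV \<Longrightarrow> (\<lambda>i. - u i) \<in> ell2 UNIV"
  using ell2_cmult[of u "-1"] by simp

lemma ell2_diff: "u \<in> ell2 UNIV \<Longrightarrow> v \<in> ell2 UNIV \<Longrightarrow> (\<lambda>i. u i - v i) \<in> ell2 UNIV"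
  using ell2_add[OF _ ell2_uminus, of u v] by simp

text \<open>A type is needed because inner product, norm and completeness enter through type
  classes. It is built over the whole index type; the subspaces \<open>ell2 I\<close> appear later
  as conditions on \<open>l2_fun x\<close>.\<close>

typedef 'i l2 = "ell2 (UNIV :: 'i set)"
  morphisms l2_fun Abs_l2
  using ell2_zero by blast

setup_lifting type_definition_l2

lemma l2_fun_ell2 [simp]: "l2_fun x \<in> ell2 UNIV"
  using l2_fun by blast

lemma l2_eqI: "(\<And>i. l2_fun x i = l2_fun y i) \<Longrightarrow> x = y"
  by (simp add: l2_fun_inject[symmetric] fun_eq_iff)

instantiation l2 :: (type) real_inner
begin

lift_definition zero_l2 :: "'a l2" is "\<lambda>i. 0" by (rule ell2_zero)
lift_definition plus_l2 :: "'a l2 \<Rightarrow> 'a l2 \<Rightarrow> 'a l2" is "\<lambda>u v i. u i + v i" by (rule ell2_add)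
lift_definition minus_l2 :: "'a l2 \<Rightarrow> 'a l2 \<Rightarrow> 'a l2" is "\<lambda>u v i. u i - v i" by (rule ell2_diff)
lift_definition uminus_l2 :: "'a l2 \<Rightarrow> 'a l2" is "\<lambda>u i. - u i" by (rule ell2_uminus)
lift_definition scaleR_l2 :: "real \<Rightarrow> 'a l2 \<Rightarrow> 'a l2" is "\<lambda>r u i. complex_of_real r * u i"
  by (rule ell2_cmult)
text \<open>This is the real part of the complex inner product: \<open>real_inner\<close> makes the
  space a real Hilbert space, and complex scalars come in only through
  \<open>cscale\<close>.\<close>

lift_definition inner_l2 :: "'a l2 \<Rightarrow> 'a l2 \<Rightarrow> real" is
  "\<lambda>u v. \<Sum>\<^sub>\<infinity>i. Re (u i * cnj (v i))" .

definition norm_l2 :: "'a l2 \<Rightarrow> real" where "norm_l2 x = sqrt (inner x x)"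
definition dist_l2 :: "'a l2 \<Rightarrow> 'a l2 \<Rightarrow> real" where "dist_l2 x y = norm (x - y)"
definition sgn_l2 :: "'a l2 \<Rightarrow> 'a l2" where "sgn_l2 x = scaleR (inverse (norm x)) x"
definition uniformity_l2 :: "('a l2 \<times> 'a l2) filter" where
  "uniformity_l2 = (INF e\<in>{0<..}. principal {(x, y). dist x y < e})"
definition open_l2 :: "'a l2 set \<Rightarrow> bool" where
  "open_l2 U = (\<forall>x\<in>U. eventually (\<lambda>(x', y). x' = x \<longrightarrow> y \<in> U) uniformity)"

instance
proof
  fix x y z :: "'a l2" and r s :: real
  show "x + y + z = x + (y + z)" by transfer (simp add: algebra_simps)
  show "x + y = y + x" by transfer (simp add: algebra_simps)
  show "0 + x = x" by transfer simp
  show "- x + x = 0" by transfer simp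
  show "x - y = x + - y" by transfer simp
  show "r *\<^sub>R (x + y) = r *\<^sub>R x + r *\<^sub>R y" by transfer (simp add: algebra_simps)
  show "(r + s) *\<^sub>R x = r *\<^sub>R x + s *\<^sub>R x" by transfer (simp add: algebra_simps)
  show "r *\<^sub>R s *\<^sub>R x = (r * s) *\<^sub>R x" by transfer (simp add: algebra_simps)
  show "1 *\<^sub>R x = x" by transfer simp
  show "inner x y = inner y x" by transfer (simp add: mult.commute)
  show "inner (x + y) z = inner x z + inner y z"
  proof transfer
    fix u v w :: "'a \<Rightarrow> complex"
    assume "u \<in> ell2 UNIV" "v \<in> ell2 UNIV" "w \<in> ell2 UNIV"
    then have "(\<Sum>\<^sub>\<infinity>i. Re (u i * cnj (w i)) + Re (v i * cnj (w i))) =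
        (\<Sum>\<^sub>\<infinity>i. Re (u i * cnj (w i))) + (\<Sum>\<^sub>\<infinity>i. Re (v i * cnj (w i)))"
      by (intro infsum_add ell2_Re_summable)
    then show "(\<Sum>\<^sub>\<infinity>i. Re ((u i + v i) * cnj (w i))) =
        (\<Sum>\<^sub>\<infinity>i. Re (u i * cnj (w i))) + (\<Sum>\<^sub>\<infinity>i. Re (v i * cnj (w i)))"
      by (simp only: distrib_right plus_complex.sel)
  qed
  show "inner (r *\<^sub>R x) y = r * inner x y"
  proof transfer
    fix r and u v :: "'a \<Rightarrow> complex"
    have "(\<Sum>\<^sub>\<infinity>i. r * Re (u i * cnj (v i))) = r * (\<Sum>\<^sub>\<infinity>i. Re (u i * cnj (v i)))"
      by (rule infsum_cmult_right')
    then show "(\<Sum>\<^sub>\<infinity>i. Re (complex_of_real r * u i * cnj (v i))) =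
        r * (\<Sum>\<^sub>\<infinity>i. Re (u i * cnj (v i)))"
      by (simp add: mult.assoc algebra_simps)
  qed
  show "0 \<le> inner x x"
    by transfer (auto intro!: infsum_nonneg)
  show "inner x x = 0 \<longleftrightarrow> x = 0"
  proof
    assume "inner x x = 0"
    then show "x = 0"
    proof transfer
      fix u :: "'a \<Rightarrow> complex"
      assume u: "u \<in> ell2 UNIV" and "(\<Sum>\<^sub>\<infinity>i. Re (u i * cnj (u i))) = 0"
      then have "Re (u i * cnj (u i)) = 0" for i
        by (intro nonneg_infsum_le_0D[OF _ ell2_Re_summable[OF u u]]) auto
      then have "(cmod (u i))\<^sup>2 = 0" for i
        unfolding Re_mult_cnj_self .
      then show "u = (\<lambda>i. 0)" by (simp add: fun_eq_iff)
    qed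
  next
    assume "x = 0"
    then show "inner x x = 0" by simp (transfer, simp)
  qed
qed (rule norm_l2_def dist_l2_def sgn_l2_def open_l2_def uniformity_l2_def)+

end

lemmas l2_fun_simps [simp] = zero_l2.rep_eq plus_l2.rep_eq minus_l2.rep_eq uminus_l2.rep_eq scaleR_l2.rep_eq

lemma norm_l2_eq: "norm x = ell2_norm (l2_fun x)"
  by (simp only: norm_l2_def inner_l2.rep_eq ell2_norm_def Re_mult_cnj_self)

lemma norm_l2_square: "(norm x)\<^sup>2 = (\<Sum>\<^sub>\<infinity>i. (cmod (l2_fun x i))\<^sup>2)"
  by (simp add: norm_l2_eq ell2_norm_def infsum_nonneg)

lemma l2_fun_summable: "(\<lambda>i. (cmod (l2_fun x i))\<^sup>2) summable_on A"
  using l2_fun_ell2[of x] summable_on_subset_banach[of _ UNIV A] by (auto simp: ell2_UNIV_iff)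

lemma sum_le_norm_l2: "finite F \<Longrightarrow> (\<Sum>i\<in>F. (cmod (l2_fun x i))\<^sup>2) \<le> (norm x)\<^sup>2"
  unfolding norm_l2_square by (intro finite_sum_le_infsum l2_fun_summable) auto

lemma cmod_le_norm_l2: "cmod (l2_fun x i) \<le> norm x"
  using sum_le_norm_l2[of "{i}" x] by (simp add: power2_le_iff_abs_le)

lemma ell2_bounded_sums:
  assumes "\<And>F. finite F \<Longrightarrow> (\<Sum>i\<in>F. (cmod (u i))\<^sup>2) \<le> C\<^sup>2" "C \<ge> 0"
  shows "u \<in> ell2 UNIV" "ell2_norm u \<le> C"
proof -
  show *: "u \<in> ell2 UNIV"
    unfolding ell2_UNIV_iff
    by (rule nonneg_bdd_above_summable_on) (use assms in \<open>auto simp: bdd_above_def\<close>)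
  have "(\<Sum>\<^sub>\<infinity>i. (cmod (u i))\<^sup>2) \<le> C\<^sup>2"
    by (rule infsum_le_finite_sums) (use * assms in \<open>auto simp: ell2_UNIV_iff\<close>)
  then show "ell2_norm u \<le> C"
    unfolding ell2_norm_def using assms(2) by (simp add: real_le_lsqrt infsum_nonneg)
qed

text \<open>Coordinates converge because each one is bounded by the norm. The Cauchy bound passes to
  the coordinatewise limit on finite index sets, and \<open>ell2_bounded_sums\<close> then gives
  membership and the norm bound at once.\<close>

instance l2 :: (type) complete_space
proof
  fix X :: "nat \<Rightarrow> 'a l2"
  assume X: "Cauchy X"
  have "Cauchy (\<lambda>n. l2_fun (X n) i)" for i
  proof (rule metric_CauchyI)
    fix e :: real assume "e > 0"
    then obtain N where N: "\<And>m n. m \<ge> N \<Longrightarrow> n \<ge> N \<Longrightarrow> dist (X m) (X n) < e"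
      using metric_CauchyD[OF X] by blast
    have "dist (l2_fun (X m) i) (l2_fun (X n) i) < e" if "m \<ge> N" "n \<ge> N" for m n
      using N[OF that] cmod_le_norm_l2[of "X m - X n" i] by (simp add: dist_norm)
    then show "\<exists>M. \<forall>m\<ge>M. \<forall>n\<ge>M. dist (l2_fun (X m) i) (l2_fun (X n) i) < e" by blast
  qed
  then have "\<exists>l. (\<lambda>n. l2_fun (X n) i) \<longlonglongrightarrow> l" for i
    using Cauchy_convergent convergentD by blast
  then have "\<forall>i. \<exists>l. (\<lambda>n. l2_fun (X n) i) \<longlonglongrightarrow> l" by blast
  from choice[OF this] obtain f where f: "\<And>i. (\<lambda>n. l2_fun (X n) i) \<longlonglongrightarrow> f i" by blast
  have tail: "\<exists>N. \<forall>m\<ge>N. (\<lambda>i. l2_fun (X m) i - f i) \<in> ell2 UNIV \<and>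
      ell2_norm (\<lambda>i. l2_fun (X m) i - f i) \<le> e" if e: "e > 0" for e
  proof -
    obtain N where N: "\<And>m n. m \<ge> N \<Longrightarrow> n \<ge> N \<Longrightarrow> dist (X m) (X n) < e"
      using metric_CauchyD[OF X e] by blast
    have le: "(\<Sum>i\<in>F. (cmod (l2_fun (X m) i - f i))\<^sup>2) \<le> e\<^sup>2" if "m \<ge> N" "finite F" for m F
    proof (rule LIMSEQ_le_const2)
      show "(\<lambda>n. \<Sum>i\<in>F. (cmod (l2_fun (X m) i - l2_fun (X n) i))\<^sup>2)
          \<longlonglongrightarrow> (\<Sum>i\<in>F. (cmod (l2_fun (X m) i - f i))\<^sup>2)"
        by (intro tendsto_intros f)
      have "(\<Sum>i\<in>F. (cmod (l2_fun (X m) i - l2_fun (X n) i))\<^sup>2) \<le> e\<^sup>2" if "n \<ge> N" for n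
      proof -
        have "(\<Sum>i\<in>F. (cmod (l2_fun (X m - X n) i))\<^sup>2) \<le> (norm (X m - X n))\<^sup>2"
          by (rule sum_le_norm_l2) fact
        also have "\<dots> \<le> e\<^sup>2"
          using N[OF \<open>m \<ge> N\<close> that] by (intro power_mono) (auto simp: dist_norm)
        finally show ?thesis by simp
      qed
      then show "\<exists>K. \<forall>n\<ge>K. (\<Sum>i\<in>F. (cmod (l2_fun (X m) i - l2_fun (X n) i))\<^sup>2) \<le> e\<^sup>2"
        by blast
    qed
    have "(\<lambda>i. l2_fun (X m) i - f i) \<in> ell2 UNIV \<and>
        ell2_norm (\<lambda>i. l2_fun (X m) i - f i) \<le> e" if "m \<ge> N" for m
      using ell2_bounded_sums[of "\<lambda>i. l2_fun (X m) i - f i" e] le[OF that] e by simp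
    then show ?thesis by blast
  qed
  obtain N where "(\<lambda>i. l2_fun (X N) i - f i) \<in> ell2 UNIV" using tail[OF zero_less_one] by blast
  from ell2_diff[OF l2_fun_ell2[of "X N"] this] have "f \<in> ell2 UNIV" by simp
  define x where "x = Abs_l2 f"
  have x: "l2_fun x = f" unfolding x_def using \<open>f \<in> ell2 UNIV\<close> by (rule Abs_l2_inverse)
  have "X \<longlonglongrightarrow> x"
  proof (rule metric_LIMSEQ_I)
    fix e :: real assume "e > 0"
    then obtain N where "\<forall>m\<ge>N. ell2_norm (\<lambda>i. l2_fun (X m) i - f i) \<le> e / 2"
      using tail[of "e/2"] half_gt_zero by blast
    then have "\<forall>m\<ge>N. dist (X m) x \<le> e / 2"
      by (simp add: dist_norm norm_l2_eq minus_l2.rep_eq x)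
    moreover have "e / 2 < e" using \<open>e > 0\<close> by simp
    ultimately show "\<exists>N. \<forall>m\<ge>N. dist (X m) x < e" by (meson le_less_trans)
  qed
  then show "convergent X" by (auto simp: convergent_def)
qed

instance l2 :: (type) banach ..

lemma l2_fun_tendsto: "(X \<longlongrightarrow> x) F \<Longrightarrow> ((\<lambda>n. l2_fun (X n) i) \<longlongrightarrow> l2_fun x i) F"
proof (rule metric_tendsto_imp_tendsto)
  show "\<forall>\<^sub>F n in F. dist (l2_fun (X n) i) (l2_fun x i) \<le> dist (X n) x"
    using cmod_le_norm_l2[of "X _ - x" i] by (simp add: dist_norm)
qed

lift_definition cscale :: "complex \<Rightarrow> 'i l2 \<Rightarrow> 'i l2" is "\<lambda>c u i. c * u i" by (rule ell2_cmult)

lemmas [simp] = cscale.rep_eq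

lemma norm_cscale [simp]: "norm (cscale c x) = cmod c * norm x"
proof (rule power2_eq_imp_eq)
  show "(norm (cscale c x))\<^sup>2 = (cmod c * norm x)\<^sup>2"
    unfolding power_mult_distrib norm_l2_square
    by (simp add: norm_mult power_mult_distrib infsum_cmult_right')
qed auto

lemma cscale_scaleR: "cscale (of_real r) x = r *\<^sub>R x"
  by (rule l2_eqI) simp

lemma cscale_cscale [simp]: "cscale c (cscale d x) = cscale (c * d) x"
  by (rule l2_eqI) simp

lemma cscale_add_right: "cscale c (x + y) = cscale c x + cscale c y"
  by (rule l2_eqI) (simp add: algebra_simps)

lemma cscale_diff_right: "cscale c (x - y) = cscale c x - cscale c y"
  by (rule l2_eqI) (simp add: algebra_simps)

lemma inner_cscale_left: "inner (cscale c x) y = inner x (cscale (cnj c) y)"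
  unfolding inner_l2.rep_eq by (simp add: mult_ac)

lemma bounded_linear_cscale: "bounded_linear (cscale c)"
  by (rule bounded_linear_intro[where K = "cmod c"]) (auto simp: cscale_add_right intro!: l2_eqI)

section \<open>Bounded operators\<close>

text \<open>Operators are given on arbitrary functions so that formal solutions make sense;
  \<open>op_of\<close> is their restriction to the Hilbert space, meaningful once
  \<open>bounded_op UNIV A\<close> puts the values into \<open>ell2 UNIV\<close>.\<close>

definition op_of :: "(('i \<Rightarrow> complex) \<Rightarrow> 'i \<Rightarrow> complex) \<Rightarrow> 'i l2 \<Rightarrow> 'i l2" where
  "op_of A x = Abs_l2 (A (l2_fun x))"

lemma Abs_l2_inverse' [simp]: "u \<in> ell2 UNIV \<Longrightarrow> l2_fun (Abs_l2 u) = u"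
  by (rule Abs_l2_inverse)

lemma norm_Abs_l2: "u \<in> ell2 UNIV \<Longrightarrow> norm (Abs_l2 u) = ell2_norm u"
  by (simp add: norm_l2_eq)

lemma bounded_opD:
  assumes "bounded_op I A" "u \<in> ell2 I"
  shows "A u \<in> ell2 I" "v \<in> ell2 I \<Longrightarrow> A (\<lambda>i. u i + v i) = (\<lambda>i. A u i + A v i)"
    "A (\<lambda>i. c * u i) = (\<lambda>i. c * A u i)"
  using assms by (auto simp only: bounded_op_def)

lemma l2_fun_op_of: "bounded_op UNIV A \<Longrightarrow> l2_fun (op_of A x) = A (l2_fun x)"
  unfolding op_of_def by (rule Abs_l2_inverse[OF bounded_opD(1)[OF _ l2_fun_ell2]])

lemma op_of_add:
  assumes "bounded_op UNIV A"
  shows "op_of A (x + y) = op_of A x + op_of A y"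
proof (rule l2_eqI)
  have "A (l2_fun (x + y)) = (\<lambda>i. A (l2_fun x) i + A (l2_fun y) i)"
    unfolding plus_l2.rep_eq by (rule bounded_opD(2)[OF assms]) (rule l2_fun_ell2)+
  then show "l2_fun (op_of A (x + y)) i = l2_fun (op_of A x + op_of A y) i" for i
    unfolding plus_l2.rep_eq l2_fun_op_of[OF assms] by metis
qed

lemma op_of_cscale:
  assumes "bounded_op UNIV A"
  shows "op_of A (cscale c x) = cscale c (op_of A x)"
proof (rule l2_eqI)
  have "A (l2_fun (cscale c x)) = (\<lambda>i. c * A (l2_fun x) i)"
    unfolding cscale.rep_eq by (rule bounded_opD(3)[OF assms]) (rule l2_fun_ell2)
  then show "l2_fun (op_of A (cscale c x)) i = l2_fun (cscale c (op_of A x)) i" for i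
    unfolding cscale.rep_eq l2_fun_op_of[OF assms] by metis
qed

lemma bounded_linear_op_of:
  assumes "bounded_op UNIV A"
  shows "bounded_linear (op_of A)"
proof -
  obtain C where C: "\<And>u. u \<in> ell2 UNIV \<Longrightarrow> ell2_norm (A u) \<le> C * ell2_norm u"
    using assms unfolding bounded_op_def by blast
  show ?thesis
  proof (rule bounded_linear_intro[where K = C])
    show "op_of A (x + y) = op_of A x + op_of A y" for x y
      by (rule op_of_add) fact
    show "op_of A (r *\<^sub>R x) = r *\<^sub>R op_of A x" for r x
      using op_of_cscale[OF assms, of "of_real r"] by (simp add: cscale_scaleR)
    show "norm (op_of A x) \<le> norm x * C" for x
      using C[of "l2_fun x"] by (simp add: norm_l2_eq l2_fun_op_of assms mult.commute)
  qed
qed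

text \<open>\<open>bounded_linear\<close> knows only real scalars, so complex homogeneity is a
  separate assumption. Compositions, sums and the passage to \<open>shifted A z\<close> are handled
  by exhibiting the corresponding map on \<open>l2\<close>.\<close>

lemma bounded_opI:
  assumes "bounded_linear T" "\<And>c x. T (cscale c x) = cscale c (T x)" "\<And>x. l2_fun (T x) = A (l2_fun x)"
  shows "bounded_op UNIV A"
  unfolding bounded_op_def
proof (intro conjI ballI allI)
  have A: "A u = l2_fun (T (Abs_l2 u))" if "u \<in> ell2 UNIV" for u
    using that by (simp add: assms(3))
  show "A u \<in> ell2 UNIV" if "u \<in> ell2 UNIV" for u
    using A[OF that] by simp
  show "A (\<lambda>i. u i + v i) = (\<lambda>i. A u i + A v i)" if "u \<in> ell2 UNIV" "v \<in> ell2 UNIV" for u v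
  proof -
    have "Abs_l2 (\<lambda>i. u i + v i) = Abs_l2 u + Abs_l2 v"
      using that by (intro l2_eqI) (simp add: ell2_add)
    then show ?thesis
      using that by (simp add: A ell2_add linear_add[OF bounded_linear.linear[OF assms(1)]])
  qed
  show "A (\<lambda>i. c * u i) = (\<lambda>i. c * A u i)" if "u \<in> ell2 UNIV" for c u
  proof -
    have "Abs_l2 (\<lambda>i. c * u i) = cscale c (Abs_l2 u)"
      using that by (intro l2_eqI) (simp add: ell2_cmult)
    then show ?thesis
      using that by (simp add: A ell2_cmult assms(2))
  qed
  obtain K where K: "\<And>x. norm (T x) \<le> norm x * K"
    using bounded_linear.bounded[OF assms(1)] by blast
  have "ell2_norm (A u) \<le> K * ell2_norm u" if "u \<in> ell2 UNIV" for u
    using K[of "Abs_l2 u"] that by (simp add: norm_l2_eq A mult.commute)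
  then show "\<exists>C. \<forall>u\<in>ell2 UNIV. ell2_norm (A u) \<le> C * ell2_norm u" by blast
qed

lemma bounded_op_subset:
  assumes A: "bounded_op UNIV A" and I: "\<And>u. u \<in> ell2 I \<Longrightarrow> A u \<in> ell2 I"
  shows "bounded_op I A"
proof -
  have sub: "u \<in> ell2 UNIV" if "u \<in> ell2 I" for u using that by (simp add: ell2_def)
  obtain C where C: "\<And>u. u \<in> ell2 UNIV \<Longrightarrow> ell2_norm (A u) \<le> C * ell2_norm u"
    using A unfolding bounded_op_def by blast
  show ?thesis
    unfolding bounded_op_def
    using I bounded_opD(2,3)[OF A sub] sub C by blast
qed

lemma bounded_op_comp:
  assumes A: "bounded_op UNIV A" and B: "bounded_op UNIV B"
  shows "bounded_op UNIV (\<lambda>u. A (B u))" "op_of (\<lambda>u. A (B u)) x = op_of A (op_of B x)"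
proof -
  show *: "bounded_op UNIV (\<lambda>u. A (B u))"
  proof (rule bounded_opI)
    show "bounded_linear (\<lambda>x. op_of A (op_of B x))"
      by (intro bounded_linear_compose[OF bounded_linear_op_of[OF A]] bounded_linear_op_of B)
  qed (simp_all add: op_of_cscale l2_fun_op_of A B)
  show "op_of (\<lambda>u. A (B u)) x = op_of A (op_of B x)"
    by (rule l2_eqI) (simp only: l2_fun_op_of A B *)
qed

lemma bounded_op_shifted:
  assumes A: "bounded_op UNIV A"
  shows "bounded_op UNIV (shifted A z)" "op_of (shifted A z) x = op_of A x - cscale z x"
proof -
  show *: "bounded_op UNIV (shifted A z)"
  proof (rule bounded_opI)
    show "bounded_linear (\<lambda>x. op_of A x - cscale z x)"
      by (intro bounded_linear_sub bounded_linear_op_of bounded_linear_cscale A)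
    show "op_of A (cscale c x) - cscale z (cscale c x) = cscale c (op_of A x - cscale z x)" for c x
      by (simp add: op_of_cscale A cscale_diff_right mult.commute)
  qed (simp add: l2_fun_op_of A shifted_def)
  show "op_of (shifted A z) x = op_of A x - cscale z x"
    by (rule l2_eqI) (simp add: l2_fun_op_of A * shifted_def)
qed

section \<open>Solvability of coercive equations, and closed subspaces enlarged by a line\<close>

lemma lax_milgram:
  fixes f :: "'a :: {real_inner, complete_space} \<Rightarrow> 'a"
  assumes f: "bounded_linear f" and "c > 0" and coercive: "\<And>x. c * (norm x)\<^sup>2 \<le> inner (f x) x"
  shows "\<exists>x. f x = y"
proof -
  obtain K0 where K0: "\<And>x. norm (f x) \<le> norm x * K0"
    using bounded_linear.bounded[OF f] by blast
  define K where "K = max K0 c"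
  have K: "K > 0" "c \<le> K" using \<open>c > 0\<close> by (auto simp: K_def)
  have fK: "norm (f x) \<le> K * norm x" for x
  proof -
    have "norm (f x) \<le> norm x * K0" by (rule K0)
    also have "\<dots> \<le> norm x * K" by (intro mult_left_mono) (auto simp: K_def)
    finally show ?thesis by (simp add: mult.commute)
  qed
  \<comment> \<open>A solution is a fixed point of \<open>g\<close>. For a step size
    \<open>t\<close> its squared Lipschitz constant is at most \<open>1 - 2 t c + t^2 K^2\<close>;
    this \<open>t\<close> minimises it, with value \<open>1 - c^2 / K^2\<close>, and
    \<open>c \<le> K\<close> makes the value nonnegative.\<close>
  define t where "t = c / K\<^sup>2"
  define q where "q = sqrt (1 - c\<^sup>2 / K\<^sup>2)"
  define g where "g = (\<lambda>x. x - t *\<^sub>R (f x - y))"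
  have "t > 0" using \<open>c > 0\<close> K by (simp add: t_def)
  have "c\<^sup>2 / K\<^sup>2 \<le> 1" using K \<open>c > 0\<close> by (simp add: power_mono)
  have "c\<^sup>2 / K\<^sup>2 > 0" using K \<open>c > 0\<close> by simp
  have q: "0 \<le> q" "q < 1" "q\<^sup>2 = 1 - c\<^sup>2 / K\<^sup>2"
    using \<open>c\<^sup>2 / K\<^sup>2 \<le> 1\<close> \<open>c\<^sup>2 / K\<^sup>2 > 0\<close> by (auto simp: q_def real_sqrt_lt_1_iff)
  have "dist (g u) (g v) \<le> q * dist u v" for u v
  proof (rule power2_le_imp_le)
    define d where "d = u - v"
    have "g u - g v = d - t *\<^sub>R f d"
      by (simp add: g_def d_def linear_diff[OF bounded_linear.linear[OF f]] algebra_simps)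
    then have dist: "dist (g u) (g v) = norm (d - t *\<^sub>R f d)" by (simp only: dist_norm)
    have "(dist (g u) (g v))\<^sup>2 = (norm d)\<^sup>2 - 2 * t * inner (f d) d + t\<^sup>2 * (norm (f d))\<^sup>2"
      unfolding dist power2_norm_eq_inner
      by (simp add: inner_diff_left inner_diff_right inner_commute power2_eq_square algebra_simps)
    also have "\<dots> \<le> (norm d)\<^sup>2 - 2 * t * (c * (norm d)\<^sup>2) + t\<^sup>2 * (K * norm d)\<^sup>2"
      using \<open>t > 0\<close> coercive[of d] fK[of d]
      by (intro add_mono diff_mono mult_left_mono power_mono) auto
    also have "\<dots> = q\<^sup>2 * (norm d)\<^sup>2"
      unfolding q(3) t_def using K by (simp add: field_simps power2_eq_square)
    finally show "(dist (g u) (g v))\<^sup>2 \<le> (q * dist u v)\<^sup>2"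
      by (simp add: power_mult_distrib dist_norm d_def)
  qed (use q in auto)
  then obtain x where "g x = x"
    using banach_fix_type[of q g] q by blast
  then have "f x = y" using \<open>t > 0\<close> by (simp add: g_def)
  then show ?thesis by blast
qed

lemma closed_subspace_plus_line:
  fixes V :: "'a :: real_normed_vector set"
  assumes V: "subspace V" "closed V"
  shows "closed {v + r *\<^sub>R x | v r. v \<in> V}"
proof (cases "x \<in> V")
  case True
  have "{v + r *\<^sub>R x | v r. v \<in> V} = V"
  proof
    show "{v + r *\<^sub>R x | v r. v \<in> V} \<subseteq> V"
      using True V(1) by (auto intro: subspace_add subspace_scale)
    show "V \<subseteq> {v + r *\<^sub>R x | v r. v \<in> V}"
      by (auto intro!: exI[of _ "0::real"])
  qed
  then show ?thesis using V by simp
next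
  case False
  then obtain \<delta> where "\<delta> > 0" and \<delta>: "ball x \<delta> \<subseteq> - V"
    using V(2) by (metis ComplI open_Compl open_contains_ball)
  \<comment> \<open>Since a ball of radius \<open>\<delta>\<close> around \<open>x\<close> misses
    \<open>V\<close>, the coefficient of \<open>x\<close> is controlled by the norm of the sum;
    hence the coefficients of a convergent sequence are Cauchy, and its parts in \<open>V\<close>
    converge too.\<close>
  have lower: "\<bar>r\<bar> * \<delta> \<le> norm (v + r *\<^sub>R x)" if "v \<in> V" for r v
  proof (cases "r = 0")
    case r: False
    have "- (1 / r) *\<^sub>R v \<in> V" using that V(1) by (rule subspace_scale[rotated])
    then have "- (1 / r) *\<^sub>R v \<notin> ball x \<delta>" using \<delta> by blast
    then have "\<delta> \<le> norm (x + (1 / r) *\<^sub>R v)" by (simp add: dist_norm)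
    then have "\<bar>r\<bar> * \<delta> \<le> norm (r *\<^sub>R (x + (1 / r) *\<^sub>R v))"
      by (simp add: mult_left_mono)
    also have "r *\<^sub>R (x + (1 / r) *\<^sub>R v) = v + r *\<^sub>R x"
      using r by (simp add: algebra_simps)
    finally show ?thesis .
  qed simp
  show ?thesis
    unfolding closed_sequential_limits
  proof (intro allI impI, elim conjE)
    fix Y y assume Y: "\<forall>n::nat. Y n \<in> {v + r *\<^sub>R x | v r. v \<in> V}" and lim: "Y \<longlonglongrightarrow> y"
    have "\<forall>n. \<exists>v r. Y n = v + r *\<^sub>R x \<and> v \<in> V" using Y by blast
    then obtain v r where vr: "\<And>n. Y n = v n + r n *\<^sub>R x" "\<And>n. v n \<in> V" by metis
    have "Cauchy r"
    proof (rule metric_CauchyI)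
      fix e :: real assume "e > 0"
      then obtain N where N: "\<And>m n. m \<ge> N \<Longrightarrow> n \<ge> N \<Longrightarrow> dist (Y m) (Y n) < e * \<delta>"
        using metric_CauchyD[OF LIMSEQ_imp_Cauchy[OF lim], of "e * \<delta>"] \<open>\<delta> > 0\<close>
        by (meson mult_pos_pos)
      have "dist (r m) (r n) < e" if "m \<ge> N" "n \<ge> N" for m n
      proof -
        have "\<bar>r m - r n\<bar> * \<delta> \<le> norm (v m - v n + (r m - r n) *\<^sub>R x)"
          by (intro lower subspace_diff V vr)
        also have "\<dots> = dist (Y m) (Y n)" by (simp add: vr dist_norm algebra_simps)
        also have "\<dots> < e * \<delta>" by (rule N) fact+
        finally show ?thesis using \<open>\<delta> > 0\<close> by (simp add: dist_real_def)
      qed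
      then show "\<exists>M. \<forall>m\<ge>M. \<forall>n\<ge>M. dist (r m) (r n) < e" by blast
    qed
    then obtain l where l: "r \<longlonglongrightarrow> l"
      using Cauchy_convergent convergentD by blast
    have "(\<lambda>n. Y n - r n *\<^sub>R x) \<longlonglongrightarrow> y - l *\<^sub>R x" by (intro tendsto_intros lim l)
    then have "y - l *\<^sub>R x \<in> V"
      by (rule closed_sequentially[OF V(2), rotated]) (use vr in simp)
    then show "y \<in> {v + r *\<^sub>R x | v r. v \<in> V}"
      by (intro CollectI exI[of _ "y - l *\<^sub>R x"] exI[of _ l]) simp
  qed
qed

section \<open>Coordinate projections and density of finitely supported vectors\<close>

lemma norm_l2_mono:
  assumes "\<And>i. cmod (l2_fun x i) \<le> cmod (l2_fun y i)"
  shows "norm x \<le> norm y"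
proof (rule power2_le_imp_le)
  show "(norm x)\<^sup>2 \<le> (norm y)\<^sup>2"
    unfolding norm_l2_square by (intro infsum_mono l2_fun_summable power_mono assms) auto
qed simp

lift_definition proj :: "'i set \<Rightarrow> 'i l2 \<Rightarrow> 'i l2" is "\<lambda>S u i. if i \<in> S then u i else 0"
  by (rule ell2_comparison[where C = 1]) auto

lemmas [simp] = proj.rep_eq

lemma proj_idem [simp]: "proj S (proj S x) = proj S x"
  by (rule l2_eqI) simp

lemma proj_ell2: "l2_fun (proj S x) \<in> ell2 S"
  by (subst ell2_iff) (auto simp del: proj.rep_eq, simp)

lemma proj_cancel: "l2_fun x \<in> ell2 S \<Longrightarrow> proj S x = x"
  by (rule l2_eqI) (auto simp: ell2_def)

lemma norm_proj_le: "norm (proj S x) \<le> norm x"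
  by (rule norm_l2_mono) simp

lemma bounded_linear_proj: "bounded_linear (proj S)"
  by (rule bounded_linear_intro[where K = 1]) (auto simp: norm_proj_le intro!: l2_eqI)

lemma inner_proj_left: "inner (proj S x) y = inner x (proj S y)"
  unfolding inner_l2.rep_eq by (intro infsum_cong) auto

lemma l2_finite_approximation:
  assumes "e > 0"
  shows "\<exists>F. finite F \<and> norm (x - proj F x) \<le> e"
proof -
  let ?f = "\<lambda>i. (cmod (l2_fun x i))\<^sup>2"
  obtain F where F: "finite F" "norm (sum ?f F - infsum ?f UNIV) \<le> e\<^sup>2"
    using infsum_finite_approximation[OF l2_fun_summable[of x UNIV], of "e\<^sup>2"] assms by (auto simp: dist_norm)
  have "(norm x)\<^sup>2 = (norm (proj F x))\<^sup>2 + (norm (x - proj F x))\<^sup>2"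
    unfolding power2_norm_eq_inner
    by (simp add: inner_diff_left inner_diff_right inner_proj_left inner_commute)
  moreover have "(norm (proj F x))\<^sup>2 = sum ?f F"
  proof -
    have "(norm (proj F x))\<^sup>2 = (\<Sum>\<^sub>\<infinity>i\<in>F. ?f i)"
      unfolding norm_l2_square by (intro infsum_cong_neutral) auto
    then show ?thesis using F by simp
  qed
  ultimately have "(norm (x - proj F x))\<^sup>2 \<le> e\<^sup>2"
    using F(2) unfolding norm_l2_square[of x] by simp
  then have "norm (x - proj F x) \<le> e" using assms by (simp add: power2_le_iff_abs_le)
  with F(1) show ?thesis by blast
qed

text \<open>Finitely supported vectors are dense in \<open>ell2 S\<close> and both sides are
  continuous. Lower bounds for the difference operators are proved by finite sums over a window, so
  this is the bridge to all of \<open>ell2 S\<close>.\<close>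

lemma lower_bound_from_finite_support:
  fixes x :: "'i l2" and T :: "'i l2 \<Rightarrow> 'j l2"
  assumes T: "bounded_linear T" and "c \<ge> 0"
    and fin: "\<And>y. l2_fun y \<in> ell2 S \<Longrightarrow> finite {i. l2_fun y i \<noteq> 0} \<Longrightarrow> c * norm y \<le> norm (T y)"
    and x: "l2_fun x \<in> ell2 S"
  shows "c * norm x \<le> norm (T x)"
proof (rule field_le_epsilon)
  fix e :: real assume "e > 0"
  obtain K where K: "K > 0" "\<And>x. norm (T x) \<le> norm x * K"
    using bounded_linear.pos_bounded[OF T] by blast
  \<comment> \<open>Replacing \<open>x\<close> by its truncation changes the left side by at most
    \<open>c * d\<close> and the right side by at most \<open>d * K\<close>.\<close>
  define d where "d = e / (c + K)"
  have "d > 0" using \<open>e > 0\<close> K \<open>c \<ge> 0\<close> by (simp add: d_def add_nonneg_pos)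
  then obtain F where F: "finite F" "norm (x - proj F x) \<le> d"
    using l2_finite_approximation by blast
  have "c * norm (proj F x) \<le> norm (T (proj F x))"
  proof (rule fin)
    show "l2_fun (proj F x) \<in> ell2 S"
      using x by (subst ell2_iff) (auto simp del: proj.rep_eq, auto simp: ell2_def)
    show "finite {i. l2_fun (proj F x) i \<noteq> 0}"
      by (rule finite_subset[OF _ F(1)]) auto
  qed
  moreover have "norm x \<le> norm (proj F x) + d"
    using norm_triangle_ineq[of "proj F x" "x - proj F x"] F by simp
  moreover have "norm (T (proj F x)) \<le> norm (T x) + d * K"
  proof -
    have "T (proj F x) = T x - T (x - proj F x)"
      by (simp add: linear_diff[OF bounded_linear.linear[OF T]])
    then have "norm (T (proj F x)) \<le> norm (T x) + norm (T (x - proj F x))"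
      by (simp add: norm_triangle_ineq4)
    also have "norm (T (x - proj F x)) \<le> norm (x - proj F x) * K" by (rule K)
    also have "\<dots> \<le> d * K" using F K by simp
    finally show ?thesis by simp
  qed
  moreover have "c * norm x \<le> c * (norm (proj F x) + d)"
    using \<open>c \<ge> 0\<close> calculation(2) by (rule mult_left_mono[rotated])
  moreover have "d * (c + K) = e" using K \<open>c \<ge> 0\<close> by (simp add: d_def)
  ultimately show "c * norm x \<le> norm (T x) + e" by (simp add: algebra_simps)
qed

lemma ell2_finite_support: "finite {i. u i \<noteq> 0} \<Longrightarrow> u \<in> ell2 UNIV"
  unfolding ell2_UNIV_iff by (rule finite_nonzero_values_imp_summable_on) simp

lift_definition unit_vec :: "'i \<Rightarrow> 'i l2" is "\<lambda>g i. if i = g then 1 else 0"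
  by (rule ell2_finite_support) simp

lemmas [simp] = unit_vec.rep_eq

section \<open>Fredholm and invertibility criteria\<close>

text \<open>Lax--Milgram for the operator that is \<open>T T'\<close> compressed to \<open>\<ell>\<^sup>2(S)\<close>, and the identity on
  the complement.\<close>

lemma compression_surj:
  assumes T: "bounded_linear T" and T': "bounded_linear T'"
    and adj: "\<And>x y. inner (T x) y = inner x (T' y)"
    and "c > 0" and lower: "\<And>x. l2_fun x \<in> ell2 S \<Longrightarrow> c * norm x \<le> norm (T' x)"
  shows "\<exists>w. proj S (T (T' (proj S w))) = proj S v"
proof -
  let ?Q = "\<lambda>x. proj S (T (T' (proj S x))) + (x - proj S x)"
  have Q: "bounded_linear ?Q"
    by (intro bounded_linear_add bounded_linear_sub bounded_linear_ident bounded_linear_proj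
      bounded_linear_compose[OF bounded_linear_proj] bounded_linear_compose[OF T]
      bounded_linear_compose[OF T'])
  \<comment> \<open>There are no cross terms: the compressed part pairs with \<open>proj S x\<close>
    to give the squared norm of \<open>T' (proj S x)\<close>, and the identity part gives the
    squared norm of the remaining component.\<close>
  have coercive: "min (c\<^sup>2) 1 * (norm x)\<^sup>2 \<le> inner (?Q x) x" for x
  proof -
    have split: "(norm x)\<^sup>2 = (norm (proj S x))\<^sup>2 + (norm (x - proj S x))\<^sup>2"
      unfolding power2_norm_eq_inner
      by (simp add: inner_diff_left inner_diff_right inner_proj_left inner_commute)
    have "inner (?Q x) x = (norm (T' (proj S x)))\<^sup>2 + (norm (x - proj S x))\<^sup>2"
      unfolding power2_norm_eq_inner
      by (simp add: inner_add_left inner_diff_left inner_diff_right inner_proj_left adj)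
    moreover have "c\<^sup>2 * (norm (proj S x))\<^sup>2 \<le> (norm (T' (proj S x)))\<^sup>2"
      using power_mono[OF lower[OF proj_ell2[of S x]], of 2] \<open>c > 0\<close> by (simp add: power_mult_distrib)
    moreover have "min (c\<^sup>2) 1 * (norm (proj S x))\<^sup>2 \<le> c\<^sup>2 * (norm (proj S x))\<^sup>2"
      by (intro mult_right_mono) auto
    moreover have "min (c\<^sup>2) 1 * (norm (x - proj S x))\<^sup>2 \<le> 1 * (norm (x - proj S x))\<^sup>2"
      by (intro mult_right_mono) auto
    ultimately show ?thesis unfolding split by (simp add: distrib_left)
  qed
  obtain w where w: "?Q w = proj S v"
    using lax_milgram[OF Q _ coercive] \<open>c > 0\<close> by auto
  then have "proj S (?Q w) = proj S v" by simp
  moreover have "proj S (?Q w) = proj S (T (T' (proj S w)))" by (intro l2_eqI) simp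
  ultimately show ?thesis by metis
qed

text \<open>Freeing one more coordinate \<open>g\<close> adds a complex line, that is, two real
  lines through the images of \<open>unit_vec g\<close> and \<open>cscale \<i> (unit_vec g)\<close>;
  each enlarges a closed subspace to a closed one.\<close>

lemma closed_image_finite_extension:
  assumes T: "bounded_linear T" and "closed (T ` {x. l2_fun x \<in> ell2 S})" and "finite F"
  shows "closed (T ` {x. l2_fun x \<in> ell2 (S \<union> F)})"
  using assms(3)
proof induction
  case empty
  then show ?case using assms(2) by simp
next
  case (insert g F)
  let ?X = "{x. l2_fun x \<in> ell2 (S \<union> F)}"
  let ?e = "unit_vec g" and ?e' = "cscale \<i> (unit_vec g)"
  let ?V = "{v + r *\<^sub>R T ?e | v r. v \<in> T ` ?X}"
  have lin: "linear T" using T by (rule bounded_linear.linear)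
  have X: "subspace ?X"
    by (auto simp: subspace_def ell2_iff[of _ "S \<union> F"] ell2_add ell2_cmult ell2_zero)
  have V0: "subspace (T ` ?X)" using lin X by (rule linear_subspace_image)
  have V: "subspace ?V"
  proof -
    have "?V = {x + y | x y. x \<in> T ` ?X \<and> y \<in> span {T ?e}}"
      by (auto simp: span_singleton)
    then show ?thesis using subspace_sums[OF V0 subspace_span, of "{T ?e}"] by simp
  qed
  have "closed {v + r *\<^sub>R T ?e' | v r. v \<in> ?V}"
    using closed_subspace_plus_line[OF V closed_subspace_plus_line[OF V0 insert.IH]] .
  also have "{v + r *\<^sub>R T ?e' | v r. v \<in> ?V} = T ` {x. l2_fun x \<in> ell2 (S \<union> insert g F)}"
  proof (intro equalityI subsetI)
    fix y assume "y \<in> {v + r *\<^sub>R T ?e' | v r. v \<in> ?V}"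
    then obtain x r r' where x: "x \<in> ?X" and y: "y = T x + r *\<^sub>R T ?e + r' *\<^sub>R T ?e'" by blast
    have "y = T (x + r *\<^sub>R ?e + r' *\<^sub>R ?e')"
      unfolding y by (simp only: linear_add[OF lin] linear_scale[OF lin])
    moreover have "l2_fun (x + r *\<^sub>R ?e + r' *\<^sub>R ?e') \<in> ell2 (S \<union> insert g F)"
      using x unfolding ell2_iff[of _ "S \<union> insert g F"] mem_Collect_eq
      by (intro conjI l2_fun_ell2) (auto simp: ell2_def)
    ultimately show "y \<in> T ` {x. l2_fun x \<in> ell2 (S \<union> insert g F)}" by blast
  next
    fix y assume "y \<in> T ` {x. l2_fun x \<in> ell2 (S \<union> insert g F)}"
    then obtain x where x: "l2_fun x \<in> ell2 (S \<union> insert g F)" and y: "y = T x" by blast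
    define x0 where "x0 = proj (S \<union> F) x"
    \<comment> \<open>If \<open>g\<close> already lies in \<open>S \<union> F\<close>, its
      coordinate is part of \<open>x0\<close> and must not be counted twice.\<close>
    define a where "a = (if g \<in> S \<union> F then 0 else l2_fun x g)"
    have "x = x0 + Re a *\<^sub>R ?e + Im a *\<^sub>R ?e'"
      using x by (intro l2_eqI) (auto simp: x0_def a_def ell2_def complex_eq_iff)
    then have "y = T x0 + Re a *\<^sub>R T ?e + Im a *\<^sub>R T ?e'"
      unfolding y by (metis linear_add[OF lin] linear_scale[OF lin])
    moreover have "x0 \<in> ?X" unfolding x0_def using proj_ell2 by blast
    ultimately show "y \<in> {v + r *\<^sub>R T ?e' | v r. v \<in> ?V}" by blast
  qed
  finally show ?case .
qed

lemma complete_ell2_subspace: "complete {x. l2_fun x \<in> ell2 S}"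
proof -
  have eq: "l2_fun x \<in> ell2 S \<longleftrightarrow> (\<forall>i. i \<notin> S \<longrightarrow> l2_fun x i = 0)" for x
    by (subst ell2_iff) simp
  have "closed {x. l2_fun x \<in> ell2 S}"
    unfolding closed_sequential_limits eq mem_Collect_eq
  proof (intro allI impI, elim conjE)
    fix X x i assume X: "\<forall>n::nat. \<forall>i. i \<notin> S \<longrightarrow> l2_fun (X n) i = 0" and lim: "X \<longlonglongrightarrow> x" and "i \<notin> S"
    have "(\<lambda>n. l2_fun (X n) i) = (\<lambda>n. 0)" using X \<open>i \<notin> S\<close> by blast
    then show "l2_fun x i = 0"
      using l2_fun_tendsto[OF lim, of i] by (simp add: LIMSEQ_const_iff)
  qed
  then show ?thesis by (simp add: complete_eq_closed)
qed

text \<open>A finite set \<open>F\<close> of coordinates is neglected. The kernel is at most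
  one-dimensional because the coordinate \<open>base\<close> determines its elements. The range is
  closed since it is the image of a complete space under a map bounded below, enlarged by finitely
  many dimensions. For the codimension, \<open>B B'\<close> compressed to \<open>I - F\<close> is
  onto, so every \<open>v\<close> agrees with an element of the range off \<open>F\<close>.\<close>

lemma fredholmI:
  fixes I :: "'i set" and base :: 'i
  assumes B: "bounded_op UNIV B" and B': "bounded_op UNIV B'"
    and adj: "\<And>x y. inner (op_of B x) y = inner x (op_of B' y)"
    and I: "\<And>u. u \<in> ell2 I \<Longrightarrow> B u \<in> ell2 I" and I': "\<And>u. u \<in> ell2 I \<Longrightarrow> B' u \<in> ell2 I"
    and F: "finite F" and "c > 0"
    and lower: "\<And>x. l2_fun x \<in> ell2 (I - F) \<Longrightarrow> c * norm x \<le> norm (op_of B x)"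
    and lower': "\<And>x. l2_fun x \<in> ell2 (I - F) \<Longrightarrow> c * norm x \<le> norm (op_of B' x)"
    and uniq: "\<And>u. u \<in> ell2 I \<Longrightarrow> B u = (\<lambda>i. 0) \<Longrightarrow> u base = 0 \<Longrightarrow> u = (\<lambda>i. 0)"
  shows "fredholm I B"
  unfolding fredholm_def
proof (intro conjI)
  let ?T = "op_of B"
  have T: "bounded_linear ?T" using B by (rule bounded_linear_op_of)
  have T': "bounded_linear (op_of B')" using B' by (rule bounded_linear_op_of)
  have sub: "u \<in> ell2 UNIV" if "u \<in> ell2 J" for u and J :: "'i set"
    using that by (simp add: ell2_def)
  show BI: "bounded_op I B" using B I by (rule bounded_op_subset)
  show "\<exists>E. finite E \<and> E \<subseteq> ell2 I \<and> {u \<in> ell2 I. B u = (\<lambda>i. 0)} \<subseteq> lin_combs E"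
  proof (cases "\<exists>k. k \<in> ell2 I \<and> B k = (\<lambda>i. 0) \<and> k \<noteq> (\<lambda>i. 0)")
    case True
    then obtain k where k: "k \<in> ell2 I" "B k = (\<lambda>i. 0)" "k \<noteq> (\<lambda>i. 0)" by blast
    then have ki: "k base \<noteq> 0" using uniq by blast
    have "u \<in> lin_combs {k}" if u: "u \<in> ell2 I" "B u = (\<lambda>i. 0)" for u
    proof -
      define d where "d = u base / k base"
      have dk: "(\<lambda>i. - d * k i) \<in> ell2 I"
        using k(1) ell2_cmult[of k "-d"] by (simp add: ell2_iff[of _ I])
      have "(\<lambda>i. u i + - d * k i) = (\<lambda>i. 0)"
      proof (rule uniq)
        show "(\<lambda>i. u i + - d * k i) \<in> ell2 I"
          using u(1) dk ell2_add[of u "\<lambda>i. - d * k i"] by (simp add: ell2_iff[of _ I])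
        show "B (\<lambda>i. u i + - d * k i) = (\<lambda>i. 0)"
          using bounded_opD(2)[OF BI u(1) dk] bounded_opD(3)[OF BI k(1), of "-d"] u(2) k(2)
          by (simp add: fun_eq_iff)
        show "u base + - d * k base = 0" using ki by (simp add: d_def)
      qed
      then have "u = (\<lambda>i. \<Sum>b\<in>{k}. d * b i)" by (simp add: fun_eq_iff)
      then show ?thesis unfolding lin_combs_def by (intro CollectI exI[of _ "\<lambda>_. d"])
    qed
    then show ?thesis using k(1) by (intro exI[of _ "{k}"]) auto
  next
    case False
    have "(\<lambda>i. 0) \<in> lin_combs {}" by (simp add: lin_combs_def)
    then show ?thesis using False by (intro exI[of _ "{}"]) auto
  qed
  show "\<forall>f. \<forall>v\<in>ell2 I. (\<forall>k. f k \<in> B ` ell2 I) \<and>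
      (\<lambda>k::nat. ell2_norm (\<lambda>i. f k i - v i)) \<longlonglongrightarrow> 0 \<longrightarrow> v \<in> B ` ell2 I"
  proof (intro allI ballI impI, elim conjE)
    fix f v assume v: "v \<in> ell2 I" and f: "\<forall>k. f k \<in> B ` ell2 I"
      and lim: "(\<lambda>k::nat. ell2_norm (\<lambda>i. f k i - v i)) \<longlonglongrightarrow> 0"
    let ?R = "\<lambda>J. ?T ` {x. l2_fun x \<in> ell2 J}"
    have "complete (?R (I - F))"
    proof (rule complete_isometric_image[OF \<open>c > 0\<close> _ T])
      show "subspace {x. l2_fun x \<in> ell2 (I - F)}"
        by (auto simp: subspace_def ell2_iff[of _ "I - F"] ell2_add ell2_cmult ell2_zero)
    qed (use lower complete_ell2_subspace in auto)
    then have "closed (?R (I - F))" by (rule complete_imp_closed)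
    then have "closed (?R ((I - F) \<union> (I \<inter> F)))"
      using F by (intro closed_image_finite_extension[OF T]) auto
    moreover have "(I - F) \<union> (I \<inter> F) = I" by blast
    ultimately have closed: "closed (?R I)" by simp
    have "\<forall>k. \<exists>g. g \<in> ell2 I \<and> f k = B g" using f by blast
    from choice[OF this] obtain g where g: "\<And>k. g k \<in> ell2 I" "\<And>k. f k = B (g k)" by blast
    have Tg: "l2_fun (?T (Abs_l2 (g k))) = f k" for k
      using g(1)[THEN sub] by (simp add: l2_fun_op_of B g(2))
    have mem: "?T (Abs_l2 (g k)) \<in> ?R I" for k
      using g(1)[of k] g(1)[THEN sub, of k] by (intro imageI) simp
    have "(\<lambda>k. ?T (Abs_l2 (g k))) \<longlonglongrightarrow> Abs_l2 v"
      using lim v[THEN sub]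
      by (subst tendsto_dist_iff) (simp add: dist_norm norm_l2_eq Tg)
    with closed mem have "Abs_l2 v \<in> ?R I" by (rule closed_sequentially)
    then obtain x where x: "l2_fun x \<in> ell2 I" "Abs_l2 v = ?T x" by blast
    then have "v = B (l2_fun x)"
      using Abs_l2_inverse'[OF v[THEN sub]] by (simp add: l2_fun_op_of[OF B])
    with x(1) show "v \<in> B ` ell2 I" by blast
  qed
  show "\<exists>E. finite E \<and> E \<subseteq> ell2 I \<and>
      (\<forall>v\<in>ell2 I. \<exists>r\<in>B ` ell2 I. \<exists>w\<in>lin_combs E. v = (\<lambda>i. r i + w i))"
  proof (intro exI conjI ballI)
    let ?e = "\<lambda>g. l2_fun (unit_vec g)"
    show "finite (?e ` (F \<inter> I))" using F by simp
    show "?e ` (F \<inter> I) \<subseteq> ell2 I"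
      by (auto simp del: unit_vec.rep_eq simp: ell2_iff[of _ I]) (simp, blast)
    have inj: "inj_on ?e (F \<inter> I)"
      by (rule inj_onI) (metis unit_vec.rep_eq zero_neq_one)
    fix v assume v: "v \<in> ell2 I"
    obtain w where w: "proj (I - F) (?T (op_of B' (proj (I - F) w))) = proj (I - F) (Abs_l2 v)"
      using compression_surj[OF T T' adj \<open>c > 0\<close> lower'] by blast
    define x where "x = op_of B' (proj (I - F) w)"
    have pw: "l2_fun (proj (I - F) w) \<in> ell2 I"
      using proj_ell2[of "I - F" w] by (auto simp: ell2_iff[of _ I] ell2_iff[of _ "I - F"] simp del: proj.rep_eq)
    then have x: "l2_fun x \<in> ell2 I" unfolding x_def l2_fun_op_of[OF B'] by (rule I')
    define r where "r = B (l2_fun x)"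
    have "r \<in> ell2 I" unfolding r_def using x by (rule I)
    have eq: "r i = v i" if "i \<in> I - F" for i
    proof -
      have "l2_fun (proj (I - F) (?T x)) i = l2_fun (proj (I - F) (Abs_l2 v)) i"
        unfolding x_def by (simp only: w)
      then show ?thesis using that v[THEN sub] by (simp add: r_def l2_fun_op_of B)
    qed
    \<comment> \<open>\<open>lin_combs\<close> indexes its coefficients by the vectors themselves,
      so the coordinate belonging to a unit vector is recovered by \<open>inv_into\<close>, using
      that distinct coordinates have distinct unit vectors.\<close>
    have "(\<lambda>i. \<Sum>b\<in>?e ` (F \<inter> I). (v (inv_into (F \<inter> I) ?e b) - r (inv_into (F \<inter> I) ?e b)) * b i)
        = (\<lambda>i. v i - r i)"
    proof
      fix i
      have "(\<Sum>b\<in>?e ` (F \<inter> I). (v (inv_into (F \<inter> I) ?e b) - r (inv_into (F \<inter> I) ?e b)) * b i)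
          = (\<Sum>g\<in>F \<inter> I. (v g - r g) * ?e g i)"
        by (subst sum.reindex[OF inj]) (simp add: inv_into_f_f[OF inj] del: unit_vec.rep_eq)
      also have "\<dots> = (\<Sum>g\<in>F \<inter> I. if g = i then v i - r i else 0)"
        by (intro sum.cong) auto
      also have "\<dots> = v i - r i"
        using F eq[of i] v \<open>r \<in> ell2 I\<close> by (cases "i \<in> I") (auto simp: sum.delta' ell2_def)
      finally show "(\<Sum>b\<in>?e ` (F \<inter> I). (v (inv_into (F \<inter> I) ?e b) - r (inv_into (F \<inter> I) ?e b)) * b i)
          = v i - r i" .
    qed
    then have "(\<lambda>i. v i - r i) \<in> lin_combs (?e ` (F \<inter> I))"
      unfolding lin_combs_def
      by (intro CollectI exI[of _ "\<lambda>b. v (inv_into (F \<inter> I) ?e b) - r (inv_into (F \<inter> I) ?e b)"]) (rule sym)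
    moreover have "r \<in> B ` ell2 I" unfolding r_def using x by blast
    ultimately show "\<exists>r\<in>B ` ell2 I. \<exists>w\<in>lin_combs (?e ` (F \<inter> I)). v = (\<lambda>i. r i + w i)"
      by (intro bexI[of _ r] bexI[of _ "\<lambda>i. v i - r i"]) auto
  qed
qed

text \<open>The bound for \<open>B\<close> gives injectivity. The bound for the adjoint makes
  \<open>B B'\<close> coercive and hence onto, so \<open>B\<close> is onto.\<close>

lemma invertible_opI:
  assumes B: "bounded_op UNIV B" and B': "bounded_op UNIV B'"
    and adj: "\<And>x y. inner (op_of B x) y = inner x (op_of B' y)" and "c > 0"
    and lower: "\<And>x. c * norm x \<le> norm (op_of B x)" and lower': "\<And>x. c * norm x \<le> norm (op_of B' x)"
  shows "invertible_op UNIV B"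
  unfolding invertible_op_def
proof (intro conjI)
  have T: "bounded_linear (op_of B)" using B by (rule bounded_linear_op_of)
  have below: "ell2_norm u \<le> (1 / c) * ell2_norm (B u)" if "u \<in> ell2 UNIV" for u
    using lower[of "Abs_l2 u"] that \<open>c > 0\<close>
    by (simp add: norm_l2_eq l2_fun_op_of B field_simps)
  then show "\<exists>C. \<forall>u\<in>ell2 UNIV. ell2_norm u \<le> C * ell2_norm (B u)" by blast
  have "bij (op_of B)"
  proof (rule bijI)
    show "inj (op_of B)"
    proof (rule injI)
      fix x y assume "op_of B x = op_of B y"
      then have "op_of B (x - y) = 0" by (simp add: linear_diff[OF bounded_linear.linear[OF T]])
      then show "x = y" using lower[of "x - y"] \<open>c > 0\<close> by (simp add: mult_le_0_iff)
    qed
    show "surj (op_of B)"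
    proof (rule surjI)
      fix v
      have "\<exists>w. op_of B (op_of B' w) = v"
        using compression_surj[OF T bounded_linear_op_of[OF B'] adj \<open>c > 0\<close> lower', of UNIV v]
        by (simp add: proj_cancel)
      then show "op_of B (op_of B' (SOME w. op_of B (op_of B' w) = v)) = v" by (rule someI_ex)
    qed
  qed
  show "bij_betw B (ell2 UNIV) (ell2 UNIV)"
    unfolding bij_betw_def
  proof (intro conjI inj_onI equalityI subsetI)
    have Abs: "l2_fun (op_of B (Abs_l2 u)) = B u" if "u \<in> ell2 UNIV" for u
      using that by (simp add: l2_fun_op_of B)
    show "u = v" if "u \<in> ell2 UNIV" "v \<in> ell2 UNIV" "B u = B v" for u v
    proof -
      have "op_of B (Abs_l2 u) = op_of B (Abs_l2 v)"
        by (rule l2_eqI) (simp add: Abs that)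
      then have "Abs_l2 u = Abs_l2 v" using \<open>bij (op_of B)\<close> by (simp add: bij_def inj_eq)
      then show ?thesis using that by (simp add: Abs_l2_inject)
    qed
    show "v \<in> ell2 UNIV" if "v \<in> B ` ell2 UNIV" for v
      using that bounded_opD(1)[OF B] by blast
    show "v \<in> B ` ell2 UNIV" if "v \<in> ell2 UNIV" for v
    proof -
      obtain w where "op_of B w = Abs_l2 v" using \<open>bij (op_of B)\<close> by (metis bij_pointE)
      then have "B (l2_fun w) = v" using l2_fun_op_of[OF B, of w] that by simp
      then show ?thesis using l2_fun_ell2 by blast
    qed
  qed
qed (fact B)

lemma not_invertible_opI:
  assumes "\<And>\<epsilon>. \<epsilon> > 0 \<Longrightarrow> \<exists>u\<in>ell2 I. ell2_norm u > 0 \<and> ell2_norm (B u) \<le> \<epsilon> * ell2_norm u"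
  shows "\<not> invertible_op I B"
proof
  assume "invertible_op I B"
  then obtain C where C: "\<And>u. u \<in> ell2 I \<Longrightarrow> ell2_norm u \<le> C * ell2_norm (B u)"
    unfolding invertible_op_def by blast
  \<comment> \<open>\<open>C\<close> is not known to be positive, and \<open>1 / (2 * D)\<close> has
    to be an admissible \<open>\<epsilon>\<close>.\<close>
  define D where "D = max C 1"
  have "D > 0" by (simp add: D_def)
  obtain u where u: "u \<in> ell2 I" "ell2_norm u > 0" "ell2_norm (B u) \<le> (1 / (2 * D)) * ell2_norm u"
    using assms[of "1 / (2 * D)"] \<open>D > 0\<close> by auto
  have "ell2_norm u \<le> C * ell2_norm (B u)" using C u by blast
  also have "\<dots> \<le> D * ell2_norm (B u)"
    by (intro mult_right_mono) (auto simp: D_def ell2_norm_def infsum_nonneg)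
  also have "\<dots> \<le> D * ((1 / (2 * D)) * ell2_norm u)" using u \<open>D > 0\<close> by (intro mult_left_mono) auto
  also have "\<dots> = ell2_norm u / 2" using \<open>D > 0\<close> by simp
  finally show False using u(2) by simp
qed

text \<open>A Weyl sequence \<open>x\<close> with disjoint supports is summed along the even and along the odd
  indices.  If the range were closed, both sums would differ from formal solutions of \<open>B h = 0\<close>
  by square summable functions; since formal solutions form a space of dimension at most one, a
  non-trivial combination of the two sums would itself be square summable.\<close>

lemma not_fredholmI:
  fixes I :: "nat set"
  assumes B: "bounded_op UNIV B"
    and add: "\<And>u v. B (\<lambda>i. u i + v i) = (\<lambda>i. B u i + B v i)"
    and cmult: "\<And>c u. B (\<lambda>i. c * u i) = (\<lambda>i. c * B u i)"
    and local: "\<And>u v n. (\<And>m. m \<le> n + b \<Longrightarrow> u m = v m) \<Longrightarrow> B u n = B v n"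
    and I: "\<And>u. u \<in> ell2 I \<Longrightarrow> B u \<in> ell2 I"
    and uniq: "\<And>h. (\<And>i. i \<notin> I \<Longrightarrow> h i = 0) \<Longrightarrow> B h = (\<lambda>i. 0) \<Longrightarrow> h base = 0 \<Longrightarrow> h = (\<lambda>i. 0)"
    and weyl: "\<And>N \<epsilon>. \<epsilon> > 0 \<Longrightarrow> \<exists>u\<in>ell2 (I \<inter> {N..}). finite {i. u i \<noteq> 0} \<and> ell2_norm u > 0 \<and>
      ell2_norm (B u) \<le> \<epsilon> * ell2_norm u"
  shows "\<not> fredholm I B"
proof
  assume fred: "fredholm I B"
  let ?T = "op_of B"
  have T: "bounded_linear ?T" using B by (rule bounded_linear_op_of)
  have lin: "linear ?T" using T by (rule bounded_linear.linear)
  have step: "\<exists>x M. norm x = 1 \<and> l2_fun x \<in> ell2 (I \<inter> {N..<M}) \<and> norm (?T x) \<le> \<epsilon> \<and> N < M"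
    if \<epsilon>: "\<epsilon> > 0" for N \<epsilon>
  proof -
    obtain u where u: "u \<in> ell2 (I \<inter> {N..})" "finite {i. u i \<noteq> 0}" "ell2_norm u > 0"
      "ell2_norm (B u) \<le> \<epsilon> * ell2_norm u"
      using weyl[OF \<epsilon>] by blast
    have u': "u \<in> ell2 UNIV" using u(1) ell2_iff by blast
    define x where "x = (1 / ell2_norm u) *\<^sub>R Abs_l2 u"
    obtain M where M: "\<And>i. u i \<noteq> 0 \<Longrightarrow> i < M"
      using finite_nat_set_iff_bounded[of "{i. u i \<noteq> 0}"] u(2) by blast
    have "norm x = 1" using u(3) by (simp add: x_def norm_Abs_l2[OF u'])
    moreover have "l2_fun x \<in> ell2 (I \<inter> {N..<max M (Suc N)})"
    proof -
      have "u i = 0" if "i \<notin> I \<inter> {N..<max M (Suc N)}" for i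
        using that u(1) M[of i] by (auto simp: ell2_def)
      then show ?thesis
        by (subst ell2_iff) (simp add: x_def u' del: scaleR_l2.rep_eq, simp add: scaleR_l2.rep_eq u')
    qed
    moreover have "norm (?T x) \<le> \<epsilon>"
    proof -
      have "norm (?T (Abs_l2 u)) = ell2_norm (B u)"
        by (simp add: norm_l2_eq l2_fun_op_of B u')
      then show ?thesis
        using u(3,4) by (simp add: x_def linear_scale[OF lin] field_simps)
    qed
    ultimately show ?thesis by (intro exI[of _ x] exI[of _ "max M (Suc N)"]) auto
  qed
  \<comment> \<open>Each pair holds a unit vector and a bound for its support; the next vector
    starts at or beyond that bound. The images decay like \<open>(1 / 2) ^ n\<close>, so that every
    series with bounded coefficients has a convergent image.\<close>
  have "\<exists>f. \<forall>n. (norm (fst (f n)) = 1 \<and> l2_fun (fst (f n)) \<in> ell2 (I \<inter> {..<snd (f n)}) \<and>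
      norm (?T (fst (f n))) \<le> (1 / 2) ^ n) \<and>
      (l2_fun (fst (f (Suc n))) \<in> ell2 {snd (f n)..} \<and> snd (f n) < snd (f (Suc n)))"
  proof (rule dependent_nat_choice)
    obtain x M where "norm x = 1" "l2_fun x \<in> ell2 (I \<inter> {0..<M})" "norm (?T x) \<le> 1"
      using step[of 1 0] by auto
    then show "\<exists>y. norm (fst y) = 1 \<and> l2_fun (fst y) \<in> ell2 (I \<inter> {..<snd y}) \<and>
        norm (?T (fst y)) \<le> (1 / 2) ^ 0"
      by (intro exI[of _ "(x, M)"]) (simp add: atLeast0LessThan)
  next
    fix y :: "nat l2 \<times> nat" and n :: nat
    obtain x M where x: "norm x = 1" "l2_fun x \<in> ell2 (I \<inter> {snd y..<M})"
        "norm (?T x) \<le> (1 / 2) ^ Suc n" "snd y < M"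
      using step[of "(1 / 2) ^ Suc n" "snd y"] by auto
    have "l2_fun x \<in> ell2 (I \<inter> {..<M})" "l2_fun x \<in> ell2 {snd y..}"
      using x(2) unfolding ell2_def by auto
    with x show "\<exists>z. (norm (fst z) = 1 \<and> l2_fun (fst z) \<in> ell2 (I \<inter> {..<snd z}) \<and>
        norm (?T (fst z)) \<le> (1 / 2) ^ Suc n) \<and> (l2_fun (fst z) \<in> ell2 {snd y..} \<and> snd y < snd z)"
      by (intro exI[of _ "(x, M)"]) simp
  qed
  then obtain f where f: "\<And>n. norm (fst (f n)) = 1" "\<And>n. l2_fun (fst (f n)) \<in> ell2 (I \<inter> {..<snd (f n)})"
      "\<And>n. norm (?T (fst (f n))) \<le> (1 / 2) ^ n" "\<And>n. l2_fun (fst (f (Suc n))) \<in> ell2 {snd (f n)..}"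
      "\<And>n. snd (f n) < snd (f (Suc n))"
    by blast
  define x where "x = (\<lambda>n. fst (f n))"
  define M where "M = (\<lambda>n. snd (f n))"
  have x1: "norm (x n) = 1" and xT: "norm (?T (x n)) \<le> (1 / 2) ^ n" for n
    using f by (auto simp: x_def)
  have xI: "l2_fun (x n) i = 0" if "i \<notin> I" for n i
    using f(2)[of n] that by (auto simp: x_def ell2_def)
  have M: "strict_mono M" using f(5) by (simp add: strict_mono_Suc_iff M_def)
  have x_lower: "l2_fun (x (Suc n)) i = 0" if "i < M n" for n i
    using f(4)[of n] that by (auto simp: x_def M_def ell2_def)
  have x_upper: "l2_fun (x n) i = 0" if "M n \<le> i" for n i
    using f(2)[of n] that by (auto simp: x_def M_def ell2_def)
  \<comment> \<open>The bounds \<open>M\<close> strictly increase, so the \<open>n\<close>-th vector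
    lives on coordinates from \<open>n - 1\<close> on. Only the vectors with
    \<open>k \<le> i + 1\<close> can meet coordinate \<open>i\<close>, which turns the infinite sum
    into the finite sum \<open>s\<close>.\<close>
  have late: "l2_fun (x n) i = 0" if "i + 1 < n" for n i
  proof (cases n)
    case (Suc k)
    then have "i < M k" using that strict_mono_imp_increasing[OF M, of k] by linarith
    then show ?thesis using x_lower Suc by simp
  qed (use that in simp)
  have disjoint: "l2_fun (x j) i = 0 \<or> l2_fun (x k) i = 0" if "j < k" for j k i
  proof (cases "i < M j")
    case True
    obtain k' where k': "k = Suc k'" using \<open>j < k\<close> by (cases k) auto
    have "M j \<le> M k'" using that k' strict_mono_leD[OF M] by simp
    then show ?thesis using True x_lower[of i k'] k' by simp
  qed (use x_upper[of j i] in simp)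
  define s where "s = (\<lambda>c i. \<Sum>k\<le>i + 1. c k * l2_fun (x k) i)"
  define P where "P = (\<lambda>c K. \<Sum>k\<le>K. cscale (c k) (x k))"
  have lsum: "l2_fun (\<Sum>k\<in>A. g k) i = (\<Sum>k\<in>A. l2_fun (g k) i)" if "finite A" for A :: "nat set" and g :: "nat \<Rightarrow> nat l2" and i
    using that by induction auto
  have P: "l2_fun (P c K) i = s c i" if "i + 1 \<le> K" for c K i
    unfolding P_def s_def lsum[OF finite_atMost] cscale.rep_eq
    by (rule sum.mono_neutral_right) (use that late in auto)
  \<comment> \<open>The images of the partial sums converge to some \<open>y\<close>, and closed
    range gives \<open>y = B w\<close>. Since \<open>B\<close> looks only finitely far ahead,
    \<open>B (s c)\<close> equals \<open>y\<close> coordinatewise although \<open>s c\<close> need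
    not be square summable, so \<open>s c - w\<close> is a formal solution.\<close>
  have key: "\<exists>w\<in>ell2 I. B (\<lambda>i. s c i - w i) = (\<lambda>i. 0)" if c: "\<And>k. cmod (c k) \<le> 1" for c
  proof -
    have TP: "?T (P c K) = (\<Sum>k\<le>K. ?T (cscale (c k) (x k)))" for K
      unfolding P_def by (rule linear_sum[OF lin])
    have "summable (\<lambda>k. norm (?T (cscale (c k) (x k))))"
    proof (rule summable_comparison_test')
      show "summable (\<lambda>k. (1 / 2 :: real) ^ k)" by (rule summable_geometric) simp
      show "norm (norm (?T (cscale (c k) (x k)))) \<le> (1 / 2) ^ k" for k
        using mult_mono[OF c[of k] xT[of k]] by (simp add: op_of_cscale B)
    qed
    then have "summable (\<lambda>k. ?T (cscale (c k) (x k)))" by (rule summable_norm_cancel)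
    then obtain y where y: "(\<lambda>K. ?T (P c K)) \<longlonglongrightarrow> y"
      unfolding TP using summable_LIMSEQ' by blast
    have PI: "l2_fun (P c K) \<in> ell2 I" for K
      by (subst ell2_iff) (simp add: P_def lsum xI)
    have mem: "B (l2_fun (P c K)) \<in> B ` ell2 I" for K using PI by blast
    have yI: "l2_fun y \<in> ell2 I"
    proof -
      have "l2_fun y i = 0" if "i \<notin> I" for i
      proof -
        have "l2_fun (?T (P c K)) i = 0" for K
          using I[OF PI[of K]] that by (simp add: l2_fun_op_of B ell2_def)
        with l2_fun_tendsto[OF y, of i] show ?thesis by (simp add: LIMSEQ_const_iff)
      qed
      then show ?thesis by (subst ell2_iff) simp
    qed
    have lim: "(\<lambda>K. ell2_norm (\<lambda>i. B (l2_fun (P c K)) i - l2_fun y i)) \<longlonglongrightarrow> 0"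
      using y by (subst (asm) tendsto_dist_iff) (simp add: dist_norm norm_l2_eq l2_fun_op_of B)
    have "l2_fun y \<in> B ` ell2 I"
      using fred yI mem lim unfolding fredholm_def
      by (elim conjE) (drule spec[of _ "\<lambda>K. B (l2_fun (P c K))"], blast)
    then obtain w where w: "w \<in> ell2 I" "l2_fun y = B w" by blast
    have "B (\<lambda>i. s c i - w i) n = 0" for n
    proof -
      have "B (\<lambda>i. s c i + (-1) * w i) n = B (s c) n + (-1) * B w n"
        unfolding add cmult ..
      moreover have "B (s c) n = l2_fun y n"
      proof -
        have "l2_fun (?T (P c K)) n = B (s c) n" if "K \<ge> n + b + 1" for K
          unfolding l2_fun_op_of[OF B] using that by (intro local P) simp
        then have "eventually (\<lambda>K. l2_fun (?T (P c K)) n = B (s c) n) sequentially"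
          by (auto simp: eventually_at_top_linorder)
        then have "(\<lambda>K. l2_fun (?T (P c K)) n) \<longlonglongrightarrow> B (s c) n" by (rule tendsto_eventually)
        then show ?thesis using l2_fun_tendsto[OF y, of n] LIMSEQ_unique by blast
      qed
      ultimately show ?thesis by (simp add: w(2))
    qed
    then show ?thesis using w(1) by (intro bexI[of _ w]) auto
  qed
  define ce :: "nat \<Rightarrow> complex" where "ce = (\<lambda>k. if even k then 1 else 0)"
  define co :: "nat \<Rightarrow> complex" where "co = (\<lambda>k. if odd k then 1 else 0)"
  have unit: "cmod (ce k) \<le> 1" "cmod (co k) \<le> 1" for k by (simp_all add: ce_def co_def)
  from key[OF unit(1)] obtain we where we: "we \<in> ell2 I" "B (\<lambda>i. s ce i - we i) = (\<lambda>i. 0)"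
    ..
  from key[OF unit(2)] obtain wo where wo: "wo \<in> ell2 I" "B (\<lambda>i. s co i - wo i) = (\<lambda>i. 0)"
    ..
  define he where "he = (\<lambda>i. s ce i - we i)"
  define ho where "ho = (\<lambda>i. s co i - wo i)"
  \<comment> \<open>Two formal solutions and one coordinate \<open>base\<close> that decides
    vanishing: some nontrivial combination vanishes identically.\<close>
  obtain p q where pq: "p * he base + q * ho base = 0" "p \<noteq> 0 \<or> q \<noteq> 0"
  proof (cases "he base = 0")
    case True
    then show ?thesis using that[of 1 0] by simp
  next
    case False
    then show ?thesis using that[of "ho base" "- he base"] by simp
  qed
  have sI: "s c i = 0" if "i \<notin> I" for c i unfolding s_def using xI[OF that] by simp
  have pq0: "(\<lambda>i. p * he i + q * ho i) = (\<lambda>i. 0)"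
  proof (rule uniq)
    show "p * he i + q * ho i = 0" if "i \<notin> I" for i
      using that we(1) wo(1) sI[OF that] by (simp add: he_def ho_def ell2_def)
    have "B he = (\<lambda>i. 0)" "B ho = (\<lambda>i. 0)" using we wo by (auto simp: he_def ho_def)
    then show "B (\<lambda>i. p * he i + q * ho i) = (\<lambda>i. 0)" unfolding add cmult by simp
  qed (rule pq)
  have eq: "p * s ce i + q * s co i = p * we i + q * wo i" for i
    using fun_cong[OF pq0, of i] by (simp add: he_def ho_def algebra_simps)
  define c where "c = (\<lambda>k. p * ce k + q * co k)"
  define G where "G = Abs_l2 (s c)"
  have "s c = (\<lambda>i. p * we i + q * wo i)"
  proof
    fix i
    have "s c i = p * s ce i + q * s co i"
      unfolding s_def c_def by (simp add: sum_distrib_left sum.distrib algebra_simps)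
    then show "s c i = p * we i + q * wo i" by (simp add: eq)
  qed
  moreover have "we \<in> ell2 UNIV" "wo \<in> ell2 UNIV" using we(1) wo(1) by (auto simp: ell2_def)
  ultimately have G: "l2_fun G = s c"
    unfolding G_def by (intro Abs_l2_inverse) (simp add: ell2_add ell2_cmult)
  \<comment> \<open>\<open>c\<close> takes the value \<open>p\<close> at even and \<open>q\<close>
    at odd indices, and one of them is nonzero.\<close>
  have infinite: "\<exists>\<delta>>0. \<forall>m. \<exists>k>m. \<delta> \<le> cmod (c k)"
  proof (cases "p = 0")
    case True
    have "\<exists>k>m. cmod q \<le> cmod (c k)" for m
      by (rule exI[of _ "Suc (2 * m)"]) (auto simp: c_def ce_def co_def)
    then show ?thesis using pq True by (intro exI[of _ "cmod q"]) auto
  next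
    case False
    have "\<exists>k>m. cmod p \<le> cmod (c k)" for m
      by (rule exI[of _ "2 * Suc m"]) (auto simp: c_def ce_def co_def)
    then show ?thesis using False by (intro exI[of _ "cmod p"]) auto
  qed
  then obtain \<delta> where \<delta>: "\<delta> > 0" "\<And>m. \<exists>k>m. \<delta> \<le> cmod (c k)" by blast
  obtain F where F: "finite F" "norm (G - proj F G) \<le> \<delta> / 2"
    using l2_finite_approximation[of "\<delta> / 2" G] \<delta>(1) by auto
  obtain m where m: "\<And>i. i \<in> F \<Longrightarrow> i < m" using finite_nat_set_iff_bounded F(1) by auto
  obtain k where k: "k > m + 1" "\<delta> \<le> cmod (c k)" using \<delta>(2) by blast
  \<comment> \<open>The supports are disjoint, so on the support of \<open>x k\<close> the sum
    \<open>G\<close> equals the single term; this support lies beyond \<open>F\<close>. One block of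
    norm at least \<open>\<delta>\<close> thus sits inside a remainder of norm at most
    \<open>\<delta> / 2\<close>.\<close>
  have "norm (cscale (c k) (x k)) \<le> norm (G - proj F G)"
  proof (rule norm_l2_mono)
    fix i
    show "cmod (l2_fun (cscale (c k) (x k)) i) \<le> cmod (l2_fun (G - proj F G) i)"
    proof (cases "l2_fun (x k) i = 0")
      case False
      have "k \<le> i + 1" using late[of i k] False by linarith
      then have "i \<notin> F" using m[of i] k(1) by auto
      have "s c i = (\<Sum>j\<in>{k}. c j * l2_fun (x j) i)"
        unfolding s_def
      proof (rule sum.mono_neutral_right)
        show "\<forall>j\<in>{..i + 1} - {k}. c j * l2_fun (x j) i = 0"
          using disjoint[of _ k i] disjoint[of k _ i] False by (metis DiffD2 insertI1 linorder_neqE_nat mult_zero_right)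
      qed (use \<open>k \<le> i + 1\<close> in auto)
      then show ?thesis using \<open>i \<notin> F\<close> by (simp add: G)
    qed simp
  qed
  then show False using F(2) k(2) \<delta>(1) by (simp add: x1)
qed

section \<open>Tridiagonal operators\<close>

lemma bounded_op_multiplication:
  assumes "\<And>i. cmod (m i) \<le> K"
  shows "bounded_op UNIV (\<lambda>u i. m i * u i)"
    "inner (op_of (\<lambda>u i. m i * u i) x) y = inner x (op_of (\<lambda>u i. cnj (m i) * u i) y)"
proof -
  have *: "bounded_op UNIV (\<lambda>u i. m i * u i)" if m: "\<And>i. cmod (m i) \<le> K" for m :: "'a \<Rightarrow> complex"
  proof -
    have comp: "cmod (m i * u i) \<le> cmod (complex_of_real K * u i)" for u :: "'a \<Rightarrow> complex" and i
    proof -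
      have "0 \<le> K" using m[of i] norm_ge_zero order_trans by blast
      then show ?thesis using m[of i] by (simp add: norm_mult mult_right_mono)
    qed
    have mem: "(\<lambda>i. m i * u i) \<in> ell2 UNIV" if "u \<in> ell2 UNIV" for u
      by (rule ell2_comparison[OF ell2_cmult[OF that, of "complex_of_real K"], of _ 1]) (use comp in simp)
    have "ell2_norm (\<lambda>i. m i * u i) \<le> \<bar>K\<bar> * ell2_norm u" if "u \<in> ell2 UNIV" for u
    proof -
      have "norm (Abs_l2 (\<lambda>i. m i * u i)) \<le> norm (cscale (complex_of_real K) (Abs_l2 u))"
        using comp by (intro norm_l2_mono) (simp add: mem that)
      then show ?thesis by (simp add: norm_Abs_l2 mem that)
    qed
    then have "\<exists>C. \<forall>u\<in>ell2 UNIV. ell2_norm (\<lambda>i. m i * u i) \<le> C * ell2_norm u" by blast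
    then show ?thesis
      unfolding bounded_op_def using mem by (simp add: distrib_left mult.left_commute)
  qed
  show "bounded_op UNIV (\<lambda>u i. m i * u i)" using * assms .
  have "bounded_op UNIV (\<lambda>u i. cnj (m i) * u i)" using assms by (intro *) simp
  then show "inner (op_of (\<lambda>u i. m i * u i) x) y = inner x (op_of (\<lambda>u i. cnj (m i) * u i) y)"
    unfolding inner_l2.rep_eq using *[OF assms] by (simp add: l2_fun_op_of mult_ac)
qed

text \<open>\<open>L\<close> composes with an injection and \<open>R\<close> is its adjoint,
  extension by zero off the range. For \<open>Suc\<close> these are the one-sided shifts; for the
  successor on the integers they are inverse to each other.\<close>

lemma bounded_op_shift:
  fixes s :: "'i \<Rightarrow> 'i"
  assumes s: "inj s"
  defines "L \<equiv> \<lambda>u i. u (s i)"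
    and "R \<equiv> \<lambda>u i. if i \<in> range s then u (inv s i) else 0"
  shows "bounded_op UNIV L" "bounded_op UNIV R" "inner (op_of L x) y = inner x (op_of R y)"
proof -
  have L_sum: "L u \<in> ell2 UNIV" "ell2_norm (L u) \<le> ell2_norm u" if u: "u \<in> ell2 UNIV" for u
  proof -
    have sum: "(\<lambda>i. (cmod (u i))\<^sup>2) summable_on range s"
      using l2_fun_summable[of "Abs_l2 u"] u by simp
    then have "(\<lambda>i. (cmod (u i))\<^sup>2) \<circ> s summable_on UNIV" using summable_on_reindex[OF s] by blast
    then show "L u \<in> ell2 UNIV" by (simp add: L_def ell2_UNIV_iff o_def)
    have "(\<Sum>\<^sub>\<infinity>i. (cmod (L u i))\<^sup>2) = (\<Sum>\<^sub>\<infinity>i\<in>range s. (cmod (u i))\<^sup>2)"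
      using infsum_reindex[OF s, of "\<lambda>i. (cmod (u i))\<^sup>2"] by (simp add: L_def o_def)
    also have "\<dots> \<le> (\<Sum>\<^sub>\<infinity>i. (cmod (u i))\<^sup>2)"
      using u sum by (intro infsum_mono_neutral) (auto simp: ell2_UNIV_iff)
    finally show "ell2_norm (L u) \<le> ell2_norm u" by (simp add: ell2_norm_def)
  qed
  show L: "bounded_op UNIV L"
    unfolding bounded_op_def using L_sum
    by (auto simp: L_def intro!: exI[of _ "1::real"])
  have R_sum: "R u \<in> ell2 UNIV" "ell2_norm (R u) = ell2_norm u" if u: "u \<in> ell2 UNIV" for u
  proof -
    have Rs: "(\<lambda>i. (cmod (R u i))\<^sup>2) \<circ> s = (\<lambda>i. (cmod (u i))\<^sup>2)"
      using s by (auto simp: R_def)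
    have "(\<lambda>i. (cmod (R u i))\<^sup>2) summable_on range s"
      using summable_on_reindex[OF s, of "\<lambda>i. (cmod (R u i))\<^sup>2"] u unfolding Rs by (simp add: ell2_UNIV_iff)
    also have "?this \<longleftrightarrow> (\<lambda>i. (cmod (R u i))\<^sup>2) summable_on UNIV"
      by (intro summable_on_cong_neutral) (auto simp: R_def)
    finally show "R u \<in> ell2 UNIV" by (simp add: ell2_UNIV_iff)
    have "(\<Sum>\<^sub>\<infinity>i. (cmod (R u i))\<^sup>2) = (\<Sum>\<^sub>\<infinity>i\<in>range s. (cmod (R u i))\<^sup>2)"
      by (intro infsum_cong_neutral) (auto simp: R_def)
    also have "\<dots> = (\<Sum>\<^sub>\<infinity>i. (cmod (u i))\<^sup>2)" by (subst infsum_reindex[OF s]) (simp only: Rs)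
    finally show "ell2_norm (R u) = ell2_norm u" by (simp add: ell2_norm_def)
  qed
  show R: "bounded_op UNIV R"
    unfolding bounded_op_def
  proof (intro conjI ballI allI)
    show "\<exists>C. \<forall>u\<in>ell2 UNIV. ell2_norm (R u) \<le> C * ell2_norm u"
      using R_sum(2) by (intro exI[of _ "1::real"]) simp
  qed (auto simp: R_sum(1), auto simp: R_def)
  have "inner (op_of L x) y = (\<Sum>\<^sub>\<infinity>i. Re (l2_fun x (s i) * cnj (l2_fun y i)))"
    unfolding inner_l2.rep_eq l2_fun_op_of[OF L] by (simp add: L_def)
  also have "\<dots> = (\<Sum>\<^sub>\<infinity>i\<in>range s. Re (l2_fun x i * cnj (R (l2_fun y) i)))"
    using s by (subst infsum_reindex[OF s]) (simp add: R_def o_def)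
  also have "\<dots> = (\<Sum>\<^sub>\<infinity>i. Re (l2_fun x i * cnj (R (l2_fun y) i)))"
    by (intro infsum_cong_neutral) (auto simp: R_def)
  finally show "inner (op_of L x) y = inner x (op_of R y)"
    unfolding inner_l2.rep_eq l2_fun_op_of[OF R] .
qed

lemma bounded_op_add:
  assumes A: "bounded_op UNIV A" and B: "bounded_op UNIV B"
  shows "bounded_op UNIV (\<lambda>u i. A u i + B u i)" "op_of (\<lambda>u i. A u i + B u i) x = op_of A x + op_of B x"
proof -
  show *: "bounded_op UNIV (\<lambda>u i. A u i + B u i)"
  proof (rule bounded_opI)
    show "bounded_linear (\<lambda>x. op_of A x + op_of B x)"
      by (intro bounded_linear_add bounded_linear_op_of A B)
  qed (simp_all add: op_of_cscale l2_fun_op_of A B cscale_add_right)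
  show "op_of (\<lambda>u i. A u i + B u i) x = op_of A x + op_of B x"
    by (rule l2_eqI) (simp add: l2_fun_op_of A B *)
qed

text \<open>The successor map \<open>s\<close> is kept abstract so that half line and full line are
  treated together. The off-diagonal \<open>e\<close> is real and used symmetrically, so taking the
  adjoint only conjugates \<open>d\<close>; Jacobi matrices and both CMV factors have this
  form.\<close>

definition tri :: "('i \<Rightarrow> 'i) \<Rightarrow> ('i \<Rightarrow> real) \<Rightarrow> ('i \<Rightarrow> complex) \<Rightarrow> ('i \<Rightarrow> complex) \<Rightarrow> 'i \<Rightarrow> complex" where
  "tri s e d u n = of_real (e n) * u (s n) + d n * u n +
     (if n \<in> range s then of_real (e (inv s n)) * u (inv s n) else 0)"

lemma tri_operator:
  assumes s: "inj s" and e: "\<And>i. \<bar>e i\<bar> \<le> K" and d: "\<And>i. cmod (d i) \<le> K"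
  shows "bounded_op UNIV (tri s e d)"
    "inner (op_of (tri s e d) x) y = inner x (op_of (tri s e (\<lambda>i. cnj (d i))) y)"
proof -
  define L R where "L = (\<lambda>u :: 'a \<Rightarrow> complex. \<lambda>i. u (s i))"
    and "R = (\<lambda>u :: 'a \<Rightarrow> complex. \<lambda>i. if i \<in> range s then u (inv s i) else 0)"
  define M where "M = (\<lambda>m u (i::'a). m i * (u i :: complex))"
  let ?e = "\<lambda>i. complex_of_real (e i)"
  have e': "cmod (?e i) \<le> K" for i using e by simp
  have Me: "bounded_op UNIV (M ?e)" unfolding M_def by (rule bounded_op_multiplication[OF e'])
  have L: "bounded_op UNIV L" and R: "bounded_op UNIV R"
    unfolding L_def R_def using bounded_op_shift[OF s] by blast+
  have eq: "tri s e d = (\<lambda>u i. (M ?e (L u) i + M d u i) + R (M ?e u) i)" for d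
    by (intro ext) (simp add: tri_def L_def R_def M_def)
  have *: "bounded_op UNIV (tri s e d)"
    "op_of (tri s e d) x = op_of (M ?e) (op_of L x) + op_of (M d) x + op_of R (op_of (M ?e) x)"
    if d: "\<And>i. cmod (d i) \<le> K" for d x
  proof -
    have Md: "bounded_op UNIV (M d)" unfolding M_def by (rule bounded_op_multiplication[OF d])
    note b1 = bounded_op_add[OF bounded_op_comp(1)[OF Me L] Md]
    note b2 = bounded_op_add[OF b1(1) bounded_op_comp(1)[OF R Me]]
    show "bounded_op UNIV (tri s e d)" unfolding eq by (rule b2(1))
    show "op_of (tri s e d) x = op_of (M ?e) (op_of L x) + op_of (M d) x + op_of R (op_of (M ?e) x)"
      unfolding eq b2(2) b1(2) bounded_op_comp(2)[OF Me L] bounded_op_comp(2)[OF R Me] ..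
  qed
  show "bounded_op UNIV (tri s e d)" using d by (rule *)
  have Md: "inner (op_of (M d) x) y = inner x (op_of (M (\<lambda>i. cnj (d i))) y)"
    unfolding M_def by (rule bounded_op_multiplication(2)[OF d])
  have Me': "inner (op_of (M ?e) x) y = inner x (op_of (M ?e) y)" for x y
    using bounded_op_multiplication(2)[OF e', where x = x and y = y] unfolding M_def by simp
  have LR: "inner (op_of L x) y = inner x (op_of R y)" for x y
    unfolding L_def R_def by (rule bounded_op_shift(3)[OF s])
  have RL: "inner (op_of R x) y = inner x (op_of L y)" for x y
    using LR[of y x] by (simp add: inner_commute)
  show "inner (op_of (tri s e d) x) y = inner x (op_of (tri s e (\<lambda>i. cnj (d i))) y)"
    using d by (simp add: *(2) inner_add_left inner_add_right Md Me' LR RL)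
qed

section \<open>Adjoints, and lower bounds off the real line and off the unit circle\<close>

lemma shifted_adjoint:
  assumes A: "bounded_op UNIV A" and A': "bounded_op UNIV A'"
    and adj: "\<And>x y. inner (op_of A x) y = inner x (op_of A' y)"
  shows "inner (op_of (shifted A z) x) y = inner x (op_of (shifted A' (cnj z)) y)"
  by (simp add: bounded_op_shifted A A' inner_diff_left inner_diff_right adj inner_cscale_left)

lemma inner_cscale_self: "inner (cscale w x) x = Re w * (norm x)\<^sup>2"
proof -
  have "Re (w * u * cnj u) = Re w * (cmod u)\<^sup>2" for u
    unfolding cmod_power2 by (simp add: power2_eq_square algebra_simps)
  then have "inner (cscale w x) x = (\<Sum>\<^sub>\<infinity>i. Re w * (cmod (l2_fun x i))\<^sup>2)"
    unfolding inner_l2.rep_eq by simp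
  then show ?thesis unfolding norm_l2_square by (simp add: infsum_cmult_right')
qed

lemma selfadjoint_lower_bound:
  assumes scale: "\<And>c x. T (cscale c x) = cscale c (T x)"
    and self: "\<And>x y. inner (T x) y = inner x (T y)"
  shows "\<bar>Im z\<bar> * norm x \<le> norm (T x - cscale z x)"
proof -
  \<comment> \<open>Testing against \<open>cscale \<i> x\<close> isolates the imaginary part: its
    pairing with \<open>T x\<close> equals its own negative by self-adjointness, whereas
    \<open>cscale z x\<close> contributes \<open>Im z\<close> times the squared norm.
    Cauchy--Schwarz finishes.\<close>
  have "inner (T x) (cscale \<i> x) = inner x (cscale \<i> (T x))" by (simp add: self scale)
  also have "\<dots> = inner (cscale (- \<i>) x) (T x)" by (simp add: inner_cscale_left)
  also have "\<dots> = - inner (T x) (cscale \<i> x)"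
  proof -
    have "cscale (- \<i>) x = - cscale \<i> x" by (rule l2_eqI) simp
    then show ?thesis by (simp add: inner_commute)
  qed
  finally have "inner (T x) (cscale \<i> x) = 0" by simp
  moreover have "inner (cscale z x) (cscale \<i> x) = Im z * (norm x)\<^sup>2"
    using inner_cscale_left[of "- \<i>" "cscale z x" x] inner_cscale_self[of "- \<i> * z" x] by simp
  ultimately have "inner (T x - cscale z x) (cscale \<i> x) = - Im z * (norm x)\<^sup>2"
    by (simp add: inner_diff_left)
  then have "\<bar>Im z\<bar> * (norm x)\<^sup>2 = \<bar>inner (T x - cscale z x) (cscale \<i> x)\<bar>"
    by (simp add: abs_mult)
  also have "\<dots> \<le> norm (T x - cscale z x) * norm x"
    using Cauchy_Schwarz_ineq2[of "T x - cscale z x" "cscale \<i> x"] by simp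
  finally have "(\<bar>Im z\<bar> * norm x) * norm x \<le> norm (T x - cscale z x) * norm x"
    by (simp add: power2_eq_square mult.assoc)
  then show ?thesis by (cases "norm x = 0") (auto simp: mult_le_cancel_right)
qed

lemma isometry_lower_bound:
  assumes "norm (T x) = norm x"
  shows "\<bar>1 - cmod z\<bar> * norm x \<le> norm (T x - cscale z x)"
proof -
  have "\<bar>norm (T x) - norm (cscale z x)\<bar> \<le> norm (T x - cscale z x)" by (rule norm_triangle_ineq3)
  moreover have "norm (T x) - norm (cscale z x) = (1 - cmod z) * norm x"
    by (simp add: assms algebra_simps)
  ultimately show ?thesis by (simp add: abs_mult)
qed

section \<open>CMV and Jacobi matrices as tridiagonal operators\<close>

lemma inv_Suc [simp]: "inv Suc (Suc n) = n"
  by (rule inv_f_f) simp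

lemma cmv_L_tri:
  "cmv_L \<alpha> = tri Suc (\<lambda>n. if even n then rho (\<alpha> n) else 0) (\<lambda>n. if even n then cnj (\<alpha> n) else - \<alpha> (n - 1))"
proof (intro ext)
  show "cmv_L \<alpha> u n = tri Suc (\<lambda>n. if even n then rho (\<alpha> n) else 0)
      (\<lambda>n. if even n then cnj (\<alpha> n) else - \<alpha> (n - 1)) u n" for u n
    by (cases n) (auto simp: cmv_L_def tri_def Theta_def)
qed

lemma cmv_M_tri:
  "cmv_M \<alpha> = tri Suc (\<lambda>n. if odd n then rho (\<alpha> n) else 0)
     (\<lambda>n. if n = 0 then 1 else if odd n then cnj (\<alpha> n) else - \<alpha> (n - 1))"
proof (intro ext)
  show "cmv_M \<alpha> u n = tri Suc (\<lambda>n. if odd n then rho (\<alpha> n) else 0)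
      (\<lambda>n. if n = 0 then 1 else if odd n then cnj (\<alpha> n) else - \<alpha> (n - 1)) u n" for u n
    by (cases n) (auto simp: cmv_M_def tri_def Theta_def)
qed

text \<open>The entries at index 0 are set to 0, which decouples coordinate 0 and lets the operator
  on \<open>ell2 {1..}\<close> be studied as one on all of \<open>ell2 UNIV\<close>.\<close>

lemma jacobi_half_tri:
  "jacobi_half a b = tri Suc (\<lambda>n. if n = 0 then 0 else a n) (\<lambda>n. of_real (if n = 0 then 0 else b n))"
proof (intro ext)
  show "jacobi_half a b u n =
      tri Suc (\<lambda>n. if n = 0 then 0 else a n) (\<lambda>n. of_real (if n = 0 then 0 else b n)) u n" for u n
    by (cases n) (auto simp: jacobi_half_def tri_def)
qed

lemma jacobi_full_tri: "jacobi_full a b = tri (\<lambda>n. n + 1) a (\<lambda>n. of_real (b n))"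
proof (intro ext)
  have "inv (\<lambda>n. n + 1) m = m - 1" for m :: int
    by (rule inv_f_eq) (auto simp: inj_def)
  moreover have "m \<in> range (\<lambda>n. n + 1)" for m :: int
    by (rule range_eqI[of _ _ "m - 1"]) simp
  ultimately show "jacobi_full a b u n = tri (\<lambda>n. n + 1) a (\<lambda>n. of_real (b n)) u n" for u n
    by (simp add: jacobi_full_def tri_def)
qed

lemma jacobi_half_operator:
  assumes "\<And>n. n \<ge> 1 \<Longrightarrow> \<bar>a n\<bar> \<le> K" "\<And>n. n \<ge> 1 \<Longrightarrow> \<bar>b n\<bar> \<le> K"
  shows "bounded_op UNIV (jacobi_half a b)"
    "inner (op_of (jacobi_half a b) x) y = inner x (op_of (jacobi_half a b) y)"
proof -
  have "K \<ge> 0" using assms(1)[of 1] by simp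
  then have a: "\<bar>if n = 0 then 0 else a n\<bar> \<le> K" and b: "cmod (of_real (if n = 0 then 0 else b n)) \<le> K" for n
    using assms[of n] by auto
  show "bounded_op UNIV (jacobi_half a b)"
    unfolding jacobi_half_tri by (rule tri_operator(1)[OF inj_Suc a b])
  show "inner (op_of (jacobi_half a b) x) y = inner x (op_of (jacobi_half a b) y)"
    using tri_operator(2)[OF inj_Suc a b, where x = x and y = y] unfolding jacobi_half_tri by (simp cong: if_cong)
qed

lemma jacobi_full_operator:
  assumes a: "\<And>n. \<bar>a n\<bar> \<le> K" and "\<And>n. \<bar>b n\<bar> \<le> K"
  shows "bounded_op UNIV (jacobi_full a b)"
    "inner (op_of (jacobi_full a b) x) y = inner x (op_of (jacobi_full a b) y)"
proof -
  have s: "inj (\<lambda>n::int. n + 1)" by (simp add: inj_def)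
  have b: "cmod (of_real (b n)) \<le> K" for n using assms(2) by simp
  show "bounded_op UNIV (jacobi_full a b)"
    unfolding jacobi_full_tri by (rule tri_operator(1)[OF s a b])
  show "inner (op_of (jacobi_full a b) x) y = inner x (op_of (jacobi_full a b) y)"
    using tri_operator(2)[OF s a b, where x = x and y = y] unfolding jacobi_full_tri by simp
qed

section \<open>Unitarity of CMV matrices\<close>

lemma rho_props:
  assumes "cmod \<alpha> < 1"
  shows "0 < rho \<alpha>" "rho \<alpha> \<le> 1" "(rho \<alpha>)\<^sup>2 = 1 - (cmod \<alpha>)\<^sup>2"
    "complex_of_real (rho \<alpha>) * complex_of_real (rho \<alpha>) = 1 - \<alpha> * cnj \<alpha>"
proof -
  have "(cmod \<alpha>)\<^sup>2 < 1" using assms by (simp add: abs_square_less_1)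
  then show "0 < rho \<alpha>" "rho \<alpha> \<le> 1" and sq: "(rho \<alpha>)\<^sup>2 = 1 - (cmod \<alpha>)\<^sup>2"
    by (auto simp: rho_def)
  have "complex_of_real (rho \<alpha>) * complex_of_real (rho \<alpha>) = of_real ((rho \<alpha>)\<^sup>2)"
    by (simp add: power2_eq_square)
  also have "\<dots> = 1 - \<alpha> * cnj \<alpha>" unfolding sq of_real_diff complex_norm_square by simp
  finally show "complex_of_real (rho \<alpha>) * complex_of_real (rho \<alpha>) = 1 - \<alpha> * cnj \<alpha>" .
qed

lemma rho_cnj [simp]: "rho (cnj \<alpha>) = rho \<alpha>"
  by (simp add: rho_def)

text \<open>Blockwise, the \<open>Theta\<close> matrices of \<open>\<alpha>\<close> and of its
  conjugate are inverse to each other because \<open>rho^2 = 1 - |\<alpha>|^2\<close>. The identity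
  is for arbitrary \<open>u\<close>, so that it also serves formal solutions.\<close>

lemma cmv_L_inverse:
  assumes "\<And>n. cmod (\<alpha> n) < 1"
  shows "cmv_L (\<lambda>n. cnj (\<alpha> n)) (cmv_L \<alpha> u) = u"
proof
  fix n
  show "cmv_L (\<lambda>n. cnj (\<alpha> n)) (cmv_L \<alpha> u) n = u n"
  proof (cases "even n")
    case True
    have "cmv_L (\<lambda>n. cnj (\<alpha> n)) (cmv_L \<alpha> u) n =
        \<alpha> n * cnj (\<alpha> n) * u n + (of_real (rho (\<alpha> n)) * of_real (rho (\<alpha> n))) * u n"
      using True by (simp add: cmv_L_def Theta_def algebra_simps)
    then show ?thesis using rho_props(4)[OF assms] by (simp add: algebra_simps)
  next
    case False
    then obtain m where n: "n = Suc m" "even m" by (cases n) auto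
    have "cmv_L (\<lambda>n. cnj (\<alpha> n)) (cmv_L \<alpha> u) n =
        \<alpha> m * cnj (\<alpha> m) * u n + (of_real (rho (\<alpha> m)) * of_real (rho (\<alpha> m))) * u n"
      using n by (simp add: cmv_L_def Theta_def algebra_simps)
    then show ?thesis using rho_props(4)[OF assms] by (simp add: algebra_simps)
  qed
qed

lemma cmv_M_inverse:
  assumes "\<And>n. cmod (\<alpha> n) < 1"
  shows "cmv_M (\<lambda>n. cnj (\<alpha> n)) (cmv_M \<alpha> u) = u"
proof
  fix n
  show "cmv_M (\<lambda>n. cnj (\<alpha> n)) (cmv_M \<alpha> u) n = u n"
  proof (cases "n = 0")
    case n0: False
    show ?thesis
    proof (cases "odd n")
      case True
      have "cmv_M (\<lambda>n. cnj (\<alpha> n)) (cmv_M \<alpha> u) n =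
          \<alpha> n * cnj (\<alpha> n) * u n + (of_real (rho (\<alpha> n)) * of_real (rho (\<alpha> n))) * u n"
        using True n0 by (simp add: cmv_M_def Theta_def algebra_simps)
      then show ?thesis using rho_props(4)[OF assms] by (simp add: algebra_simps)
    next
      case False
      then obtain m where n: "n = Suc m" "odd m" using n0 by (cases n) auto
      have "cmv_M (\<lambda>n. cnj (\<alpha> n)) (cmv_M \<alpha> u) n =
          \<alpha> m * cnj (\<alpha> m) * u n + (of_real (rho (\<alpha> m)) * of_real (rho (\<alpha> m))) * u n"
        using n by (auto simp: cmv_M_def Theta_def algebra_simps)
      then show ?thesis using rho_props(4)[OF assms] by (simp add: algebra_simps)
    qed
  qed (simp add: cmv_M_def)
qed

lemma cmv_factors:
  assumes \<alpha>: "\<And>n. cmod (\<alpha> n) < 1"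
  shows "bounded_op UNIV (cmv_L \<alpha>)" "bounded_op UNIV (cmv_M \<alpha>)"
    "inner (op_of (cmv_L \<alpha>) x) y = inner x (op_of (cmv_L (\<lambda>n. cnj (\<alpha> n))) y)"
    "inner (op_of (cmv_M \<alpha>) x) y = inner x (op_of (cmv_M (\<lambda>n. cnj (\<alpha> n))) y)"
proof -
  have bd: "\<bar>if P then rho (\<alpha> n) else 0\<bar> \<le> 1" "cmod (if P then cnj (\<alpha> n) else - \<alpha> m) \<le> 1"
    "cmod (if P then 1 else if Q then cnj (\<alpha> n) else - \<alpha> m) \<le> 1"
    for P Q and n m :: nat
    using \<alpha>[of n] \<alpha>[of m] rho_props[OF \<alpha>[of n]] by auto
  show "bounded_op UNIV (cmv_L \<alpha>)" "bounded_op UNIV (cmv_M \<alpha>)"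
    unfolding cmv_L_tri cmv_M_tri by (rule tri_operator(1)[OF inj_Suc]; rule bd)+
  show "inner (op_of (cmv_L \<alpha>) x) y = inner x (op_of (cmv_L (\<lambda>n. cnj (\<alpha> n))) y)"
  proof -
    let ?e = "\<lambda>n. if even n then rho (\<alpha> n) else 0"
    let ?d = "(\<lambda>n. if even n then cnj (\<alpha> n) else - \<alpha> (n - 1))"
    have "inner (op_of (tri Suc ?e ?d) x) y = inner x (op_of (tri Suc ?e (\<lambda>i. cnj (?d i))) y)"
      by (rule tri_operator(2)[OF inj_Suc]) (rule bd)+
    moreover have "(\<lambda>i. cnj (?d i)) = (\<lambda>n. if even n then cnj (cnj (\<alpha> n)) else - cnj (\<alpha> (n - 1)))"
      by (simp add: fun_eq_iff)
    ultimately show ?thesis unfolding cmv_L_tri by (simp only: rho_cnj)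
  qed
  show "inner (op_of (cmv_M \<alpha>) x) y = inner x (op_of (cmv_M (\<lambda>n. cnj (\<alpha> n))) y)"
  proof -
    let ?e = "\<lambda>n. if odd n then rho (\<alpha> n) else 0"
    let ?d = "(\<lambda>n. if n = 0 then 1 else if odd n then cnj (\<alpha> n) else - \<alpha> (n - 1))"
    have "inner (op_of (tri Suc ?e ?d) x) y = inner x (op_of (tri Suc ?e (\<lambda>i. cnj (?d i))) y)"
      by (rule tri_operator(2)[OF inj_Suc]) (rule bd)+
    moreover have "(\<lambda>i. cnj (?d i)) = (\<lambda>n. if n = 0 then 1 else if odd n then cnj (cnj (\<alpha> n)) else - cnj (\<alpha> (n - 1)))"
      by (simp add: fun_eq_iff)
    ultimately show ?thesis unfolding cmv_M_tri by (simp only: rho_cnj)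
  qed
qed

text \<open>The blocks are symmetric matrices, so the adjoint of each factor arises by conjugating
  the coefficients; the order of the factors is reversed.\<close>

definition cmv_adj :: "(nat \<Rightarrow> complex) \<Rightarrow> (nat \<Rightarrow> complex) \<Rightarrow> (nat \<Rightarrow> complex)" where
  "cmv_adj \<alpha> u = cmv_M (\<lambda>n. cnj (\<alpha> n)) (cmv_L (\<lambda>n. cnj (\<alpha> n)) u)"

lemma cmv_operator:
  assumes \<alpha>: "\<And>n. cmod (\<alpha> n) < 1"
  shows "bounded_op UNIV (cmv \<alpha>)" "bounded_op UNIV (cmv_adj \<alpha>)"
    "inner (op_of (cmv \<alpha>) x) y = inner x (op_of (cmv_adj \<alpha>) y)"
    "op_of (cmv_adj \<alpha>) (op_of (cmv \<alpha>) x) = x" "op_of (cmv \<alpha>) (op_of (cmv_adj \<alpha>) x) = x"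
proof -
  have \<alpha>': "cmod (cnj (\<alpha> n)) < 1" for n using \<alpha> by simp
  note L = cmv_factors(1,2)
  note adj = cmv_factors(3,4)[where \<alpha> = \<alpha>, OF \<alpha>]
  have eq: "cmv \<alpha> = (\<lambda>u. cmv_L \<alpha> (cmv_M \<alpha> u))"
    "cmv_adj \<alpha> = (\<lambda>u. cmv_M (\<lambda>n. cnj (\<alpha> n)) (cmv_L (\<lambda>n. cnj (\<alpha> n)) u))"
    by (auto simp: fun_eq_iff cmv_def cmv_adj_def)
  note c = bounded_op_comp[OF L(1)[OF \<alpha>] L(2)[OF \<alpha>]]
  note c' = bounded_op_comp[OF L(2)[OF \<alpha>'] L(1)[OF \<alpha>']]
  show b: "bounded_op UNIV (cmv \<alpha>)" "bounded_op UNIV (cmv_adj \<alpha>)"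
    unfolding eq by (rule c c')+
  show "inner (op_of (cmv \<alpha>) x) y = inner x (op_of (cmv_adj \<alpha>) y)"
    unfolding eq c(2) c'(2) by (simp add: adj)
  have inv: "cmv_adj \<alpha> (cmv \<alpha> u) = u" "cmv \<alpha> (cmv_adj \<alpha> u) = u" for u
    using cmv_L_inverse[of \<alpha>, OF \<alpha>] cmv_M_inverse[of \<alpha>, OF \<alpha>]
      cmv_L_inverse[of "\<lambda>n. cnj (\<alpha> n)", OF \<alpha>'] cmv_M_inverse[of "\<lambda>n. cnj (\<alpha> n)", OF \<alpha>']
    by (simp_all add: cmv_def cmv_adj_def)
  show "op_of (cmv_adj \<alpha>) (op_of (cmv \<alpha>) x) = x" "op_of (cmv \<alpha>) (op_of (cmv_adj \<alpha>) x) = x"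
    by (rule l2_eqI; simp add: l2_fun_op_of b inv)+
qed

lemma cmv_M_norm:
  assumes \<alpha>: "\<And>n. cmod (\<alpha> n) < 1"
  shows "norm (op_of (cmv_M \<alpha>) x) = norm x"
proof -
  have \<alpha>': "cmod (cnj (\<alpha> n)) < 1" for n using \<alpha> by simp
  have "op_of (cmv_M (\<lambda>n. cnj (\<alpha> n))) (op_of (cmv_M \<alpha>) x) = x"
    by (rule l2_eqI) (simp add: l2_fun_op_of cmv_factors(2) \<alpha> \<alpha>' cmv_M_inverse)
  then show ?thesis by (simp add: norm_eq_sqrt_inner cmv_factors(4)[where \<alpha> = \<alpha>, OF \<alpha>])
qed

lemma cmv_norm:
  assumes \<alpha>: "\<And>n. cmod (\<alpha> n) < 1"
  shows "norm (op_of (cmv \<alpha>) x) = norm x" "norm (op_of (cmv_adj \<alpha>) x) = norm x"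
proof -
  note c = cmv_operator[of \<alpha>, OF \<alpha>]
  have iso: "norm (op_of (cmv \<alpha>) y) = norm y" for y
    by (simp add: norm_eq_sqrt_inner c(3,4))
  then show "norm (op_of (cmv \<alpha>) x) = norm x" .
  show "norm (op_of (cmv_adj \<alpha>) x) = norm x"
    using iso[of "op_of (cmv_adj \<alpha>) x"] by (simp add: c(5))
qed

text \<open>For \<open>|z| = 1\<close> one has \<open>C' - cnj z = - cnj z C' (C - z)\<close> with
  \<open>C'\<close> the adjoint of the unitary \<open>C\<close>. Lower bounds for the adjoint thus
  come from those for \<open>C - z\<close>.\<close>

lemma cmv_adj_norm_shifted:
  assumes \<alpha>: "\<And>n. cmod (\<alpha> n) < 1" and z: "cmod z = 1"
  shows "norm (op_of (shifted (cmv_adj \<alpha>) (cnj z)) x) = norm (op_of (shifted (cmv \<alpha>) z) x)"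
proof -
  note c = cmv_operator[of \<alpha>, OF \<alpha>]
  have zz: "cnj z * z = 1" using z by (metis complex_norm_square mult.commute of_real_1 one_power2)
  have "op_of (cmv_adj \<alpha>) x - cscale (cnj z) x = cscale (- cnj z) (op_of (cmv_adj \<alpha>) (op_of (cmv \<alpha>) x - cscale z x))"
  proof -
    have "op_of (cmv_adj \<alpha>) (op_of (cmv \<alpha>) x - cscale z x) = x - cscale z (op_of (cmv_adj \<alpha>) x)"
      by (simp add: linear_diff[OF bounded_linear.linear[OF bounded_linear_op_of]] c op_of_cscale)
    moreover have "- cnj z * (p - z * q) = q - cnj z * p" for p q
    proof -
      have "- cnj z * (p - z * q) = (cnj z * z) * q - cnj z * p" by (simp add: algebra_simps)
      then show ?thesis using zz by simp
    qed
    ultimately show ?thesis by (intro l2_eqI) simp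
  qed
  then show ?thesis
    using cmv_norm(2)[of \<alpha>, OF \<alpha>] z by (simp add: bounded_op_shifted c)
qed

section \<open>Products of transfer matrices\<close>

lemma norm_smult_vec: "norm (c *s (x :: complex^'n)) = cmod c * norm x"
  unfolding norm_vec_def by (simp add: norm_mult L2_set_right_distrib)

lemma norm_matrix_vector_mult_le: "norm (A *v x) \<le> norm A * norm (x :: complex^'n)"
  for A :: "complex^'n^'m"
proof -
  have "norm ((A *v x) $ i) \<le> norm (A $ i) * norm x" for i
  proof -
    have "norm ((A *v x) $ i) \<le> (\<Sum>j\<in>UNIV. norm (A $ i $ j) * norm (x $ j))"
      by (simp add: matrix_vector_mult_def sum_norm_le norm_mult)
    also have "\<dots> \<le> norm (A $ i) * norm x"
      using L2_set_mult_ineq[of "\<lambda>j. norm (A $ i $ j)" "\<lambda>j. norm (x $ j)" UNIV]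
      by (simp add: norm_vec_def)
    finally show ?thesis .
  qed
  then have "norm (A *v x) \<le> L2_set (\<lambda>i. norm (A $ i) * norm x) UNIV"
    unfolding norm_vec_def[of "A *v x"] by (intro L2_set_mono) auto
  also have "\<dots> = norm A * norm x"
    unfolding norm_vec_def[of A] by (simp add: L2_set_left_distrib)
  finally show ?thesis .
qed

lemma matrix_vector_smult: "A *v (c *s x) = c *s (A *v (x :: 'a::comm_semiring_1^'n))"
  by (simp add: matrix_vector_mult_def vec_eq_iff sum_distrib_left mult.left_commute)

lemma cayley_hamilton_2:
  fixes A :: "'a::comm_ring_1^2^2"
  shows "A *v (A *v x) = trace A *s (A *v x) - det A *s x"
  by (simp add: vec_eq_iff forall_2 matrix_vector_mult_def sum_2 trace_def det_2 algebra_simps)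

text \<open>Let \<open>?\<mu>\<close> be the second root. By Cayley--Hamilton
  \<open>A - \<nu>\<close> annihilates the range of \<open>A - ?\<mu>\<close>, so any nonzero vector
  of that range can be normalised; if the range is zero, \<open>A\<close> is the scalar
  \<open>?\<mu>\<close> and the trace forces \<open>?\<mu> = \<nu>\<close>.\<close>

lemma eigenvector_2:
  fixes A :: "complex^2^2"
  assumes root: "\<nu>\<^sup>2 - trace A * \<nu> + det A = 0"
  obtains v where "norm v = 1" "A *v v = \<nu> *s v"
proof -
  let ?\<mu> = "trace A - \<nu>"
  have D: "det A = \<nu> * ?\<mu>"
    using root by (simp add: algebra_simps power2_eq_square eq_neg_iff_add_eq_0)
  obtain y where y: "y \<noteq> 0" "A *v y = \<nu> *s y"
  proof (cases "\<forall>x. A *v x = ?\<mu> *s x")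
    case True
    have diag: "A $ i $ i = ?\<mu>" for i
    proof -
      have "(A *v axis i 1) $ i = (?\<mu> *s axis i 1) $ i" using True by simp
      then show ?thesis
        by (simp add: matrix_vector_mult_def axis_def if_distrib sum.delta cong: if_cong)
    qed
    have "trace A = A $ 1 $ 1 + A $ 2 $ 2" by (simp add: trace_def sum_2)
    then have "trace A = ?\<mu> + ?\<mu>" unfolding diag .
    moreover have "x - w = w" if "x = (x - w) + (x - w)" for x w :: complex
      using that by (simp add: algebra_simps)
    ultimately have "?\<mu> = \<nu>" by blast
    then show ?thesis using True that[of "axis 1 1"] by (simp add: axis_eq_0_iff)
  next
    case False
    then obtain x where x: "A *v x - ?\<mu> *s x \<noteq> 0" by auto
    have "A *v (A *v x - ?\<mu> *s x) = \<nu> *s (A *v x - ?\<mu> *s x)"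
      unfolding matrix_vector_mult_diff_distrib matrix_vector_smult cayley_hamilton_2 D
      by (simp add: vec_eq_iff algebra_simps)
    then show ?thesis using x that by blast
  qed
  show ?thesis
  proof (rule that[of "complex_of_real (1 / norm y) *s y"])
    show "norm (complex_of_real (1 / norm y) *s y) = 1"
      using y(1) by (simp add: norm_smult_vec norm_divide)
    show "A *v (complex_of_real (1 / norm y) *s y) = \<nu> *s (complex_of_real (1 / norm y) *s y)"
      by (simp add: matrix_vector_smult y(2) vector_smult_assoc mult.commute)
  qed
qed

section \<open>Products of step matrices and their perturbation\<close>

primrec mprod :: "(nat \<Rightarrow> 'a::comm_ring_1^2^2) \<Rightarrow> nat \<Rightarrow> nat \<Rightarrow> 'a^2^2" where
  "mprod A n 0 = mat 1"
| "mprod A n (Suc k) = A (n + k) ** mprod A n k"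

lemma mprod_add: "mprod A n (j + k) = mprod A (n + j) k ** mprod A n j"
  by (induction k) (simp_all add: matrix_mul_assoc add.assoc)

lemma mprod_vector_Suc: "mprod A n (Suc k) *v x = A (n + k) *v (mprod A n k *v x)"
  by (simp add: matrix_vector_mul_assoc)

lemma mprod_cong: "(\<And>j. j < k \<Longrightarrow> A (n + j) = B (m + j)) \<Longrightarrow> mprod A n k = mprod B m k"
  by (induction k) auto

lemma mprod_periodic:
  assumes "\<And>j. P (j + p) = P j"
  shows "mprod P (i * p) k = mprod P 0 k"
proof (rule mprod_cong)
  have "P (j + i * p) = P j" for j i
  proof (induction i)
    case (Suc i)
    have "j + Suc i * p = (j + i * p) + p" by simp
    then show ?case using assms Suc by metis
  qed simp
  then show "P (i * p + j) = P (0 + j)" for j by (simp add: add.commute)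
qed

lemma mprod_norm:
  fixes A :: "nat \<Rightarrow> complex^2^2"
  assumes "\<And>j. norm (A j) \<le> K" "K \<ge> 0"
  shows "norm (mprod A n k *v x) \<le> K ^ k * norm x"
proof (induction k)
  case (Suc k)
  have "norm (mprod A n (Suc k) *v x) \<le> norm (A (n + k)) * norm (mprod A n k *v x)"
    unfolding mprod_vector_Suc by (rule norm_matrix_vector_mult_le)
  also have "\<dots> \<le> K * (K ^ k * norm x)"
    using assms Suc by (intro mult_mono) auto
  finally show ?case by simp
qed simp

text \<open>The difference telescopes into \<open>k\<close> terms with one factor
  \<open>A - P\<close> each; \<open>K \<ge> 1\<close> lets every term be bounded with the full power
  \<open>K ^ k\<close>. Separate start indices allow a model that is renumbered to begin at
  0.\<close>

lemma mprod_perturbation: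
  fixes A P :: "nat \<Rightarrow> complex^2^2"
  assumes A: "\<And>j. norm (A j) \<le> K" and P: "\<And>j. norm (P j) \<le> K" and "K \<ge> 1"
    and close: "\<And>j. j < k \<Longrightarrow> norm (A (n + j) - P (m + j)) \<le> \<epsilon>"
  shows "norm (mprod A n k *v x - mprod P m k *v x) \<le> real k * \<epsilon> * K ^ k * norm x"
  using close
proof (induction k)
  case (Suc k)
  have "0 \<le> \<epsilon>" using Suc.prems[of k] norm_ge_zero order_trans by blast
  have "mprod A n (Suc k) *v x - mprod P m (Suc k) *v x =
      A (n + k) *v (mprod A n k *v x - mprod P m k *v x) + (A (n + k) - P (m + k)) *v (mprod P m k *v x)"
    unfolding mprod_vector_Suc by (simp add: matrix_vector_mult_diff_distrib matrix_vector_mult_diff_rdistrib)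
  then have "norm (mprod A n (Suc k) *v x - mprod P m (Suc k) *v x) \<le>
      norm (A (n + k)) * norm (mprod A n k *v x - mprod P m k *v x) +
      norm (A (n + k) - P (m + k)) * norm (mprod P m k *v x)"
    by (metis add_mono norm_matrix_vector_mult_le norm_triangle_le)
  also have "\<dots> \<le> K * (real k * \<epsilon> * K ^ k * norm x) + \<epsilon> * (K ^ k * norm x)"
    using A[of "n + k"] Suc.prems[of k] Suc.IH[OF Suc.prems] \<open>K \<ge> 1\<close> \<open>0 \<le> \<epsilon>\<close>
    by (intro add_mono mult_mono mprod_norm P) auto
  also have "\<dots> \<le> K * (real k * \<epsilon> * K ^ k * norm x) + K * (\<epsilon> * (K ^ k * norm x))"
    using \<open>K \<ge> 1\<close> \<open>0 \<le> \<epsilon>\<close> mult_right_mono[of 1 K "\<epsilon> * (K ^ k * norm x)"] by simp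
  also have "\<dots> = real (Suc k) * \<epsilon> * K ^ Suc k * norm x"
    by (simp add: algebra_simps)
  finally show ?case .
qed simp

text \<open>Variation of constants in norm: the deviation from the homogeneous solution is the sum
  of the residuals, each carried forward by at most \<open>k\<close> matrices.\<close>

lemma mprod_inhomogeneous:
  fixes A :: "nat \<Rightarrow> complex^2^2" and U :: "nat \<Rightarrow> complex^2"
  assumes A: "\<And>j. norm (A j) \<le> K" and "K \<ge> 1"
  shows "norm (U (n + k) - mprod A n k *v U n) \<le> K ^ k * (\<Sum>j<k. norm (U (Suc (n + j)) - A (n + j) *v U (n + j)))"
proof (induction k)
  case (Suc k)
  let ?F = "\<lambda>j. norm (U (Suc (n + j)) - A (n + j) *v U (n + j))"
  have "U (n + Suc k) - mprod A n (Suc k) *v U n =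
      (U (Suc (n + k)) - A (n + k) *v U (n + k)) + A (n + k) *v (U (n + k) - mprod A n k *v U n)"
    unfolding mprod_vector_Suc by (simp add: matrix_vector_mult_diff_distrib)
  then have "norm (U (n + Suc k) - mprod A n (Suc k) *v U n) \<le>
      ?F k + norm (A (n + k)) * norm (U (n + k) - mprod A n k *v U n)"
    by (metis add_mono norm_matrix_vector_mult_le norm_triangle_le order_refl)
  also have "\<dots> \<le> ?F k + K * (K ^ k * (\<Sum>j<k. ?F j))"
    using A[of "n + k"] Suc \<open>K \<ge> 1\<close> by (intro add_mono mult_mono) auto
  also have "\<dots> \<le> K ^ Suc k * ?F k + K * (K ^ k * (\<Sum>j<k. ?F j))"
    using mult_right_mono[OF one_le_power[OF \<open>K \<ge> 1\<close>, of "Suc k"], of "?F k"] by simp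
  also have "\<dots> = K ^ Suc k * (\<Sum>j<Suc k. ?F j)" by (simp add: algebra_simps)
  finally show ?case .
qed simp

section \<open>Asymptotic periodicity with fixed trace and determinant\<close>

definition periodic_window ::
  "nat \<Rightarrow> complex \<Rightarrow> complex \<Rightarrow> real \<Rightarrow> (nat \<Rightarrow> complex^2^2) \<Rightarrow> nat \<Rightarrow> real \<Rightarrow> nat \<Rightarrow> bool" where
  "periodic_window p t D K A L \<epsilon> n \<longleftrightarrow> (\<exists>P. (\<forall>j. P (j + p) = P j) \<and> (\<forall>j. norm (P j) \<le> K) \<and>
     trace (mprod P 0 p) = t \<and> det (mprod P 0 p) = D \<and> (\<forall>j\<le>L. norm (A (n + j) - P j) \<le> \<epsilon>))"

text \<open>The model \<open>P\<close> inside \<open>periodic_window\<close> is chosen anew for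
  every start \<open>n\<close>, as the torus element may drift; only the period, \<open>t\<close>,
  \<open>D\<close> and the bound \<open>K\<close> are common to all windows, and \<open>K\<close> is
  fixed before \<open>L\<close> and \<open>\<epsilon>\<close>.\<close>

definition asymptotically_periodic :: "nat \<Rightarrow> complex \<Rightarrow> complex \<Rightarrow> (nat \<Rightarrow> complex^2^2) \<Rightarrow> bool" where
  "asymptotically_periodic p t D A \<longleftrightarrow>
     (\<exists>K. \<forall>L. \<forall>\<epsilon>>0. \<exists>N. \<forall>n\<ge>N. periodic_window p t D K A L \<epsilon> n)"

lemma periodic_windowE:
  assumes "periodic_window p t D K A L \<epsilon> n"
  obtains P where "\<And>j. P (j + p) = P j" "\<And>j. norm (P j) \<le> K" "trace (mprod P 0 p) = t"
    "det (mprod P 0 p) = D" "\<And>j. j \<le> L \<Longrightarrow> norm (A (n + j) - P j) \<le> \<epsilon>"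
  using assms unfolding periodic_window_def by (elim exE conjE) metis

lemma periodic_window_mono:
  assumes "periodic_window p t D K A L \<epsilon> n" "K \<le> K'"
  shows "periodic_window p t D K' A L \<epsilon> n"
  using assms(1)
proof (rule periodic_windowE)
  fix P assume P: "\<And>j. P (j + p) = P j" "\<And>j. norm (P j) \<le> K" "trace (mprod P 0 p) = t"
    "det (mprod P 0 p) = D" "\<And>j. j \<le> L \<Longrightarrow> norm (A (n + j) - P j) \<le> \<epsilon>"
  have "norm (P j) \<le> K'" for j using P(2)[of j] assms(2) by linarith
  with P show ?thesis unfolding periodic_window_def by (intro exI[of _ P]) simp
qed

lemma asymptotically_periodicE:
  assumes "asymptotically_periodic p t D A"
  obtains K where "K \<ge> 1" "\<And>n. norm (A n) \<le> K"
    "\<And>L \<epsilon>. \<epsilon> > 0 \<Longrightarrow> \<exists>N. \<forall>n\<ge>N. periodic_window p t D K A L \<epsilon> n"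
proof -
  obtain K where K: "\<And>L \<epsilon>. \<epsilon> > 0 \<Longrightarrow> \<exists>N. \<forall>n\<ge>N. periodic_window p t D K A L \<epsilon> n"
    using assms unfolding asymptotically_periodic_def by blast
  obtain N where N: "\<And>n. n \<ge> N \<Longrightarrow> periodic_window p t D K A 0 1 n"
    using K[OF zero_less_one, of 0] by blast
  have late: "norm (A n) \<le> K + 1" if "n \<ge> N" for n
    using N[OF that]
  proof (rule periodic_windowE)
    fix P assume "\<And>j. norm (P j) \<le> K" "\<And>j. j \<le> 0 \<Longrightarrow> norm (A (n + j) - P j) \<le> 1"
    from this(1)[of 0] this(2)[of 0] show ?thesis
      using norm_triangle_sub[of "A n" "P 0"] by simp
  qed
  \<comment> \<open>Far-out matrices are within 1 of a model bounded by \<open>K\<close>; the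
    finitely many others are absorbed into the maximum.\<close>
  define K' where "K' = Max (insert 1 (insert (K + 1) ((\<lambda>n. norm (A n)) ` {..<N})))"
  have K': "1 \<le> K'" "K + 1 \<le> K'" "n < N \<Longrightarrow> norm (A n) \<le> K'" for n
    unfolding K'_def by (rule Max_ge; simp)+
  show ?thesis
  proof (rule that[of K'])
    show "norm (A n) \<le> K'" for n using late[of n] K'(2) K'(3)[of n] by (cases "n < N") auto
    show "\<exists>N. \<forall>n\<ge>N. periodic_window p t D K' A L \<epsilon> n" if "\<epsilon> > 0" for L \<epsilon>
      using K[OF that, of L] periodic_window_mono[of p t D K A L \<epsilon> _ K'] K'(2) by fastforce
  qed (fact K'(1))
qed

lemma mprod_periodic_start:
  fixes A :: "nat \<Rightarrow> 'a::comm_ring_1^2^2"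
  assumes per: "\<And>j. A (j + p) = A j" and "p \<ge> 1"
  shows "trace (mprod A n p) = trace (mprod A 0 p)" "det (mprod A n p) = det (mprod A 0 p)"
proof -
  obtain q where q: "p = Suc q" using \<open>p \<ge> 1\<close> by (cases p) auto
  \<comment> \<open>Moving the start by one permutes the factors cyclically, since the factor gained
    equals the factor lost.\<close>
  have step: "trace (mprod A (Suc n) p) = trace (mprod A n p)" "det (mprod A (Suc n) p) = det (mprod A n p)" for n
  proof -
    have 1: "mprod A n p = mprod A (Suc n) q ** A n"
      using mprod_add[of A n 1 q] by (simp add: q)
    have 2: "mprod A (Suc n) p = A n ** mprod A (Suc n) q"
      using per[of n] by (simp add: q)
    show "trace (mprod A (Suc n) p) = trace (mprod A n p)" unfolding 1 2 by (rule trace_mul_sym)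
    show "det (mprod A (Suc n) p) = det (mprod A n p)" unfolding 1 2 by (simp only: det_mul mult.commute)
  qed
  show "trace (mprod A n p) = trace (mprod A 0 p)" "det (mprod A n p) = det (mprod A 0 p)"
    by (induction n) (simp_all only: step)
qed

lemma asymptotically_periodic_cong:
  assumes "asymptotically_periodic p t D A" "\<And>n. n \<ge> m \<Longrightarrow> A n = B n"
  shows "asymptotically_periodic p t D B"
proof -
  obtain K where K: "\<And>L \<epsilon>. \<epsilon> > 0 \<Longrightarrow> \<exists>N. \<forall>n\<ge>N. periodic_window p t D K A L \<epsilon> n"
    using assms(1) unfolding asymptotically_periodic_def by blast
  have eq: "periodic_window p t D K B L \<epsilon> n = periodic_window p t D K A L \<epsilon> n" if "n \<ge> m" for L \<epsilon> n
    using assms(2) that by (simp add: periodic_window_def)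
  have "\<exists>N. \<forall>n\<ge>N. periodic_window p t D K B L \<epsilon> n" if e: "\<epsilon> > 0" for L \<epsilon>
  proof -
    obtain N where "\<forall>n\<ge>N. periodic_window p t D K A L \<epsilon> n" using K[OF e] by blast
    then have "\<forall>n\<ge>max N m. periodic_window p t D K B L \<epsilon> n" by (simp add: eq)
    then show ?thesis by blast
  qed
  then show ?thesis unfolding asymptotically_periodic_def by blast
qed

lemma periodic_imp_asymptotically_periodic:
  fixes A :: "nat \<Rightarrow> complex^2^2"
  assumes per: "\<And>j. A (j + p) = A j" and "p \<ge> 1"
  shows "asymptotically_periodic p (trace (mprod A 0 p)) (det (mprod A 0 p)) A"
proof -
  note inv = mprod_periodic_start[where A = A, OF per \<open>p \<ge> 1\<close>]
  have per': "A (j + i * p) = A j" for i j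
  proof (induction i)
    case (Suc i)
    have "j + Suc i * p = (j + i * p) + p" by simp
    then show ?case using per Suc by metis
  qed simp
  define K where "K = Max ((\<lambda>j. norm (A j)) ` {..<p})"
  have K: "norm (A j) \<le> K" for j
  proof -
    have "A j = A (j mod p)" using per'[of "j mod p" "j div p"] by (simp only: mod_div_mult_eq)
    moreover have "j mod p < p" using \<open>p \<ge> 1\<close> by simp
    ultimately show ?thesis unfolding K_def by (auto intro!: Max_ge)
  qed
  have "periodic_window p (trace (mprod A 0 p)) (det (mprod A 0 p)) K A L \<epsilon> n" if "\<epsilon> > 0" for L \<epsilon> n
    unfolding periodic_window_def
  proof (intro exI conjI allI impI)
    have shift: "mprod (\<lambda>j. A (n + j)) 0 p = mprod A n p" by (rule mprod_cong) simp
    show "A (n + (j + p)) = A (n + j)" for j using per[of "n + j"] by (simp add: add.assoc)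
    show "norm (A (n + j)) \<le> K" for j by (rule K)
    show "trace (mprod (\<lambda>j. A (n + j)) 0 p) = trace (mprod A 0 p)"
      "det (mprod (\<lambda>j. A (n + j)) 0 p) = det (mprod A 0 p)"
      unfolding shift by (rule inv)+
  qed (use that in simp)
  then show ?thesis unfolding asymptotically_periodic_def by blast
qed

section \<open>Lower bound or bounded solutions, according to the roots\<close>

lemma shift_lower_bound:
  fixes W :: "nat \<Rightarrow> complex^2"
  assumes zero: "\<And>n. n < p \<or> n \<ge> M \<Longrightarrow> W n = 0"
  shows "\<bar>1 - cmod \<mu>\<bar> * L2_set (\<lambda>n. norm (W n)) {..<M} \<le>
    L2_set (\<lambda>n. norm (W (n + p) - \<mu> *s W n)) {..<M}"
proof -
  let ?w = "L2_set (\<lambda>n. norm (W n)) {..<M}"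
  let ?d = "L2_set (\<lambda>n. norm (W (n + p) - \<mu> *s W n)) {..<M}"
  \<comment> \<open>As \<open>W\<close> vanishes below \<open>p\<close> and from \<open>M\<close>
    on, no mass is lost and the shift by \<open>p\<close> preserves the norm; the claim is then the
    reverse triangle inequality.\<close>
  have "(\<Sum>n<M. (norm (W (n + p)))\<^sup>2) = (\<Sum>n\<in>(\<lambda>n. n + p) ` {..<M}. (norm (W n))\<^sup>2)"
    by (subst sum.reindex) (auto simp: inj_on_def)
  also have "\<dots> = (\<Sum>n<M. (norm (W n))\<^sup>2)"
  proof (rule sum.mono_neutral_cong)
    fix i assume "i \<in> {..<M} - (\<lambda>n. n + p) ` {..<M}"
    then have i: "i < M" "\<And>x. x < M \<Longrightarrow> i \<noteq> x + p" by auto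
    have "i < p"
    proof (rule ccontr)
      assume "\<not> i < p"
      then show False using i(1) i(2)[of "i - p"] by (simp add: less_imp_diff_less)
    qed
    then show "(norm (W i))\<^sup>2 = 0" by (simp add: zero)
  qed (auto simp: zero)
  finally have shift: "L2_set (\<lambda>n. norm (W (n + p))) {..<M} = ?w" by (simp add: L2_set_def)
  have scale: "L2_set (\<lambda>n. norm (\<mu> *s W n)) {..<M} = cmod \<mu> * ?w"
    by (simp add: norm_smult_vec L2_set_right_distrib)
  have tri1: "norm (W (n + p)) \<le> norm (W (n + p) - \<mu> *s W n) + norm (\<mu> *s W n)" for n
    using norm_triangle_sub by (metis add.commute)
  have tri2: "norm (\<mu> *s W n) \<le> norm (W (n + p) - \<mu> *s W n) + norm (W (n + p))" for n
    using norm_triangle_sub[of "\<mu> *s W n" "W (n + p)"] by (simp add: norm_minus_commute add.commute)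
  have "L2_set (\<lambda>n. norm (W (n + p))) {..<M} \<le> ?d + L2_set (\<lambda>n. norm (\<mu> *s W n)) {..<M}"
    by (rule order_trans[OF L2_set_mono L2_set_triangle_ineq]) (use tri1 in auto)
  moreover have "L2_set (\<lambda>n. norm (\<mu> *s W n)) {..<M} \<le> ?d + L2_set (\<lambda>n. norm (W (n + p))) {..<M}"
    by (rule order_trans[OF L2_set_mono L2_set_triangle_ineq]) (use tri2 in auto)
  ultimately show ?thesis unfolding shift scale by (auto simp: abs_if algebra_simps)
qed

lemma quadratic_roots_complex:
  fixes t D :: complex
  obtains \<nu> \<mu> where "\<nu> + \<mu> = t" "\<nu> * \<mu> = D" "\<nu>\<^sup>2 - t * \<nu> + D = 0" "\<mu>\<^sup>2 - t * \<mu> + D = 0"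
proof -
  define s where "s = csqrt (t\<^sup>2 - 4 * D)"
  have s: "s * s = t\<^sup>2 - 4 * D" using power2_csqrt[of "t\<^sup>2 - 4 * D"] by (simp add: s_def power2_eq_square)
  show ?thesis
  proof (rule that[of "(t + s) / 2" "(t - s) / 2"])
    show "(t + s) / 2 + (t - s) / 2 = t" by (simp add: field_simps)
    show prod: "(t + s) / 2 * ((t - s) / 2) = D"
      using s by (simp add: field_simps power2_eq_square)
    show "((t + s) / 2)\<^sup>2 - t * ((t + s) / 2) + D = 0" "((t - s) / 2)\<^sup>2 - t * ((t - s) / 2) + D = 0"
      unfolding prod[symmetric] by (simp_all add: field_simps power2_eq_square)
  qed
qed

text \<open>By Cayley--Hamilton, the value of \<open>U\<close> two periods ahead satisfies
  \<open>U (n + 2 p) - t U (n + p) + D U n \<approx> 0\<close> up to the residuals; this constant-coefficient recurrence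
  factors into two shifts \<open>S\<^sup>p - \<nu>\<close> and \<open>S\<^sup>p - \<mu>\<close>, each bounded below.\<close>

lemma transfer_lower_bound:
  assumes ap: "asymptotically_periodic p t D A"
    and no_root: "\<And>\<nu>. cmod \<nu> = 1 \<Longrightarrow> \<nu>\<^sup>2 - t * \<nu> + D \<noteq> 0"
  obtains N C where "C > 0"
    "\<forall>U M. (\<forall>n. n < N \<or> n \<ge> M \<longrightarrow> U n = 0) \<longrightarrow> L2_set (\<lambda>n. norm (U n)) {..<M} \<le>
       C * L2_set (\<lambda>n. norm (U (Suc n) - A n *v U n)) {..<M}"
proof -
  obtain K where K: "K \<ge> 1" "\<And>n. norm (A n) \<le> K"
    "\<And>L \<epsilon>. \<epsilon> > 0 \<Longrightarrow> \<exists>N. \<forall>n\<ge>N. periodic_window p t D K A L \<epsilon> n"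
    by (rule asymptotically_periodicE[OF ap]) (rule that; assumption)
  obtain \<nu> \<mu> where roots: "\<nu> + \<mu> = t" "\<nu> * \<mu> = D" "\<nu>\<^sup>2 - t * \<nu> + D = 0" "\<mu>\<^sup>2 - t * \<mu> + D = 0"
    using quadratic_roots_complex .
  define c where "c = \<bar>1 - cmod \<nu>\<bar> * \<bar>1 - cmod \<mu>\<bar>"
  have "cmod \<nu> \<noteq> 1" "cmod \<mu> \<noteq> 1" using no_root roots(3,4) by blast+
  then have "c > 0" unfolding c_def by (intro mult_pos_pos) auto
  define E where "E = 2 * real p * K ^ (2 * p) * (1 + cmod t)"
  \<comment> \<open>\<open>c\<close> is the lower bound for the two shift factors together, and
    \<open>\<epsilon> * E\<close> is the error made by replacing the actual products by those of the
    model; the choice keeps this error at most \<open>c / 2\<close>, half of the main term.\<close>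
  define \<epsilon> where "\<epsilon> = c / (2 * (E + 1))"
  have "E \<ge> 0" using K(1) by (simp add: E_def)
  then have "\<epsilon> > 0" "\<epsilon> * E \<le> c / 2" using \<open>c > 0\<close> by (auto simp: \<epsilon>_def field_simps)
  obtain N where N: "\<And>n. n \<ge> N \<Longrightarrow> periodic_window p t D K A (2 * p) \<epsilon> n"
    using K(3)[OF \<open>\<epsilon> > 0\<close>, of "2 * p"] by blast
  define C' where "C' = K ^ (2 * p) * (1 + cmod t)"
  have "C' > 0" using K(1) by (simp add: C'_def add_pos_nonneg)
  have mono: "K ^ p \<le> K ^ (2 * p)" using K(1) by (intro power_increasing) auto
  \<comment> \<open>For the model the vector on the left vanishes by Cayley--Hamilton, so only the
    perturbation of the two products remains.\<close>
  have near: "norm (mprod A n (2 * p) *v x - t *s (mprod A n p *v x) + D *s x) \<le> c / 2 * norm x"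
    if "n \<ge> N" for n x
  proof -
    obtain P where P: "\<And>j. P (j + p) = P j" "\<And>j. norm (P j) \<le> K" "trace (mprod P 0 p) = t"
      "det (mprod P 0 p) = D" "\<And>j. j \<le> 2 * p \<Longrightarrow> norm (A (n + j) - P j) \<le> \<epsilon>"
      by (rule periodic_windowE[OF N[OF \<open>n \<ge> N\<close>]]) (rule that; assumption)
    have "mprod P 0 (2 * p) *v x = mprod P 0 p *v (mprod P 0 p *v x)"
      using mprod_add[of P 0 p p] mprod_periodic[of P p 1 p, OF P(1)]
      by (simp add: mult_2 matrix_vector_mul_assoc)
    then have CH: "mprod P 0 (2 * p) *v x = t *s (mprod P 0 p *v x) - D *s x"
      unfolding cayley_hamilton_2 P(3,4) .
    have close: "norm (mprod A n k *v x - mprod P 0 k *v x) \<le> real (2 * p) * \<epsilon> * K ^ (2 * p) * norm x"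
      if "k \<le> 2 * p" for k
    proof -
      have "norm (mprod A n k *v x - mprod P 0 k *v x) \<le> real k * \<epsilon> * K ^ k * norm x"
        using P(5) that by (intro mprod_perturbation K P) auto
      also have "\<dots> \<le> real (2 * p) * \<epsilon> * K ^ (2 * p) * norm x"
        using that K(1) \<open>\<epsilon> > 0\<close> by (intro mult_mono power_increasing) auto
      finally show ?thesis .
    qed
    have "mprod A n (2 * p) *v x - t *s (mprod A n p *v x) + D *s x =
        (mprod A n (2 * p) *v x - mprod P 0 (2 * p) *v x) - t *s (mprod A n p *v x - mprod P 0 p *v x)"
      unfolding CH by (simp add: vec_eq_iff algebra_simps)
    also have "norm \<dots> \<le> norm (mprod A n (2 * p) *v x - mprod P 0 (2 * p) *v x) +
        cmod t * norm (mprod A n p *v x - mprod P 0 p *v x)"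
      unfolding norm_smult_vec[symmetric] by (rule norm_triangle_ineq4)
    also have "\<dots> \<le> real (2 * p) * \<epsilon> * K ^ (2 * p) * norm x +
        cmod t * (real (2 * p) * \<epsilon> * K ^ (2 * p) * norm x)"
      by (intro add_mono mult_left_mono close) auto
    also have "\<dots> = \<epsilon> * E * norm x" by (simp add: E_def algebra_simps)
    also have "\<dots> \<le> c / 2 * norm x" using \<open>\<epsilon> * E \<le> c / 2\<close> by (intro mult_right_mono) auto
    finally show ?thesis .
  qed
  show ?thesis
  \<comment> \<open>The margin \<open>2 * p\<close> makes \<open>U\<close> and \<open>W\<close>
    vanish below \<open>p\<close>, as \<open>shift_lower_bound\<close> demands, and \<open>N\<close>
    is where the windows become good. The summand 1 makes the constant positive outright.\<close>
  proof (rule that[of "4 * real p * C' / c + 1" "N + 2 * p"])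
    show "4 * real p * C' / c + 1 > 0" using \<open>C' > 0\<close> \<open>c > 0\<close> by (simp add: add_nonneg_pos)
    show "\<forall>U M. (\<forall>n. n < N + 2 * p \<or> n \<ge> M \<longrightarrow> U n = 0) \<longrightarrow> L2_set (\<lambda>n. norm (U n)) {..<M} \<le>
       (4 * real p * C' / c + 1) * L2_set (\<lambda>n. norm (U (Suc n) - A n *v U n)) {..<M}"
    proof (intro allI impI)
      fix U :: "nat \<Rightarrow> complex^2" and M
      assume U': "\<forall>n. n < N + 2 * p \<or> n \<ge> M \<longrightarrow> U n = 0"
      then have U: "U n = 0" if "n < N + 2 * p \<or> n \<ge> M" for n using that by blast
      let ?F = "\<lambda>n. norm (U (Suc n) - A n *v U n)"
      let ?u = "L2_set (\<lambda>n. norm (U n)) {..<M}" and ?f = "L2_set ?F {..<M}"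
      define G where "G = (\<lambda>n. U (n + 2 * p) - t *s U (n + p) + D *s U n)"
      define W where "W = (\<lambda>n. U (n + p) - \<nu> *s U n)"
      have GW: "G n = W (n + p) - \<mu> *s W n" for n
      proof -
        have "n + 2 * p = n + p + p" by simp
        then show ?thesis
          unfolding G_def W_def roots(1,2)[symmetric] by (simp only: vec_eq_iff) (simp add: algebra_simps)
      qed
      have low: "c * ?u \<le> L2_set (\<lambda>n. norm (G n)) {..<M}"
      proof -
        have "\<bar>1 - cmod \<nu>\<bar> * ?u \<le> L2_set (\<lambda>n. norm (W n)) {..<M}"
          unfolding W_def by (rule shift_lower_bound) (use U in auto)
        then have "\<bar>1 - cmod \<mu>\<bar> * (\<bar>1 - cmod \<nu>\<bar> * ?u) \<le> \<bar>1 - cmod \<mu>\<bar> * L2_set (\<lambda>n. norm (W n)) {..<M}"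
          by (rule mult_left_mono) simp
        then have "c * ?u \<le> \<bar>1 - cmod \<mu>\<bar> * L2_set (\<lambda>n. norm (W n)) {..<M}"
          by (simp add: c_def mult_ac)
        also have "\<dots> \<le> L2_set (\<lambda>n. norm (G n)) {..<M}"
          unfolding GW by (rule shift_lower_bound) (use U in \<open>auto simp: W_def\<close>)
        finally show ?thesis .
      qed
      have G_le: "norm (G n) \<le> c / 2 * norm (U n) + C' * (\<Sum>j<2 * p. ?F (n + j))" for n
      proof -
        define S where "S = K ^ (2 * p) * (\<Sum>j<2 * p. ?F (n + j))"
        \<comment> \<open>\<open>G n\<close> splits into the Cayley--Hamilton defect
          \<open>a\<close> and the deviations \<open>b\<close> and \<open>d\<close> from the
          homogeneous solution after two periods and after one.\<close>
        define a where "a = mprod A n (2 * p) *v U n - t *s (mprod A n p *v U n) + D *s U n"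
        define b where "b = U (n + 2 * p) - mprod A n (2 * p) *v U n"
        define d where "d = U (n + p) - mprod A n p *v U n"
        have a: "norm a \<le> c / 2 * norm (U n)"
        proof (cases "n \<ge> N")
          case False
          then have "n < N + 2 * p" by linarith
          then have "U n = 0" using U by blast
          then show ?thesis by (simp add: a_def)
        next
          case True
          then show ?thesis unfolding a_def by (rule near)
        qed
        have b: "norm b \<le> S" unfolding b_def S_def by (rule mprod_inhomogeneous[OF K(2,1)])
        have "norm d \<le> K ^ p * (\<Sum>j<p. ?F (n + j))"
          unfolding d_def by (rule mprod_inhomogeneous[OF K(2,1)])
        also have "\<dots> \<le> S"
          unfolding S_def using K(1) by (intro mult_mono mono sum_mono2 sum_nonneg) auto
        finally have d: "norm (t *s d) \<le> cmod t * S" unfolding norm_smult_vec by (rule mult_left_mono) simp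
        have Gn: "G n = a + (b - t *s d)"
          unfolding G_def a_def b_def d_def by (simp only: vec_eq_iff) (simp add: algebra_simps)
        have "norm (G n) \<le> c / 2 * norm (U n) + (S + cmod t * S)"
          unfolding Gn using a b d norm_triangle_ineq[of a "b - t *s d"] norm_triangle_ineq4[of b "t *s d"] by linarith
        also have "S + cmod t * S = C' * (\<Sum>j<2 * p. ?F (n + j))"
          by (simp add: S_def C'_def distrib_left distrib_right mult.assoc mult.left_commute)
        finally show ?thesis .
      qed
      have "L2_set (\<lambda>n. norm (G n)) {..<M} \<le>
          L2_set (\<lambda>n. c / 2 * norm (U n) + C' * (\<Sum>j<2 * p. ?F (n + j))) {..<M}"
        by (rule L2_set_mono) (use G_le in auto)
      also have "\<dots> \<le> L2_set (\<lambda>n. c / 2 * norm (U n)) {..<M} + L2_set (\<lambda>n. C' * (\<Sum>j<2 * p. ?F (n + j))) {..<M}"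
        by (rule L2_set_triangle_ineq)
      also have "\<dots> = c / 2 * ?u + C' * L2_set (\<lambda>n. \<Sum>j<2 * p. ?F (n + j)) {..<M}"
      proof -
        have "0 \<le> c / 2" "0 \<le> C'" using \<open>c > 0\<close> \<open>C' > 0\<close> by simp_all
        then show ?thesis by (simp only: L2_set_right_distrib)
      qed
      finally have up: "L2_set (\<lambda>n. norm (G n)) {..<M} \<le>
          c / 2 * ?u + C' * L2_set (\<lambda>n. \<Sum>j<2 * p. ?F (n + j)) {..<M}" .
      have "L2_set (\<lambda>n. \<Sum>j<2 * p. ?F (n + j)) {..<M} \<le> real (2 * p) * ?f"
      proof -
        have single: "L2_set (\<lambda>n. ?F (n + j)) {..<M} \<le> ?f" for j
        proof -
          have "(\<Sum>n<M. (?F (n + j))\<^sup>2) = (\<Sum>n\<in>(\<lambda>n. n + j) ` {..<M}. (?F n)\<^sup>2)"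
            by (subst sum.reindex) (auto simp: inj_on_def)
          also have "\<dots> = (\<Sum>n\<in>(\<lambda>n. n + j) ` {..<M} \<inter> {..<M}. (?F n)\<^sup>2)"
          proof (rule sum.mono_neutral_right)
            have "?F m = 0" if "M \<le> m" for m using that U[of m] U[of "Suc m"] by simp
            then show "\<forall>m\<in>(\<lambda>n. n + j) ` {..<M} - (\<lambda>n. n + j) ` {..<M} \<inter> {..<M}. (?F m)\<^sup>2 = 0"
              by (metis DiffE IntI lessThan_iff not_le zero_power2)
          qed auto
          also have "\<dots> \<le> (\<Sum>n<M. (?F n)\<^sup>2)" by (rule sum_mono2) auto
          finally show ?thesis by (simp add: L2_set_def)
        qed
        have "L2_set (\<lambda>n. \<Sum>j<k. ?F (n + j)) {..<M} \<le> real k * ?f" for k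
        proof (induction k)
          case (Suc k)
          have "L2_set (\<lambda>n. (\<Sum>j<k. ?F (n + j)) + ?F (n + k)) {..<M} \<le>
              L2_set (\<lambda>n. \<Sum>j<k. ?F (n + j)) {..<M} + L2_set (\<lambda>n. ?F (n + k)) {..<M}"
            by (rule L2_set_triangle_ineq)
          also have "\<dots> \<le> real k * ?f + ?f" using Suc single by (rule add_mono)
          finally show ?case by (simp add: algebra_simps)
        qed (simp add: L2_set_def)
        then show ?thesis .
      qed
      then have "C' * L2_set (\<lambda>n. \<Sum>j<2 * p. ?F (n + j)) {..<M} \<le> C' * (real (2 * p) * ?f)"
        using \<open>C' > 0\<close> by (intro mult_left_mono) auto
      with low up have "c * ?u \<le> c / 2 * ?u + C' * (real (2 * p) * ?f)" by linarith
      \<comment> \<open>The error \<open>c / 2 * ?u\<close> is absorbed into the left side, which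
        doubles the constant.\<close>
      then have "?u \<le> (4 * real p * C' / c) * ?f" using \<open>c > 0\<close> by (simp add: field_simps)
      also have "\<dots> \<le> (4 * real p * C' / c + 1) * ?f" by (simp add: distrib_right)
      finally show "?u \<le> (4 * real p * C' / c + 1) * ?f" .
    qed
  qed
qed

text \<open>An eigenvector for \<open>\<nu>\<close> of the one-period matrix of the model gives a
  model solution of norm 1 at all multiples of \<open>p\<close> and at most \<open>K ^ p\<close> in
  between. It is the initial value for the actual recursion. The bound \<open>C\<close> does not
  depend on the number \<open>L\<close> of periods, so the cost of truncation becomes negligible as
  \<open>L\<close> grows.\<close>

lemma bounded_transfer_solutions:
  assumes ap: "asymptotically_periodic p t D A" and "p \<ge> 1"
    and \<nu>: "cmod \<nu> = 1" "\<nu>\<^sup>2 - t * \<nu> + D = 0"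
  obtains C where "C > 0" "\<forall>L. \<exists>N. \<forall>n\<ge>N. \<exists>V. (\<forall>j. V (Suc j) = A (n + j) *v V j) \<and>
    (\<forall>j\<le>L * p. norm (V j) \<le> C) \<and> (\<forall>k\<le>L. 1 / 2 \<le> norm (V (k * p)))"
proof -
  obtain K where K: "K \<ge> 1" "\<And>n. norm (A n) \<le> K"
    "\<And>L \<epsilon>. \<epsilon> > 0 \<Longrightarrow> \<exists>N. \<forall>n\<ge>N. periodic_window p t D K A L \<epsilon> n"
    by (rule asymptotically_periodicE[OF ap]) (rule that; assumption)
  show ?thesis
  proof (rule that[of "K ^ p + 1"])
    show "K ^ p + 1 > 0" using K(1) by (simp add: add_nonneg_pos)
    show "\<forall>L. \<exists>N. \<forall>n\<ge>N. \<exists>V. (\<forall>j. V (Suc j) = A (n + j) *v V j) \<and>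
        (\<forall>j\<le>L * p. norm (V j) \<le> K ^ p + 1) \<and> (\<forall>k\<le>L. 1 / 2 \<le> norm (V (k * p)))"
    proof
      fix L
      define R where "R = real (L * p) * K ^ (L * p)"
      \<comment> \<open>\<open>\<epsilon> * R\<close> bounds the drift between actual and model
        solution over \<open>L\<close> periods; a drift of at most 1/2 keeps the norm at least 1/2
        at multiples of \<open>p\<close>.\<close>
      define \<epsilon> where "\<epsilon> = 1 / (2 * (R + 1))"
      have "R \<ge> 0" using K(1) by (simp add: R_def)
      then have \<epsilon>: "\<epsilon> > 0" "\<epsilon> * R \<le> 1 / 2" by (auto simp: \<epsilon>_def field_simps)
      obtain N where N: "\<And>n. n \<ge> N \<Longrightarrow> periodic_window p t D K A (L * p) \<epsilon> n"
        using K(3)[OF \<epsilon>(1), of "L * p"] by blast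
      have "\<exists>V. (\<forall>j. V (Suc j) = A (n + j) *v V j) \<and> (\<forall>j\<le>L * p. norm (V j) \<le> K ^ p + 1) \<and>
          (\<forall>k\<le>L. 1 / 2 \<le> norm (V (k * p)))" if "n \<ge> N" for n
      proof -
        obtain P where P: "\<And>j. P (j + p) = P j" "\<And>j. norm (P j) \<le> K" "trace (mprod P 0 p) = t"
          "det (mprod P 0 p) = D" "\<And>j. j \<le> L * p \<Longrightarrow> norm (A (n + j) - P j) \<le> \<epsilon>"
          by (rule periodic_windowE[OF N[OF \<open>n \<ge> N\<close>]]) (rule that; assumption)
        obtain v where v: "norm v = 1" "mprod P 0 p *v v = \<nu> *s v"
          using eigenvector_2[of \<nu> "mprod P 0 p"] \<nu>(2) P(3,4) by metis
        have mult: "mprod P 0 (k * p) *v v = \<nu> ^ k *s v" for k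
        proof (induction k)
          case (Suc k)
          have "mprod P 0 (Suc k * p) *v v = mprod P (k * p) p *v (mprod P 0 (k * p) *v v)"
            using mprod_add[of P 0 "k * p" p] by (simp add: add.commute matrix_vector_mul_assoc)
          also have "mprod P (k * p) p = mprod P 0 p" by (rule mprod_periodic) (rule P)
          finally show ?case by (simp add: Suc matrix_vector_smult v(2) vector_smult_assoc mult.commute)
        qed simp
        have bound: "norm (mprod P 0 j *v v) \<le> K ^ p" for j
        proof -
          have "mprod P 0 j *v v = mprod P (j div p * p) (j mod p) *v (mprod P 0 (j div p * p) *v v)"
            using mprod_add[of P 0 "j div p * p" "j mod p"] by (simp add: matrix_vector_mul_assoc)
          also have "mprod P (j div p * p) (j mod p) = mprod P 0 (j mod p)"
            by (rule mprod_periodic) (rule P)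
          also have "norm (mprod P 0 (j mod p) *v (mprod P 0 (j div p * p) *v v)) \<le>
              K ^ (j mod p) * norm (mprod P 0 (j div p * p) *v v)"
            by (rule mprod_norm) (use P K in auto)
          also have "\<dots> = K ^ (j mod p)" by (simp add: mult norm_smult_vec norm_power \<nu>(1) v(1))
          also have "\<dots> \<le> K ^ p" using K(1) \<open>p \<ge> 1\<close> by (intro power_increasing) (auto intro: less_imp_le)
          finally show ?thesis .
        qed
        have close: "norm (mprod A n j *v v - mprod P 0 j *v v) \<le> 1 / 2" if "j \<le> L * p" for j
        proof -
          have "norm (mprod A n j *v v - mprod P 0 j *v v) \<le> real j * \<epsilon> * K ^ j * norm v"
            using P(5) that by (intro mprod_perturbation K P) auto
          also have "\<dots> \<le> real (L * p) * \<epsilon> * K ^ (L * p) * 1"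
            unfolding v(1) using that K(1) \<epsilon>(1) by (intro mult_mono power_increasing) (auto simp del: of_nat_mult)
          also have "\<dots> = \<epsilon> * R" by (simp add: R_def)
          finally show ?thesis using \<epsilon>(2) by linarith
        qed
        show ?thesis
        proof (intro exI[of _ "\<lambda>j. mprod A n j *v v"] conjI allI impI)
          show "mprod A n (Suc j) *v v = A (n + j) *v (mprod A n j *v v)" for j by (rule mprod_vector_Suc)
          show "norm (mprod A n j *v v) \<le> K ^ p + 1" if "j \<le> L * p" for j
            using close[OF that] bound[of j] norm_triangle_sub[of "mprod A n j *v v" "mprod P 0 j *v v"]
            by linarith
          show "1 / 2 \<le> norm (mprod A n (k * p) *v v)" if "k \<le> L" for k
          proof -
            have "norm (mprod P 0 (k * p) *v v) = 1"
              by (simp add: mult norm_smult_vec norm_power \<nu>(1) v(1))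
            moreover have "k * p \<le> L * p" using that by simp
            ultimately show ?thesis
              using close[of "k * p"] norm_triangle_sub[of "mprod P 0 (k * p) *v v" "mprod A n (k * p) *v v"]
              by (simp add: norm_minus_commute)
          qed
        qed
      qed
      then show "\<exists>N. \<forall>n\<ge>N. \<exists>V. (\<forall>j. V (Suc j) = A (n + j) *v V j) \<and>
          (\<forall>j\<le>L * p. norm (V j) \<le> K ^ p + 1) \<and> (\<forall>k\<le>L. 1 / 2 \<le> norm (V (k * p)))"
        by blast
    qed
  qed
qed

section \<open>Jacobi matrices with asymptotically periodic transfer matrices\<close>

lemma norm_l2_finite_support:
  assumes "\<And>n. n \<ge> M \<Longrightarrow> l2_fun x n = 0"
  shows "norm x = L2_set (\<lambda>n. cmod (l2_fun x n)) {..<M::nat}"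
proof -
  have "(norm x)\<^sup>2 = (\<Sum>\<^sub>\<infinity>n\<in>{..<M}. (cmod (l2_fun x n))\<^sup>2)"
    unfolding norm_l2_square by (intro infsum_cong_neutral) (use assms in auto)
  then show ?thesis unfolding L2_set_def by (metis finite_lessThan infsum_finite norm_ge_zero real_sqrt_unique)
qed

lemma L2_set_le_norm_l2: "finite F \<Longrightarrow> L2_set (\<lambda>n. cmod (l2_fun x n)) F \<le> norm x"
  unfolding L2_set_def by (intro real_le_lsqrt sum_le_norm_l2) auto

lemma norm_vec_2: "(norm (v :: complex^2))\<^sup>2 = (cmod (v $ 1))\<^sup>2 + (cmod (v $ 2))\<^sup>2"
  unfolding norm_vec_def L2_set_def by (simp add: sum_2)

lemma finite_support_bound:
  fixes u :: "nat \<Rightarrow> complex"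
  assumes "finite {n. u n \<noteq> 0}"
  obtains M where "\<And>n. n \<ge> M \<Longrightarrow> u n = 0"
proof -
  obtain M where "\<forall>n\<in>{n. u n \<noteq> 0}. n < M"
    using assms finite_nat_set_iff_bounded by blast
  then show ?thesis using that[of M] by (auto simp: not_less[symmetric])
qed

text \<open>Takes \<open>(u n, u (n - 1))\<close> to \<open>(u (n + 1), u n)\<close> along a
  solution; it is \<open>jacobi_step\<close> over the complex numbers. The parameters are separate
  real arguments so that continuity on a compact box can be used.\<close>

definition jacobi_matrix :: "real \<Rightarrow> real \<Rightarrow> real \<Rightarrow> real \<Rightarrow> complex^2^2" where
  "jacobi_matrix x a0 a1 b1 =
     vector [vector [of_real ((x - b1) / a1), of_real (- a0 / a1)], vector [1, 0]]"

lemma jacobi_matrix_mult: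
  "(jacobi_matrix x a0 a1 b1 *v v) $ 1 = of_real ((x - b1) / a1) * v $ 1 + of_real (- a0 / a1) * v $ 2"
  "(jacobi_matrix x a0 a1 b1 *v v) $ 2 = v $ 1"
  by (simp_all add: jacobi_matrix_def matrix_vector_mult_def sum_2)

lemma jacobi_matrix_mult_scaled:
  assumes "a1 \<noteq> 0"
  shows "of_real a1 * (jacobi_matrix x a0 a1 b1 *v v) $ 1 = of_real (x - b1) * v $ 1 - of_real a0 * v $ 2"
proof -
  have "complex_of_real a1 * of_real ((x - b1) / a1) = of_real (x - b1)"
    "complex_of_real a1 * of_real (- a0 / a1) = - of_real a0"
    using assms by simp_all
  then show ?thesis
    unfolding jacobi_matrix_mult distrib_left mult.assoc[symmetric] by simp
qed

definition jacobi_steps :: "(nat \<Rightarrow> real) \<Rightarrow> (nat \<Rightarrow> real) \<Rightarrow> real \<Rightarrow> nat \<Rightarrow> complex^2^2" where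
  "jacobi_steps a b x n = jacobi_matrix x (a (n - 1)) (a n) (b n)"

text \<open>Uniform positivity is part of the notion because the difference equation is divided by
  \<open>a n\<close>; index 0 is left out, being outside the half line.\<close>

definition tame_parameters :: "real \<Rightarrow> real \<Rightarrow> (nat \<Rightarrow> real) \<Rightarrow> (nat \<Rightarrow> real) \<Rightarrow> bool" where
  "tame_parameters \<delta> K a b \<longleftrightarrow> \<delta> > 0 \<and> (\<forall>n\<ge>1. \<delta> \<le> a n \<and> a n \<le> K \<and> \<bar>b n\<bar> \<le> K)"

lemma tame_parametersD:
  assumes "tame_parameters \<delta> K a b"
  shows "\<delta> > 0" "n \<ge> 1 \<Longrightarrow> \<delta> \<le> a n" "n \<ge> 1 \<Longrightarrow> a n > 0" "n \<ge> 1 \<Longrightarrow> \<bar>a n\<bar> \<le> K"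
    "n \<ge> 1 \<Longrightarrow> \<bar>b n\<bar> \<le> K" "K > 0"
proof -
  have all: "\<delta> > 0" "\<And>n. n \<ge> 1 \<Longrightarrow> \<delta> \<le> a n \<and> a n \<le> K \<and> \<bar>b n\<bar> \<le> K"
    using assms unfolding tame_parameters_def by blast+
  show "\<delta> > 0" by (rule all)
  show "n \<ge> 1 \<Longrightarrow> \<delta> \<le> a n" "n \<ge> 1 \<Longrightarrow> a n > 0" "n \<ge> 1 \<Longrightarrow> \<bar>a n\<bar> \<le> K"
    "n \<ge> 1 \<Longrightarrow> \<bar>b n\<bar> \<le> K" "K > 0"
    using all(1) all(2)[of n] all(2)[of 1] by auto
qed

lemma jacobi_half_shifted_operator:
  assumes tame: "tame_parameters \<delta> K a b"
  shows "bounded_op UNIV (shifted (jacobi_half a b) z)"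
    "inner (op_of (shifted (jacobi_half a b) z) x) y = inner x (op_of (shifted (jacobi_half a b) (cnj z)) y)"
    "\<bar>Im z\<bar> * norm x \<le> norm (op_of (shifted (jacobi_half a b) z) x)"
    "u \<in> ell2 {1..} \<Longrightarrow> shifted (jacobi_half a b) z u \<in> ell2 {1..}"
proof -
  have J: "bounded_op UNIV (jacobi_half a b)"
    "inner (op_of (jacobi_half a b) x) y = inner x (op_of (jacobi_half a b) y)" for x y
    using jacobi_half_operator[of a K b] tame_parametersD[OF tame] by blast+
  show b: "bounded_op UNIV (shifted (jacobi_half a b) z)" using J(1) by (rule bounded_op_shifted)
  show "inner (op_of (shifted (jacobi_half a b) z) x) y = inner x (op_of (shifted (jacobi_half a b) (cnj z)) y)"
    using J by (intro shifted_adjoint)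
  show "\<bar>Im z\<bar> * norm x \<le> norm (op_of (shifted (jacobi_half a b) z) x)"
    unfolding bounded_op_shifted(2)[OF J(1)]
    by (rule selfadjoint_lower_bound) (simp_all add: op_of_cscale J)
  show "shifted (jacobi_half a b) z u \<in> ell2 {1..}" if u: "u \<in> ell2 {1..}"
  proof -
    have "u \<in> ell2 UNIV" "u 0 = 0" using u by (simp_all add: ell2_def)
    then show ?thesis
      using bounded_opD(1)[OF b, of u] by (subst ell2_iff) (simp add: shifted_def jacobi_half_def not_less_eq_eq)
  qed
qed

text \<open>The recursion can be solved forward since \<open>a n > 0\<close>. It is stated for
  arbitrary \<open>h\<close> because the formal solutions met in \<open>not_fredholmI\<close> need
  not be square summable.\<close>

lemma jacobi_half_formal_solution_unique:
  assumes a: "\<And>n. n \<ge> 1 \<Longrightarrow> a n > 0" and h: "shifted (jacobi_half a b) z h = (\<lambda>i. 0)"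
    and "h 0 = 0" "h 1 = 0"
  shows "h = (\<lambda>i. 0)"
proof -
  have "h n = 0 \<and> h (Suc n) = 0" for n
  proof (induction n)
    case (Suc n)
    have "shifted (jacobi_half a b) z h (Suc n) = 0" by (simp add: h)
    then have "of_real (a (Suc n)) * h (Suc (Suc n)) = 0"
      using Suc by (simp add: shifted_def jacobi_half_def split: if_splits)
    then show ?case using a[of "Suc n"] Suc by simp
  qed (use assms in simp)
  then show ?thesis by blast
qed

lemma jacobi_half_lower_bound:
  assumes tame: "tame_parameters \<delta> K a b"
    and ap: "asymptotically_periodic p t D (jacobi_steps a b x)"
    and no_root: "\<And>\<nu>. cmod \<nu> = 1 \<Longrightarrow> \<nu>\<^sup>2 - t * \<nu> + D \<noteq> 0"
  obtains N c where "c > 0" "\<forall>y. l2_fun y \<in> ell2 {N..} \<longrightarrow>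
    c * norm y \<le> norm (op_of (shifted (jacobi_half a b) (of_real x)) y)"
proof -
  obtain N C where NC: "C > 0" "\<forall>U M. (\<forall>n. n < N \<or> n \<ge> M \<longrightarrow> U n = 0) \<longrightarrow> L2_set (\<lambda>n. norm (U n)) {..<M} \<le>
       C * L2_set (\<lambda>n. norm (U (Suc n) - jacobi_steps a b x n *v U n)) {..<M}"
    by (rule transfer_lower_bound[OF ap no_root], assumption, rule that)
  let ?B = "shifted (jacobi_half a b) (of_real x)"
  note B = jacobi_half_shifted_operator[OF tame, where z = "of_real x"]
  note pos = tame_parametersD[OF tame]
  show ?thesis
  \<comment> \<open>The factor \<open>\<delta>\<close> is the price for dividing the equation by
    \<open>a n\<close>. The margin 2 makes \<open>(u n, u (n - 1))\<close> vanish below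
    \<open>N\<close>, and \<open>u 0\<close> and \<open>u 1\<close> as well, so that the boundary of
    the half line is invisible.\<close>
  proof (rule that[of "\<delta> / C" "N + 2"])
    show "\<delta> / C > 0" using NC(1) pos by simp
    have "\<delta> / C * norm y \<le> norm (op_of ?B y)" if y: "l2_fun y \<in> ell2 {N + 2..}" for y
    proof (rule lower_bound_from_finite_support[OF bounded_linear_op_of[OF B(1)] _ _ y])
      show "0 \<le> \<delta> / C" using NC(1) pos by simp
      fix y :: "nat l2" assume y: "l2_fun y \<in> ell2 {N + 2..}" and fin: "finite {i. l2_fun y i \<noteq> 0}"
      define u where "u = l2_fun y"
      obtain M where M: "\<And>n. n \<ge> M \<Longrightarrow> u n = 0"
        using finite_support_bound[OF fin] unfolding u_def by blast
      have u0: "u n = 0" if "n < N + 2" for n using y that by (auto simp: u_def ell2_def)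
      define U :: "nat \<Rightarrow> complex^2" where "U = (\<lambda>n. vector [u n, u (n - 1)])"
      define f where "f = ?B u"
      have U: "U n = 0" if "n < N \<or> n \<ge> M + 1" for n
        using that M[of n] M[of "n - 1"] u0[of n] u0[of "n - 1"] by (auto simp: U_def vec_eq_iff forall_2)
      \<comment> \<open>The second components agree by construction, so the residual of the
        first-order system is the scalar residual divided by \<open>a n\<close>.\<close>
      have res: "norm (U (Suc n) - jacobi_steps a b x n *v U n) \<le> (1 / \<delta>) * cmod (f n)" for n
      proof (cases "n = 0")
        case True
        then have "U (Suc n) - jacobi_steps a b x n *v U n = 0"
          using u0[of 0] u0[of 1] by (simp add: U_def vec_eq_iff forall_2 jacobi_steps_def jacobi_matrix_mult)
        then show ?thesis using pos(1) by simp
      next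
        case False
        then have an: "a n > 0" "\<delta> \<le> a n" using pos by auto
        let ?d = "U (Suc n) - jacobi_steps a b x n *v U n"
        have d2: "?d $ 2 = 0" by (simp add: U_def jacobi_steps_def jacobi_matrix_mult)
        have fn: "f n = of_real (a n) * u (Suc n) + of_real (b n) * u n + of_real (a (n - 1)) * u (n - 1) - of_real x * u n"
          using False u0[of 0] by (simp add: f_def shifted_def jacobi_half_def)
        have "of_real (a n) * ?d $ 1 = f n"
          using jacobi_matrix_mult_scaled[of "a n" x "a (n - 1)" "b n" "U n"] an(1) unfolding fn
          by (simp add: U_def jacobi_steps_def algebra_simps)
        then have "a n * cmod (?d $ 1) = cmod (f n)"
          using an(1) by (metis abs_of_pos norm_mult norm_of_real)
        moreover have "\<delta> * cmod (?d $ 1) \<le> a n * cmod (?d $ 1)" using an by (intro mult_right_mono) auto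
        moreover have "norm ?d = cmod (?d $ 1)"
          using norm_vec_2[of ?d] d2 by (metis add.right_neutral norm_ge_zero norm_zero power2_eq_iff_nonneg zero_power2)
        ultimately show ?thesis using pos(1) by (simp add: field_simps)
      qed
      have "norm y = L2_set (\<lambda>n. cmod (u n)) {..<M + 1}"
        unfolding u_def by (rule norm_l2_finite_support) (use M in \<open>simp add: u_def\<close>)
      also have "\<dots> \<le> L2_set (\<lambda>n. norm (U n)) {..<M + 1}"
      proof (rule L2_set_mono)
        show "cmod (u n) \<le> norm (U n)" for n
          using Finite_Cartesian_Product.norm_nth_le[of "U n" 1] by (simp add: U_def)
      qed simp
      also have "\<dots> \<le> C * L2_set (\<lambda>n. norm (U (Suc n) - jacobi_steps a b x n *v U n)) {..<M + 1}"
        using U by (intro NC(2)[rule_format]) auto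
      also have "\<dots> \<le> C * L2_set (\<lambda>n. (1 / \<delta>) * cmod (f n)) {..<M + 1}"
        using NC(1) res by (intro mult_left_mono L2_set_mono) auto
      also have "\<dots> = C * (1 / \<delta>) * L2_set (\<lambda>n. cmod (f n)) {..<M + 1}"
      proof -
        have "0 \<le> 1 / \<delta>" using pos(1) by simp
        then show ?thesis by (simp only: L2_set_right_distrib[symmetric] mult.assoc)
      qed
      also have "\<dots> \<le> C * (1 / \<delta>) * norm (op_of ?B y)"
        using L2_set_le_norm_l2[of "{..<M + 1}" "op_of ?B y"] NC(1) pos(1)
        by (intro mult_left_mono) (auto simp: f_def u_def l2_fun_op_of B(1))
      finally show "\<delta> / C * norm y \<le> norm (op_of ?B y)"
        using NC(1) pos(1) by (simp add: field_simps)
    qed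
    then show "\<forall>y. l2_fun y \<in> ell2 {N + 2..} \<longrightarrow> \<delta> / C * norm y \<le> norm (op_of ?B y)" by blast
  qed
qed

text \<open>Each of the two cuts of a truncated solution leaves at most two residual entries, of
  size at most \<open>Q\<close>, so the squared residual stays below \<open>4 * Q^2\<close> whatever
  the length of the window, while \<open>\<Lambda>\<close> grows with it.\<close>

lemma approximate_eigenvectorI:
  fixes u :: "nat \<Rightarrow> complex"
  assumes B: "bounded_op UNIV B" and u: "u \<in> ell2 UNIV"
    and E: "finite E" "card E \<le> 4" "\<And>m. m \<notin> E \<Longrightarrow> B u m = 0" and small: "\<And>m. cmod (B u m) \<le> Q"
    and lower: "\<Lambda> \<le> (norm (Abs_l2 u))\<^sup>2" "4 * Q\<^sup>2 < \<epsilon>\<^sup>2 * \<Lambda>" and "\<epsilon> > 0"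
  shows "ell2_norm u > 0" "ell2_norm (B u) \<le> \<epsilon> * ell2_norm u"
proof -
  define y where "y = Abs_l2 u"
  have y: "l2_fun y = u" unfolding y_def using u by simp
  have By: "l2_fun (op_of B y) = B u" by (simp add: l2_fun_op_of[OF B] y)
  have "(norm (op_of B y))\<^sup>2 = (\<Sum>\<^sub>\<infinity>m\<in>E. (cmod (B u m))\<^sup>2)"
    unfolding norm_l2_square By by (intro infsum_cong_neutral) (use E(3) in auto)
  also have "\<dots> = (\<Sum>m\<in>E. (cmod (B u m))\<^sup>2)" using E(1) by (rule infsum_finite)
  also have "\<dots> \<le> real (card E) * Q\<^sup>2"
    by (rule sum_bounded_above) (use small in \<open>auto intro: power_mono\<close>)
  also have "\<dots> \<le> 4 * Q\<^sup>2" using E(2) by (intro mult_right_mono) auto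
  finally have upper: "(norm (op_of B y))\<^sup>2 \<le> 4 * Q\<^sup>2" .
  have below: "\<epsilon>\<^sup>2 * \<Lambda> \<le> \<epsilon>\<^sup>2 * (norm y)\<^sup>2" using lower(1) by (intro mult_left_mono) (auto simp: y_def)
  have "y \<noteq> 0"
  proof
    assume "y = 0"
    then have "\<epsilon>\<^sup>2 * \<Lambda> \<le> 0" using below by simp
    then show False using lower(2) zero_le_power2[of Q] by linarith
  qed
  then show "ell2_norm u > 0" by (simp add: norm_l2_eq[symmetric] y[symmetric])
  have "(norm (op_of B y))\<^sup>2 \<le> (\<epsilon> * norm y)\<^sup>2"
    unfolding power_mult_distrib using upper below lower(2) by linarith
  then have "norm (op_of B y) \<le> \<epsilon> * norm y" by (rule power2_le_imp_le) (use \<open>\<epsilon> > 0\<close> in simp)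
  then show "ell2_norm (B u) \<le> \<epsilon> * ell2_norm u" by (simp add: norm_l2_eq By y)
qed

text \<open>Truncating a solution that stays bounded above and below on a long window gives an approximate
  eigenvector, because the residual is supported near the two ends of the window.\<close>

lemma jacobi_half_weyl:
  assumes tame: "tame_parameters \<delta> K a b"
    and ap: "asymptotically_periodic p t D (jacobi_steps a b x)" and "p \<ge> 1"
    and root: "cmod \<nu> = 1" "\<nu>\<^sup>2 - t * \<nu> + D = 0" and "\<epsilon> > 0"
  shows "\<exists>u\<in>ell2 ({1..} \<inter> {N..}). finite {i. u i \<noteq> 0} \<and> ell2_norm u > 0 \<and>
    ell2_norm (shifted (jacobi_half a b) (of_real x) u) \<le> \<epsilon> * ell2_norm u"
proof -
  let ?A = "jacobi_steps a b x" and ?B = "shifted (jacobi_half a b) (of_real x)"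
  note pos = tame_parametersD[OF tame]
  obtain C where C: "C > 0" "\<forall>L. \<exists>N. \<forall>n\<ge>N. \<exists>V. (\<forall>j. V (Suc j) = ?A (n + j) *v V j) \<and>
      (\<forall>j\<le>L * p. norm (V j) \<le> C) \<and> (\<forall>k\<le>L. 1 / 2 \<le> norm (V (k * p)))"
    by (rule bounded_transfer_solutions[OF ap \<open>p \<ge> 1\<close> root]) (rule that)
  \<comment> \<open>Bound for one entry of the residual: three matrix entries of size at most
    \<open>K\<close>, the term with \<open>x\<close>, and values of \<open>u\<close> of size at most
    \<open>C\<close>.\<close>
  define Q where "Q = (3 * K + \<bar>x\<bar>) * C"
  have "Q > 0" using C(1) pos(6) by (simp add: Q_def add_pos_nonneg)
  \<comment> \<open>The constant is 4 times 8: four residual entries against a squared norm of at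
    least \<open>L / 8\<close>.\<close>
  obtain L :: nat where "L > 32 * Q\<^sup>2 / \<epsilon>\<^sup>2" using reals_Archimedean2 by blast
  then have L: "4 * Q\<^sup>2 < \<epsilon>\<^sup>2 * (real L / 8)" using \<open>\<epsilon> > 0\<close> by (simp add: field_simps)
  obtain N0 where N0: "\<And>n. n \<ge> N0 \<Longrightarrow> \<exists>V. (\<forall>j. V (Suc j) = ?A (n + j) *v V j) \<and>
      (\<forall>j\<le>L * p. norm (V j) \<le> C) \<and> (\<forall>k\<le>L. 1 / 2 \<le> norm (V (k * p)))"
    using C(2) by blast
  define n where "n = max N0 (max N 2)"
  have n: "n \<ge> N0" "n \<ge> N" "n \<ge> 2" by (auto simp: n_def)
  obtain V where V: "\<And>j. V (Suc j) = ?A (n + j) *v V j" "\<And>j. j \<le> L * p \<Longrightarrow> norm (V j) \<le> C"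
      "\<And>k. k \<le> L \<Longrightarrow> 1 / 2 \<le> norm (V (k * p))"
    using N0[OF n(1)] by blast
  define u where "u = (\<lambda>m. if n \<le> m \<and> m \<le> n + L * p then V (m - n) $ 1 else 0)"
  define W where "W = {n..n + L * p}"
  have u0: "u m = 0" if "m \<notin> W" for m using that by (auto simp: u_def W_def)
  have uV: "u (n + j) = V j $ 1" if "j \<le> L * p" for j using that by (simp add: u_def)
  have fin: "finite {i. u i \<noteq> 0}" by (rule finite_subset[of _ W]) (use u0 in blast, simp add: W_def)
  have u_ell2: "u \<in> ell2 UNIV" using fin by (rule ell2_finite_support)
  have uC: "cmod (u m) \<le> C" for m
  proof (cases "m \<in> W")
    case True
    then have "cmod (u m) \<le> norm (V (m - n))" and "m - n \<le> L * p"
      using Finite_Cartesian_Product.norm_nth_le[of "V (m - n)" 1] by (auto simp: u_def W_def)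
    then show ?thesis using V(2) by fastforce
  qed (use u0 C(1) in simp)
  have V2: "V (Suc j) $ 2 = V j $ 1" for j
    unfolding V(1) by (simp add: jacobi_steps_def jacobi_matrix_mult)
  \<comment> \<open>Cutting at \<open>n\<close> and \<open>n + L * p\<close> spoils the three-term
    equation only at the end points and their outer neighbours.\<close>
  let ?E = "{n - 1, n, n + L * p, n + L * p + 1}"
  have zero: "?B u m = 0" if "m \<notin> ?E" for m
  proof (cases "m \<in> W")
    case True
    with that have m: "n < m" "m < n + L * p" by (auto simp: W_def)
    obtain j where "m = Suc (n + j)" using less_imp_Suc_add[OF m(1)] by blast
    with m have j: "m = n + Suc j" "Suc j < L * p" by simp_all
    have am: "a m > 0" using pos(3)[of m] n j by simp
    have um: "u m = V (Suc j) $ 1" "u (m + 1) = V (Suc (Suc j)) $ 1" "u (m - 1) = V (Suc j) $ 2"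
      using uV[of "Suc j"] uV[of "Suc (Suc j)"] uV[of j] j V2[of j] by simp_all
    have "of_real (a m) * V (Suc (Suc j)) $ 1 =
        of_real (x - b m) * V (Suc j) $ 1 - of_real (a (m - 1)) * V (Suc j) $ 2"
      using jacobi_matrix_mult_scaled[of "a m" x "a (m - 1)" "b m" "V (Suc j)"] am
      unfolding V(1)[of "Suc j"] by (simp add: jacobi_steps_def j)
    then show ?thesis
      using n j um by (simp add: shifted_def jacobi_half_def algebra_simps)
  next
    case False
    with that n have "u m = 0" "u (m + 1) = 0" "u (m - 1) = 0"
      by (auto intro!: u0 simp: W_def)
    then show ?thesis by (simp add: shifted_def jacobi_half_def)
  qed
  have small: "cmod (?B u m) \<le> Q" for m
  proof (cases "m = 0")
    case True
    then show ?thesis using n u0[of 0] \<open>Q > 0\<close> by (simp add: shifted_def jacobi_half_def W_def)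
  next
    case False
    have bd: "cmod (of_real r * u i) \<le> R * C" if "\<bar>r\<bar> \<le> R" for r R i
      using that uC[of i] by (simp add: norm_mult mult_mono)
    have a1: "cmod (if m = 1 then 0 else of_real (a (m - 1)) * u (m - 1)) \<le> K * C"
      using bd[of "a (m - 1)" K "m - 1"] pos(4)[of "m - 1"] False pos(6) C(1) by auto
    have "?B u m = of_real (a m) * u (m + 1) + of_real (b m) * u m +
        (if m = 1 then 0 else of_real (a (m - 1)) * u (m - 1)) - of_real x * u m"
      using False by (simp add: shifted_def jacobi_half_def)
    also have "cmod \<dots> \<le> (K * C + K * C + K * C) + \<bar>x\<bar> * C"
      using False a1 bd[of "a m" K "m + 1"] bd[of "b m" K m] bd[of x "\<bar>x\<bar>" m] pos(4,5)[of m]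
      by (intro norm_triangle_le_diff norm_triangle_le add_mono) auto
    also have "\<dots> = Q" by (simp add: Q_def algebra_simps)
    finally show ?thesis .
  qed
  define y where "y = Abs_l2 u"
  have y: "l2_fun y = u" unfolding y_def using u_ell2 by simp
  have B: "bounded_op UNIV ?B" by (rule jacobi_half_shifted_operator[OF tame])
  have lower: "real L / 8 \<le> (norm y)\<^sup>2"
  proof -
    \<comment> \<open>The second component of \<open>V (k * p)\<close> is the value of
      \<open>u\<close> one place to the left. Starting with \<open>k = 1\<close> keeps that place
      inside the window. Each coordinate is counted at most twice, which turns \<open>L / 4\<close>
      into \<open>L / 8\<close>.\<close>
    have quarter: "1 / 4 \<le> (cmod (u (n + k * p)))\<^sup>2 + (cmod (u (n + k * p - 1)))\<^sup>2" if "k \<in> {1..L}" for k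
    proof -
      have kp: "k * p \<le> L * p" using that by simp
      have "k * p \<noteq> 0" using that \<open>p \<ge> 1\<close> by simp
      then obtain j where j: "k * p = Suc j" using not0_implies_Suc by blast
      have "u (n + k * p) = V (k * p) $ 1" "u (n + k * p - 1) = V (k * p) $ 2"
        using uV[OF kp] uV[of j] V2[of j] kp j by simp_all
      then have "(norm (V (k * p)))\<^sup>2 = (cmod (u (n + k * p)))\<^sup>2 + (cmod (u (n + k * p - 1)))\<^sup>2"
        by (simp add: norm_vec_2)
      moreover have "(1 / 2)\<^sup>2 \<le> (norm (V (k * p)))\<^sup>2" using V(3)[of k] that by (intro power_mono) auto
      ultimately show ?thesis by (simp add: power2_eq_square)
    qed
    have part: "(\<Sum>k\<in>{1..L}. (cmod (u (g k)))\<^sup>2) \<le> (norm y)\<^sup>2" if "inj_on g {1..L}" for g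
    proof -
      have "(\<Sum>k\<in>{1..L}. (cmod (u (g k)))\<^sup>2) = (\<Sum>m\<in>g ` {1..L}. (cmod (u m))\<^sup>2)"
        by (subst sum.reindex[OF that]) simp
      also have "\<dots> \<le> (norm y)\<^sup>2" using sum_le_norm_l2[of "g ` {1..L}" y] by (simp add: y)
      finally show ?thesis .
    qed
    have "real L / 4 = (\<Sum>k\<in>{1..L}. 1 / 4)" by simp
    also have "\<dots> \<le> (\<Sum>k\<in>{1..L}. (cmod (u (n + k * p)))\<^sup>2 + (cmod (u (n + k * p - 1)))\<^sup>2)"
      by (rule sum_mono) (rule quarter)
    also have "\<dots> \<le> (norm y)\<^sup>2 + (norm y)\<^sup>2"
      unfolding sum.distrib
    proof (intro add_mono part)
      show "inj_on (\<lambda>k. n + k * p) {1..L}" using \<open>p \<ge> 1\<close> by (auto simp: inj_on_def)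
      show "inj_on (\<lambda>k. n + k * p - 1) {1..L}"
      proof (rule inj_onI)
        fix k l assume "n + k * p - 1 = n + l * p - 1"
        then have "k * p = l * p" using n(3) by linarith
        then show "k = l" using \<open>p \<ge> 1\<close> by simp
      qed
    qed
    finally show ?thesis by simp
  qed
  have card: "card ?E \<le> 4" by (simp add: card_insert_if)
  note approx = approximate_eigenvectorI[where B = ?B and E = ?E and Q = Q and \<Lambda> = "real L / 8" and \<epsilon> = \<epsilon>,
      OF B u_ell2 _ card zero small _ L \<open>\<epsilon> > 0\<close>]
  have "ell2_norm u > 0" "ell2_norm (?B u) \<le> \<epsilon> * ell2_norm u"
    using lower by (auto intro!: approx simp: y_def)
  moreover have "u \<in> ell2 ({1..} \<inter> {N..})"
    using n by (subst ell2_iff) (auto simp: u_ell2 intro!: u0 simp: W_def)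
  ultimately show ?thesis using fin by blast
qed

text \<open>For real \<open>x\<close> the shifted operator is its own adjoint, so one lower bound
  serves both roles in \<open>fredholmI\<close>. Coordinate 1 determines a formal solution because
  coordinate 0 is zero.\<close>

lemma jacobi_half_fredholm_iff:
  assumes tame: "tame_parameters \<delta> K a b"
    and ap: "asymptotically_periodic p t D (jacobi_steps a b x)" and "p \<ge> 1"
  shows "fredholm {1..} (shifted (jacobi_half a b) (of_real x)) \<longleftrightarrow>
    (\<forall>\<nu>. cmod \<nu> = 1 \<longrightarrow> \<nu>\<^sup>2 - t * \<nu> + D \<noteq> 0)"
proof -
  let ?B = "shifted (jacobi_half a b) (of_real x)"
  note B = jacobi_half_shifted_operator[OF tame, where z = "of_real x"]
  have uniq: "h = (\<lambda>i. 0)" if "h 0 = 0" "?B h = (\<lambda>i. 0)" "h 1 = 0" for h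
    by (rule jacobi_half_formal_solution_unique[OF _ that(2,1,3)]) (rule tame_parametersD[OF tame])
  have 1: "fredholm {1..} ?B" if no_root: "\<forall>\<nu>. cmod \<nu> = 1 \<longrightarrow> \<nu>\<^sup>2 - t * \<nu> + D \<noteq> 0"
  proof -
    obtain N c where Nc: "c > 0" "\<forall>y. l2_fun y \<in> ell2 {N..} \<longrightarrow> c * norm y \<le> norm (op_of ?B y)"
      by (rule jacobi_half_lower_bound[OF tame ap no_root[rule_format]], assumption, rule that)
    have lower: "c * norm y \<le> norm (op_of ?B y)" if "l2_fun y \<in> ell2 ({1..} - {..<N})" for y
      by (rule Nc(2)[rule_format]) (use that in \<open>auto simp: ell2_def\<close>)
    show ?thesis
    proof (rule fredholmI[where F = "{..<N}" and base = 1, OF B(1) B(1) _ B(4) B(4) _ Nc(1) lower lower])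
      show "inner (op_of ?B x) y = inner x (op_of ?B y)" for x y using B(2)[of x y] by simp
      show "u = (\<lambda>i. 0)" if "u \<in> ell2 {1..}" "?B u = (\<lambda>i. 0)" "u 1 = 0" for u
        by (rule uniq) (use that in \<open>auto simp: ell2_def\<close>)
    qed auto
  qed
  have 2: "\<forall>\<nu>. cmod \<nu> = 1 \<longrightarrow> \<nu>\<^sup>2 - t * \<nu> + D \<noteq> 0" if "fredholm {1..} ?B"
  proof (rule ccontr)
    assume "\<not> (\<forall>\<nu>. cmod \<nu> = 1 \<longrightarrow> \<nu>\<^sup>2 - t * \<nu> + D \<noteq> 0)"
    then obtain \<nu> where root: "cmod \<nu> = 1" "\<nu>\<^sup>2 - t * \<nu> + D = 0" by blast
    have "\<not> fredholm {1..} ?B"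
    proof (rule not_fredholmI[where b = 1 and base = 1, OF B(1) _ _ _ B(4)])
      show "?B (\<lambda>i. u i + v i) = (\<lambda>i. ?B u i + ?B v i)" for u v
        by (auto simp: fun_eq_iff shifted_def jacobi_half_def algebra_simps)
      show "?B (\<lambda>i. c * u i) = (\<lambda>i. c * ?B u i)" for c u
        by (auto simp: fun_eq_iff shifted_def jacobi_half_def algebra_simps)
      show "?B u n = ?B v n" if "\<And>m. m \<le> n + 1 \<Longrightarrow> u m = v m" for u v n
        using that by (simp add: shifted_def jacobi_half_def)
      show "h = (\<lambda>i. 0)" if "\<And>i. i \<notin> {1..} \<Longrightarrow> h i = 0" "?B h = (\<lambda>i. 0)" "h 1 = 0" for h
        by (rule uniq) (use that in auto)
    qed (use jacobi_half_weyl[OF tame ap \<open>p \<ge> 1\<close> root] in auto)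
    with that show False by contradiction
  qed
  show ?thesis using 1 2 by blast
qed

lemma jacobi_half_fredholm_nonreal:
  assumes tame: "tame_parameters \<delta> K a b" and z: "Im z \<noteq> 0"
  shows "fredholm {1..} (shifted (jacobi_half a b) z)"
proof -
  note B = jacobi_half_shifted_operator[OF tame]
  show ?thesis
  proof (rule fredholmI[where F = "{}" and base = 1 and c = "\<bar>Im z\<bar>", OF B(1) B(1) B(2) B(4) B(4)])
    show "\<bar>Im z\<bar> * norm x \<le> norm (op_of (shifted (jacobi_half a b) (cnj z)) x)" for x
      using B(3)[of "cnj z" x] by simp
    show "u = (\<lambda>i. 0)" if "u \<in> ell2 {1..}" "shifted (jacobi_half a b) z u = (\<lambda>i. 0)" "u 1 = 0" for u
      by (rule jacobi_half_formal_solution_unique[OF _ that(2) _ that(3)])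
        (use that(1) tame_parametersD[OF tame] in \<open>auto simp: ell2_def\<close>)
  qed (use z B(3) in auto)
qed

section \<open>The isospectral torus of a periodic Jacobi matrix\<close>

text \<open>In the variable \<open>w = 1 / x\<close>, the columns of \<open>a\<^sub>1 \<cdots> a\<^sub>n x\<^sup>-\<^sup>n\<close> times the transfer matrix are
  polynomials.\<close>

fun column_poly :: "(int \<Rightarrow> real) \<Rightarrow> (int \<Rightarrow> real) \<Rightarrow> real poly \<times> real poly \<Rightarrow> nat \<Rightarrow> real poly \<times> real poly" where
  "column_poly a b c 0 = c"
| "column_poly a b c (Suc n) =
     ([:1, - b (int (Suc n)):] * fst (column_poly a b c n) - [:0, a (int n):] * snd (column_poly a b c n),
      [:0, a (int (Suc n)):] * fst (column_poly a b c n))"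

lemma jacobi_transfer_column:
  assumes "x \<noteq> 0" and a: "\<And>n. a n > 0"
    and k: "mat 1 $ 1 $ k = poly (fst c) (1 / x)" "mat 1 $ 2 $ k = poly (snd c) (1 / x)"
  shows "(\<Prod>j=1..n. a (int j)) * jacobi_transfer n a b x $ 1 $ k = x ^ n * poly (fst (column_poly a b c n)) (1 / x) \<and>
    (\<Prod>j=1..n. a (int j)) * jacobi_transfer n a b x $ 2 $ k = x ^ n * poly (snd (column_poly a b c n)) (1 / x)"
proof (induction n)
  case (Suc n)
  let ?A = "\<Prod>j=1..n. a (int j)" and ?T = "jacobi_transfer n a b x"
  let ?P = "poly (fst (column_poly a b c n)) (1 / x)" and ?R = "poly (snd (column_poly a b c n)) (1 / x)"
  have an: "a (int (Suc n)) > 0" by (rule a)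
  have prod: "(\<Prod>j=1..Suc n. a (int j)) = a (int (Suc n)) * ?A"
    by (simp add: mult.commute)
  have T1: "a (int (Suc n)) * jacobi_transfer (Suc n) a b x $ 1 $ k =
      (x - b (int (Suc n))) * ?T $ 1 $ k - a (int n) * ?T $ 2 $ k"
    using an by (simp add: jacobi_step_def matrix_matrix_mult_def sum_2 field_simps)
  have T2: "jacobi_transfer (Suc n) a b x $ 2 $ k = ?T $ 1 $ k"
    using an by (simp add: jacobi_step_def matrix_matrix_mult_def sum_2)
  have "(\<Prod>j=1..Suc n. a (int j)) * jacobi_transfer (Suc n) a b x $ 1 $ k =
      ?A * (a (int (Suc n)) * jacobi_transfer (Suc n) a b x $ 1 $ k)" by (simp only: prod mult_ac)
  also have "\<dots> = (x - b (int (Suc n))) * (?A * ?T $ 1 $ k) - a (int n) * (?A * ?T $ 2 $ k)"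
    unfolding T1 by (simp add: algebra_simps)
  also have "\<dots> = (x - b (int (Suc n))) * (x ^ n * ?P) - a (int n) * (x ^ n * ?R)"
    using Suc by simp
  also have "\<dots> = x ^ Suc n * poly (fst (column_poly a b c (Suc n))) (1 / x)"
    using \<open>x \<noteq> 0\<close> by (simp add: field_simps)
  finally have 1: "(\<Prod>j=1..Suc n. a (int j)) * jacobi_transfer (Suc n) a b x $ 1 $ k =
      x ^ Suc n * poly (fst (column_poly a b c (Suc n))) (1 / x)" .
  have "(\<Prod>j=1..Suc n. a (int j)) * jacobi_transfer (Suc n) a b x $ 2 $ k = a (int (Suc n)) * (?A * ?T $ 1 $ k)"
    by (simp only: prod T2 mult_ac)
  also have "\<dots> = a (int (Suc n)) * (x ^ n * ?P)" using Suc by simp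
  also have "\<dots> = x ^ Suc n * poly (snd (column_poly a b c (Suc n))) (1 / x)"
    using \<open>x \<noteq> 0\<close> by simp
  finally show ?case using 1 by blast
qed (use k in simp)

lemma coeff_linear_mult:
  "coeff ([:c, d:] * q) 0 = c * coeff q 0"
  "coeff ([:c, d:] * q) (Suc n) = c * coeff q (Suc n) + d * coeff q n"
  for q :: "real poly"
  by (simp_all add: coeff_pCons)

text \<open>The first component is \<open>det (1 - w J)\<close> for the truncation \<open>J\<close>
  of the Jacobi matrix to the sites \<open>1..n\<close>. By Newton's identity its coefficients of
  orders 1 and 2 give the trace of \<open>J^2\<close>, hence the sums of squares.\<close>

lemma column_poly_first:
  fixes a b n
  defines "u \<equiv> fst (column_poly a b (1, 0) n)" and "v \<equiv> snd (column_poly a b (1, 0) n)"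
  shows "coeff u 0 = 1" "coeff v 0 = 0" "coeff v 1 = (if n = 0 then 0 else a (int n))"
    "(coeff u 1)\<^sup>2 - 2 * coeff u 2 = (\<Sum>j=1..n. (b (int j))\<^sup>2) + 2 * (\<Sum>j=1..<n. (a (int j))\<^sup>2)"
proof -
  have *: "coeff (fst (column_poly a b (1, 0) n)) 0 = 1 \<and> coeff (snd (column_poly a b (1, 0) n)) 0 = 0 \<and>
      coeff (snd (column_poly a b (1, 0) n)) 1 = (if n = 0 then 0 else a (int n)) \<and>
      (coeff (fst (column_poly a b (1, 0) n)) 1)\<^sup>2 - 2 * coeff (fst (column_poly a b (1, 0) n)) 2 =
        (\<Sum>j=1..n. (b (int j))\<^sup>2) + 2 * (\<Sum>j=1..<n. (a (int j))\<^sup>2)" for n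
  proof (induction n)
    case (Suc n)
    have sum: "(\<Sum>j=1..<Suc n. (a (int j))\<^sup>2) = (\<Sum>j=1..<n. (a (int j))\<^sup>2) + (if n = 0 then 0 else (a (int n))\<^sup>2)"
      by (cases n) simp_all
    have sq: "(c1 - b')\<^sup>2 - 2 * (c2 - b' * c1 - d) = (c1\<^sup>2 - 2 * c2) + b'\<^sup>2 + 2 * d" for c1 c2 b' d :: real
      by (simp add: power2_eq_square algebra_simps)
    have c: "coeff (fst (column_poly a b (1, 0) (Suc n))) 1 = coeff (fst (column_poly a b (1, 0) n)) 1 - b (int (Suc n))"
      "coeff (fst (column_poly a b (1, 0) (Suc n))) 2 = coeff (fst (column_poly a b (1, 0) n)) 2 -
        b (int (Suc n)) * coeff (fst (column_poly a b (1, 0) n)) 1 - a (int n) * coeff (snd (column_poly a b (1, 0) n)) 1"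
      using Suc by (simp_all add: coeff_linear_mult numeral_2_eq_2 del: of_nat_Suc mult_pCons_left)
    have av: "a (int n) * coeff (snd (column_poly a b (1, 0) n)) 1 = (if n = 0 then 0 else (a (int n))\<^sup>2)"
      using Suc by (simp add: power2_eq_square)
    have 4: "(coeff (fst (column_poly a b (1, 0) (Suc n))) 1)\<^sup>2 - 2 * coeff (fst (column_poly a b (1, 0) (Suc n))) 2 =
        (\<Sum>j=1..Suc n. (b (int j))\<^sup>2) + 2 * (\<Sum>j=1..<Suc n. (a (int j))\<^sup>2)"
      unfolding c av sq sum using Suc by simp
    have "coeff (fst (column_poly a b (1, 0) (Suc n))) 0 = 1" "coeff (snd (column_poly a b (1, 0) (Suc n))) 0 = 0"
      "coeff (snd (column_poly a b (1, 0) (Suc n))) 1 = (if Suc n = 0 then 0 else a (int (Suc n)))"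
      using Suc by (simp_all add: coeff_linear_mult del: of_nat_Suc mult_pCons_left)
    with 4 show ?case by blast
  qed simp
  show "coeff u 0 = 1" "coeff v 0 = 0" "coeff v 1 = (if n = 0 then 0 else a (int n))"
    "(coeff u 1)\<^sup>2 - 2 * coeff u 2 = (\<Sum>j=1..n. (b (int j))\<^sup>2) + 2 * (\<Sum>j=1..<n. (a (int j))\<^sup>2)"
    using *[of n] unfolding u_def v_def by blast+
qed

text \<open>The second column accounts for the bond that closes the periodic ring: its lower entry
  starts at order 2 with coefficient \<open>- a n * a 0\<close>, which for \<open>n = p\<close>
  supplies the square of \<open>a p\<close> missing in the first column. For \<open>n = 1\<close>
  this coefficient is zero.\<close>

lemma column_poly_second:
  assumes "n \<ge> 1"
  shows "coeff (snd (column_poly a b (0, 1) n)) 0 = 0" "coeff (snd (column_poly a b (0, 1) n)) 1 = 0"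
    "coeff (snd (column_poly a b (0, 1) n)) 2 = (if n = 1 then 0 else - a (int n) * a 0)"
proof -
  have fst: "coeff (fst (column_poly a b (0, 1) (Suc n))) 0 = 0 \<and> coeff (snd (column_poly a b (0, 1) (Suc n))) 0 = 0 \<and>
      coeff (fst (column_poly a b (0, 1) (Suc n))) 1 = - a 0" for n
  proof (induction n)
    case (Suc n)
    then show ?case
      by (subst (1 2 3) column_poly.simps(2))
        (simp add: coeff_linear_mult del: of_nat_Suc mult_pCons_left column_poly.simps(2))
  qed (simp add: coeff_pCons)
  obtain m where n: "n = Suc m" using assms by (cases n) auto
  show "coeff (snd (column_poly a b (0, 1) n)) 0 = 0" "coeff (snd (column_poly a b (0, 1) n)) 1 = 0"
    "coeff (snd (column_poly a b (0, 1) n)) 2 = (if n = 1 then 0 else - a (int n) * a 0)"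
    unfolding n using fst[of "m - 1"]
    by (cases m; simp add: coeff_linear_mult numeral_2_eq_2 del: of_nat_Suc mult_pCons_left)+
qed

text \<open>Multiplied by the product of the \<open>a j\<close>, the discriminant is
  \<open>x ^ p\<close> times a polynomial in \<open>1 / x\<close> with constant term 1. So the
  discriminant determines the product, and then the coefficients of orders 1 and 2 give the weighted
  sum of squares; for \<open>p = 1\<close> there is no bond term of order 2.\<close>

lemma jacobi_torus_invariants:
  assumes T: "(a', b') \<in> jacobi_torus p a b" and per: "periodic_jacobi p a b" and "p \<ge> 1"
  shows "(\<Prod>j=1..p. a' (int j)) = (\<Prod>j=1..p. a (int j))"
    "(\<Sum>j=1..p. (b' (int j))\<^sup>2) + 2 * (if p = 1 then 0 else \<Sum>j=1..p. (a' (int j))\<^sup>2) =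
     (\<Sum>j=1..p. (b (int j))\<^sup>2) + 2 * (if p = 1 then 0 else \<Sum>j=1..p. (a (int j))\<^sup>2)"
proof -
  define tp where "tp = (\<lambda>a b. fst (column_poly a b (1, 0) p) + snd (column_poly a b (0, 1) p))"
  have tr: "(\<Prod>j=1..p. a (int j)) * jacobi_discriminant p a b x = x ^ p * poly (tp a b) (1 / x)"
    if "x \<noteq> 0" "\<And>n. a n > 0" for a b x
  proof -
    have "(\<Prod>j=1..p. a (int j)) * jacobi_transfer p a b x $ 1 $ 1 = x ^ p * poly (fst (column_poly a b (1, 0) p)) (1 / x)"
      using jacobi_transfer_column[OF that(1), of a 1 "(1, 0)" p b] that(2) by (simp add: mat_def)
    moreover have "(\<Prod>j=1..p. a (int j)) * jacobi_transfer p a b x $ 2 $ 2 = x ^ p * poly (snd (column_poly a b (0, 1) p)) (1 / x)"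
      using jacobi_transfer_column[OF that(1), of a 2 "(0, 1)" p b] that(2) by (simp add: mat_def)
    ultimately show ?thesis
      by (simp add: jacobi_discriminant_def trace_def sum_2 tp_def distrib_left)
  qed
  have coeffs: "coeff (tp a b) 0 = 1"
    "(coeff (tp a b) 1)\<^sup>2 - 2 * coeff (tp a b) 2 =
      (\<Sum>j=1..p. (b (int j))\<^sup>2) + 2 * (if p = 1 then 0 else \<Sum>j=1..p. (a (int j))\<^sup>2)"
    if "periodic_jacobi p a b" for a b
  proof -
    have "a 0 = a (int p)" using that unfolding periodic_jacobi_def by (metis add_0)
    then have s: "2 * (\<Sum>j=1..<p. (a (int j))\<^sup>2) + 2 * (if p = 1 then 0 else a (int p) * a 0) =
        2 * (if p = 1 then 0 else \<Sum>j=1..p. (a (int j))\<^sup>2)"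
      using \<open>p \<ge> 1\<close> by (cases p) (simp_all add: power2_eq_square atLeastLessThanSuc_atLeastAtMost del: of_nat_Suc)
    show "coeff (tp a b) 0 = 1"
      using column_poly_first(1) column_poly_second(1)[OF \<open>p \<ge> 1\<close>] by (simp add: tp_def)
    have "(coeff (tp a b) 1)\<^sup>2 - 2 * coeff (tp a b) 2 =
        (coeff (fst (column_poly a b (1, 0) p)) 1)\<^sup>2 - 2 * coeff (fst (column_poly a b (1, 0) p)) 2
        + 2 * (if p = 1 then 0 else a (int p) * a 0)"
      using column_poly_second(2)[OF \<open>p \<ge> 1\<close>, of a b] by (simp add: tp_def column_poly_second(3)[OF \<open>p \<ge> 1\<close>])
    then show "(coeff (tp a b) 1)\<^sup>2 - 2 * coeff (tp a b) 2 =
        (\<Sum>j=1..p. (b (int j))\<^sup>2) + 2 * (if p = 1 then 0 else \<Sum>j=1..p. (a (int j))\<^sup>2)"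
      unfolding column_poly_first(4) using s by linarith
  qed
  have per': "periodic_jacobi p a' b'" and eq: "\<And>x. jacobi_discriminant p a' b' x = jacobi_discriminant p a b x"
    using T by (auto simp: jacobi_torus_def)
  have pos: "a n > 0" "a' n > 0" for n using per per' by (auto simp: periodic_jacobi_def)
  let ?A = "\<Prod>j=1..p. a (int j)" and ?A' = "\<Prod>j=1..p. a' (int j)"
  have A: "?A > 0" "?A' > 0" using pos by (auto intro: prod_pos)
  let ?d = "smult ?A (tp a' b') - smult ?A' (tp a b)"
  \<comment> \<open>The identity is known only for \<open>w = 1 / x\<close>, so \<open>w = 0\<close>
    is missing; the extra factor \<open>w\<close> covers it.\<close>
  have "poly (pCons 0 ?d) w = 0" for w
  proof (cases "w = 0")
    case False
    define x where "x = 1 / w"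
    have x: "x \<noteq> 0" "1 / x = w" using False by (auto simp: x_def)
    have "x ^ p * (?A * poly (tp a' b') w) = ?A * (?A' * jacobi_discriminant p a' b' x)"
      using tr[of x a' b'] x pos by (simp add: mult.left_commute)
    also have "\<dots> = ?A' * (?A * jacobi_discriminant p a b x)" unfolding eq by (simp add: mult.left_commute)
    also have "\<dots> = x ^ p * (?A' * poly (tp a b) w)"
      using tr[of x a b] x pos by (simp add: mult.left_commute)
    finally show ?thesis using x(1) by simp
  qed simp
  then have "poly (pCons 0 ?d) = poly 0" by (simp add: fun_eq_iff)
  then have "pCons 0 ?d = 0" by (simp only: poly_eq_poly_eq_iff)
  then have d: "smult ?A (tp a' b') = smult ?A' (tp a b)" by simp
  then have "coeff (smult ?A (tp a' b')) 0 = coeff (smult ?A' (tp a b)) 0" by simp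
  then show AA: "?A' = ?A" using coeffs(1)[OF per] coeffs(1)[OF per'] by simp
  then have "tp a' b' = tp a b" using d A by (metis less_irrefl smult_cancel)
  then show "(\<Sum>j=1..p. (b' (int j))\<^sup>2) + 2 * (if p = 1 then 0 else \<Sum>j=1..p. (a' (int j))\<^sup>2) =
      (\<Sum>j=1..p. (b (int j))\<^sup>2) + 2 * (if p = 1 then 0 else \<Sum>j=1..p. (a (int j))\<^sup>2)"
    using coeffs(2)[OF per] coeffs(2)[OF per'] by simp
qed

text \<open>The invariant sum of squares bounds the parameters above; for \<open>p = 1\<close> the
  product takes over for \<open>a\<close>. The lower bound for \<open>a\<close> follows from the
  invariant product, since the other \<open>p - 1\<close> factors are at most
  \<open>K\<close>.\<close>

lemma jacobi_torus_bounds: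
  assumes per: "periodic_jacobi p a b" and "p \<ge> 1"
  obtains \<delta> K where "\<delta> > 0"
    "\<forall>a' b' n. (a', b') \<in> jacobi_torus p a b \<longrightarrow> \<delta> \<le> a' n \<and> a' n \<le> K \<and> \<bar>b' n\<bar> \<le> K"
proof -
  define A where "A = (\<Prod>j=1..p. a (int j))"
  define S where "S = (\<Sum>j=1..p. (b (int j))\<^sup>2) + 2 * (if p = 1 then 0 else \<Sum>j=1..p. (a (int j))\<^sup>2)"
  define K where "K = 1 + A + S"
  have "A > 0" using per by (auto simp: A_def periodic_jacobi_def intro: prod_pos)
  have "S \<ge> 0" by (auto simp: S_def intro!: add_nonneg_nonneg sum_nonneg)
  then have "K \<ge> 1" using \<open>A > 0\<close> by (simp add: K_def)
  show ?thesis
  proof (rule that[of "A / K ^ (p - 1)" K])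
    show "A / K ^ (p - 1) > 0" using \<open>A > 0\<close> \<open>K \<ge> 1\<close> by simp
    have "A / K ^ (p - 1) \<le> a' n \<and> a' n \<le> K \<and> \<bar>b' n\<bar> \<le> K" if T: "(a', b') \<in> jacobi_torus p a b" for a' b' n
    proof -
      have per': "periodic_jacobi p a' b'" using T by (auto simp: jacobi_torus_def)
      note inv = jacobi_torus_invariants[OF T per \<open>p \<ge> 1\<close>]
      have pos: "a' n > 0" for n using per' by (simp add: periodic_jacobi_def)
      have le_sq: "t \<le> 1 + t\<^sup>2" for t :: real
        using zero_le_power2[of "t - 1 / 2"] by (simp add: power2_eq_square algebra_simps)
      have bK: "\<bar>b' (int j)\<bar> \<le> K" if j: "j \<in> {1..p}" for j
      proof -
        have "(b' (int j))\<^sup>2 \<le> (\<Sum>j=1..p. (b' (int j))\<^sup>2)"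
          using j by (intro member_le_sum[of j "{1..p}" "\<lambda>j. (b' (int j))\<^sup>2"]) auto
        also have "\<dots> \<le> S" unfolding S_def inv(2)[symmetric] by (simp add: sum_nonneg)
        finally show ?thesis using le_sq[of "\<bar>b' (int j)\<bar>"] \<open>A > 0\<close> by (simp add: K_def)
      qed
      have aK: "a' (int j) \<le> K" if j: "j \<in> {1..p}" for j
      proof (cases "p = 1")
        case True
        then show ?thesis using inv(1) j \<open>S \<ge> 0\<close> by (simp add: K_def A_def)
      next
        case False
        have "(a' (int j))\<^sup>2 \<le> (\<Sum>j=1..p. (a' (int j))\<^sup>2)"
          using j by (intro member_le_sum[of j "{1..p}" "\<lambda>j. (a' (int j))\<^sup>2"]) auto
        also have "\<dots> \<le> (\<Sum>j=1..p. (b' (int j))\<^sup>2) + 2 * (\<Sum>j=1..p. (a' (int j))\<^sup>2)"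
          by (simp add: sum_nonneg add_increasing)
        also have "\<dots> = S" unfolding S_def inv(2)[symmetric] using False by simp
        finally show ?thesis using le_sq[of "a' (int j)"] \<open>A > 0\<close> by (simp add: K_def)
      qed
      have lower: "A / K ^ (p - 1) \<le> a' (int j)" if j: "j \<in> {1..p}" for j
      proof -
        have "A = a' (int j) * (\<Prod>i\<in>{1..p} - {j}. a' (int i))"
          unfolding A_def inv(1)[symmetric] using j by (simp add: prod.remove)
        also have "\<dots> \<le> a' (int j) * K ^ (p - 1)"
        proof (rule mult_left_mono)
          have "(\<Prod>i\<in>{1..p} - {j}. a' (int i)) \<le> (\<Prod>i\<in>{1..p} - {j}. K)"
            using aK pos by (intro prod_mono) (auto intro: less_imp_le)
          then show "(\<Prod>i\<in>{1..p} - {j}. a' (int i)) \<le> K ^ (p - 1)" using j by simp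
        qed (use pos in \<open>simp add: less_imp_le\<close>)
        finally show ?thesis using \<open>K \<ge> 1\<close> by (simp add: divide_le_eq)
      qed
      \<comment> \<open>Representative of \<open>n\<close> modulo \<open>p\<close> in
        \<open>1..p\<close>, the range over which the invariants are formed.\<close>
      define j where "j = nat ((n - 1) mod int p) + 1"
      have j: "j \<in> {1..p}" using \<open>p \<ge> 1\<close> pos_mod_bound[of "int p" "n - 1"] by (simp add: j_def nat_less_iff Suc_le_eq)
      have nj: "n = int j + int p * ((n - 1) div int p)"
        using \<open>p \<ge> 1\<close> mult_div_mod_eq[of "int p" "n - 1"] by (simp add: j_def)
      have shift: "f (m + int p * k) = f m" if f: "\<And>m. f (m + int p) = f m" for f :: "int \<Rightarrow> real" and m k
      proof (induction k arbitrary: m rule: int_induct[of _ 0])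
        case (step1 i)
        then show ?case using f[of "m + int p * i"] by (simp add: algebra_simps)
      next
        case (step2 i)
        then show ?case using f[of "m + int p * (i - 1)"] by (simp add: algebra_simps)
      qed simp
      have "a' n = a' (int j)" "b' n = b' (int j)"
        using per' by (subst nj, intro shift, simp add: periodic_jacobi_def)+
      then show ?thesis using lower[OF j] aK[OF j] bK[OF j] by simp
    qed
    then show "\<forall>a' b' n. (a', b') \<in> jacobi_torus p a b \<longrightarrow> A / K ^ (p - 1) \<le> a' n \<and> a' n \<le> K \<and> \<bar>b' n\<bar> \<le> K"
      by blast
  qed
qed

section \<open>Trace and determinant over one period\<close>

lemma mprod_jacobi_matrix:
  assumes a: "\<And>n. a n > 0"
  shows "mprod (\<lambda>j. jacobi_matrix x (a (int j)) (a (int j + 1)) (b (int j + 1))) 0 k $ i $ l =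
    of_real (jacobi_transfer k a b x $ i $ l)"
proof (induction k arbitrary: i l)
  case (Suc k)
  have "\<forall>i l. jacobi_matrix x (a (int k)) (a (int k + 1)) (b (int k + 1)) $ i $ l =
      of_real (jacobi_step a b (int (Suc k)) x $ i $ l)"
    using less_imp_neq[OF a, of "1 + int k"]
    by (simp add: forall_2 jacobi_matrix_def jacobi_step_def add.commute field_simps)
  then show ?case
    by (simp add: matrix_matrix_mult_def sum_2 Suc)
qed (simp add: mat_def)

text \<open>The determinants of the single steps are quotients of consecutive \<open>a\<close>, and
  they telescope; over a full period the result is 1, the value of \<open>D\<close> in the Jacobi
  case.\<close>

lemma det_mprod_jacobi_matrix:
  assumes a: "\<And>n. a n > 0"
  shows "det (mprod (\<lambda>j. jacobi_matrix x (a (int j)) (a (int j + 1)) (b (int j + 1))) 0 k) =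
    of_real (a 0 / a (int k))"
proof (induction k)
  case 0
  then show ?case using a[of 0] by (simp add: det_I)
next
  case (Suc k)
  have "det (jacobi_matrix x (a (int k)) (a (int k + 1)) (b (int k + 1))) = of_real (a (int k) / a (int (Suc k)))"
    by (simp add: det_2 jacobi_matrix_def add.commute)
  then show ?case
    using Suc a[of "int k"] by (simp add: det_mul)
qed

lemma mprod_periodic_jacobi:
  fixes x :: real
  assumes per: "periodic_jacobi p a b"
  defines "P \<equiv> \<lambda>j. jacobi_matrix x (a (int j)) (a (int j + 1)) (b (int j + 1))"
  shows "P (j + p) = P j" "trace (mprod P 0 p) = of_real (jacobi_discriminant p a b x)"
    "det (mprod P 0 p) = 1"
proof -
  have a: "a n > 0" "a (n + int p) = a n" "b (n + int p) = b n" for n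
    using per by (auto simp: periodic_jacobi_def)
  have "int (j + p) + 1 = int j + 1 + int p" by simp
  then show "P (j + p) = P j" unfolding P_def using a(2,3) by (metis of_nat_add)
  show "trace (mprod P 0 p) = of_real (jacobi_discriminant p a b x)"
    using mprod_jacobi_matrix[where a = a, OF a(1)] by (simp add: P_def trace_def sum_2 jacobi_discriminant_def)
  show "det (mprod P 0 p) = 1"
    unfolding P_def det_mprod_jacobi_matrix[where a = a, OF a(1)]
    using a(2)[of 0] a(1)[of 0] by simp
qed

section \<open>From asymptotic parameters to windows of transfer matrices\<close>

lemma vector_2_lambda: "(vector [x, y] :: 'a::zero^2) = (\<chi> i. if i = 1 then x else y)"
  by (simp add: vec_eq_iff forall_2)

lemma continuous_on_vector_2 [continuous_intros]:
  fixes f g :: "'b::topological_space \<Rightarrow> 'a::{topological_space, zero}"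
  assumes "continuous_on S f" "continuous_on S g"
  shows "continuous_on S (\<lambda>x. vector [f x, g x] :: 'a^2)"
  unfolding vector_2_lambda
proof (rule continuous_on_vec_lambda)
  show "continuous_on S (\<lambda>x. if i = 1 then f x else g x)" for i :: 2
    using assms by (cases "i = 1") auto
qed

text \<open>Applied to the map from coefficients to step matrices on a compact set around the torus
  values, it gives the uniform bound on the models and turns closeness of coefficients into
  closeness of matrices.\<close>

lemma compact_modulus:
  fixes f :: "'a::metric_space \<Rightarrow> 'b::real_normed_vector"
  assumes "compact S" "continuous_on S f"
  obtains C where "\<And>x. x \<in> S \<Longrightarrow> norm (f x) \<le> C"
    "\<And>\<epsilon>. \<epsilon> > 0 \<Longrightarrow> \<exists>\<eta>>0. \<forall>x\<in>S. \<forall>y\<in>S. dist x y < \<eta> \<longrightarrow> norm (f x - f y) \<le> \<epsilon>"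
proof -
  have "bounded (f ` S)" using compact_imp_bounded[OF compact_continuous_image[OF assms(2,1)]] .
  then obtain C where C: "\<And>x. x \<in> S \<Longrightarrow> norm (f x) \<le> C" by (auto simp: bounded_iff)
  have unif: "uniformly_continuous_on S f" using compact_uniformly_continuous[OF assms(2,1)] .
  have "\<exists>\<eta>>0. \<forall>x\<in>S. \<forall>y\<in>S. dist x y < \<eta> \<longrightarrow> norm (f x - f y) \<le> \<epsilon>" if e: "\<epsilon> > 0" for \<epsilon>
  proof -
    obtain \<eta> where "\<eta> > 0" and \<eta>: "\<And>x y. x \<in> S \<Longrightarrow> y \<in> S \<Longrightarrow> dist y x < \<eta> \<Longrightarrow> dist (f y) (f x) < \<epsilon>"
      using unif e unfolding uniformly_continuous_on_def by blast
    have "norm (f x - f y) \<le> \<epsilon>" if "x \<in> S" "y \<in> S" "dist x y < \<eta>" for x y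
      using \<eta>[OF that(2,1,3)] by (simp add: dist_norm)
    with \<open>\<eta> > 0\<close> show ?thesis by blast
  qed
  with C show ?thesis by (rule that)
qed

lemma jacobi_asymptotic_window:
  assumes asym: "jacobi_asymptotic a b T" and "\<eta> > 0"
  shows "\<exists>N. \<forall>n\<ge>N. \<exists>(a', b')\<in>T. \<forall>k. 1 \<le> k \<and> k \<le> L \<longrightarrow> \<bar>a (n + k) - a' (int k)\<bar> < \<eta> \<and> \<bar>b (n + k) - b' (int k)\<bar> < \<eta>"
proof -
  \<comment> \<open>In the first \<open>L\<close> places the weight is at least
    \<open>exp (- real L)\<close>, so a weighted sum below \<open>c\<close> forces each difference
    there below \<open>\<eta>\<close>.\<close>
  define c where "c = \<eta> * exp (- real L)"
  have "c > 0" using \<open>\<eta> > 0\<close> by (simp add: c_def)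
  then have "eventually (\<lambda>n. (INF (a', b')\<in>T. jacobi_dist a b n a' b') < ennreal c) sequentially"
    using asym unfolding jacobi_asymptotic_def by (intro order_tendstoD) auto
  then obtain N where N: "\<And>n. n \<ge> N \<Longrightarrow> (INF (a', b')\<in>T. jacobi_dist a b n a' b') < ennreal c"
    by (auto simp: eventually_at_top_linorder)
  have "\<exists>(a', b')\<in>T. \<forall>k. 1 \<le> k \<and> k \<le> L \<longrightarrow> \<bar>a (n + k) - a' (int k)\<bar> < \<eta> \<and> \<bar>b (n + k) - b' (int k)\<bar> < \<eta>"
    if n: "n \<ge> N" for n
  proof -
    obtain a' b' where T: "(a', b') \<in> T" and dist: "jacobi_dist a b n a' b' < ennreal c"
      using N[OF n] by (auto simp: INF_less_iff)
    have "\<bar>a (n + k) - a' (int k)\<bar> < \<eta> \<and> \<bar>b (n + k) - b' (int k)\<bar> < \<eta>" if k: "1 \<le> k" "k \<le> L" for k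
    proof -
      let ?s = "\<bar>a (n + k) - a' (int k)\<bar> + \<bar>b (n + k) - b' (int k)\<bar>"
      obtain i where i: "k = Suc i" using k(1) by (cases k) auto
      define f where "f = (\<lambda>k. ennreal ((\<bar>a (n + Suc k) - a' (int (Suc k))\<bar> + \<bar>b (n + Suc k) - b' (int (Suc k))\<bar>)
                     * exp (- real (Suc k))))"
      have "f i \<le> suminf f"
        using sum_le_suminf[of f "{i}"] by simp
      moreover have "jacobi_dist a b n a' b' = suminf f" unfolding jacobi_dist_def f_def ..
      moreover have "f i = ennreal (?s * exp (- real k))" unfolding f_def i ..
      ultimately have "ennreal (?s * exp (- real k)) < ennreal c"
        using dist by (metis le_less_trans)
      then have "?s * exp (- real k) < \<eta> * exp (- real L)"
        by (simp add: ennreal_less_iff c_def)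
      also have "\<dots> \<le> \<eta> * exp (- real k)" using k \<open>\<eta> > 0\<close> by simp
      finally have "?s < \<eta>" by simp
      then show ?thesis by linarith
    qed
    with T show ?thesis by blast
  qed
  then show ?thesis by blast
qed

lemma eventually_tame_parameters:
  assumes "\<And>n. n \<ge> 1 \<Longrightarrow> a n > 0" "\<delta> > 0"
    and "\<And>n. n \<ge> N \<Longrightarrow> \<delta> \<le> a n \<and> a n \<le> K \<and> \<bar>b n\<bar> \<le> K"
  obtains \<delta>' K' where "tame_parameters \<delta>' K' a b"
proof -
  define \<delta>' where "\<delta>' = Min (insert \<delta> (a ` {1..<N}))"
  define K' where "K' = Max (insert K (a ` {1..<N} \<union> (\<lambda>n. \<bar>b n\<bar>) ` {1..<N}))"
  have "\<delta>' > 0" unfolding \<delta>'_def using assms(1,2) by (subst Min_gr_iff) auto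
  moreover have "\<delta>' \<le> a n \<and> a n \<le> K' \<and> \<bar>b n\<bar> \<le> K'" if "n \<ge> 1" for n
  proof (cases "n < N")
    case True
    then show ?thesis unfolding \<delta>'_def K'_def using that
      by (intro conjI Min_le Max_ge) auto
  next
    case False
    have "\<delta>' \<le> \<delta>" unfolding \<delta>'_def by (rule Min_le) auto
    moreover have "K \<le> K'" unfolding K'_def by (rule Max_ge) auto
    ultimately show ?thesis using assms(3)[of n] False by linarith
  qed
  ultimately have "tame_parameters \<delta>' K' a b" by (simp add: tame_parameters_def)
  then show ?thesis by (rule that)
qed

lemma jacobi_asymptotic_transfer:
  assumes per: "periodic_jacobi p a' b'" and "p \<ge> 1"
    and pos: "\<And>n. n \<ge> 1 \<Longrightarrow> a n > 0" and asym: "jacobi_asymptotic a b (jacobi_torus p a' b')"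
  shows "\<exists>\<delta> K. tame_parameters \<delta> K a b"
    "asymptotically_periodic p (of_real (jacobi_discriminant p a' b' x)) 1 (jacobi_steps a b x)"
proof -
  let ?T = "jacobi_torus p a' b'"
  obtain \<delta> K where \<delta>: "\<delta> > 0"
    and T: "\<forall>a'' b'' n. (a'', b'') \<in> ?T \<longrightarrow> \<delta> \<le> a'' n \<and> a'' n \<le> K \<and> \<bar>b'' n\<bar> \<le> K"
    using jacobi_torus_bounds[OF per \<open>p \<ge> 1\<close>] by metis
  \<comment> \<open>A box around the torus values with a margin, so that it also holds the late
    parameters while staying away from \<open>a = 0\<close>, where the matrix blows up.\<close>
  define S where "S = {\<delta> / 2..K + \<delta>} \<times> {\<delta> / 2..K + \<delta>} \<times> {- (K + \<delta>)..K + \<delta>}"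
  define f where "f = (\<lambda>(a0, a1, b1). jacobi_matrix x a0 a1 b1)"
  have "compact S" unfolding S_def by (intro compact_Times compact_Icc)
  moreover have "continuous_on S f"
    unfolding f_def case_prod_unfold jacobi_matrix_def using \<delta>
    by (intro continuous_intros) (auto simp: S_def)
  ultimately obtain C where C: "\<And>x. x \<in> S \<Longrightarrow> norm (f x) \<le> C"
    "\<And>\<epsilon>. \<epsilon> > 0 \<Longrightarrow> \<exists>\<eta>>0. \<forall>x\<in>S. \<forall>y\<in>S. dist x y < \<eta> \<longrightarrow> norm (f x - f y) \<le> \<epsilon>"
    by (rule compact_modulus) (rule that; assumption)
  \<comment> \<open>A step matrix also needs \<open>a\<close> one place to the left, which for
    \<open>k = 0\<close> falls before the range of the distance. The window is therefore taken
    \<open>p + 1\<close> places earlier, and periodicity of the torus element renumbers it.\<close>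
  have near: "\<exists>N. \<forall>n\<ge>N. \<exists>(a'', b'')\<in>?T. \<forall>k\<le>L. \<bar>a (n + k) - a'' (int k + 1)\<bar> < \<eta> \<and> \<bar>b (n + k) - b'' (int k + 1)\<bar> < \<eta>
      \<and> \<bar>a (n + k - 1) - a'' (int k)\<bar> < \<eta>" if \<eta>: "\<eta> > 0" for \<eta> L
  proof -
    obtain N where N: "\<And>n. n \<ge> N \<Longrightarrow> \<exists>(a'', b'')\<in>?T. \<forall>k. 1 \<le> k \<and> k \<le> L + p + 1 \<longrightarrow>
        \<bar>a (n + k) - a'' (int k)\<bar> < \<eta> \<and> \<bar>b (n + k) - b'' (int k)\<bar> < \<eta>"
      using jacobi_asymptotic_window[OF asym \<eta>, of "L + p + 1"] by blast
    have "\<exists>(a'', b'')\<in>?T. \<forall>k\<le>L. \<bar>a (n + k) - a'' (int k + 1)\<bar> < \<eta> \<and> \<bar>b (n + k) - b'' (int k + 1)\<bar> < \<eta>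
      \<and> \<bar>a (n + k - 1) - a'' (int k)\<bar> < \<eta>" if n: "n \<ge> N + p + 1" for n
    proof -
      obtain a'' b'' where m: "(a'', b'') \<in> ?T" and
        close: "\<And>k. 1 \<le> k \<Longrightarrow> k \<le> L + p + 1 \<Longrightarrow> \<bar>a ((n - p - 1) + k) - a'' (int k)\<bar> < \<eta> \<and> \<bar>b ((n - p - 1) + k) - b'' (int k)\<bar> < \<eta>"
      proof -
        have "N \<le> n - p - 1" using n by simp
        from N[OF this] show ?thesis using that by blast
      qed
      have perT: "a'' (m + int p) = a'' m" "b'' (m + int p) = b'' m" for m
        using m by (auto simp: jacobi_torus_def periodic_jacobi_def)
      have "\<bar>a (n + k) - a'' (int k + 1)\<bar> < \<eta> \<and> \<bar>b (n + k) - b'' (int k + 1)\<bar> < \<eta>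
          \<and> \<bar>a (n + k - 1) - a'' (int k)\<bar> < \<eta>" if "k \<le> L" for k
      proof -
        have idx: "(n - p - 1) + (k + p + 1) = n + k" "(n - p - 1) + (k + p) = n + k - 1"
          "int (k + p + 1) = (int k + 1) + int p" "int (k + p) = int k + int p"
          using n by simp_all
        show ?thesis
          using close[of "k + p + 1"] close[of "k + p"] that \<open>p \<ge> 1\<close> unfolding idx perT by simp
      qed
      with m show ?thesis by blast
    qed
    then show ?thesis by blast
  qed
  have "\<delta> / 2 > 0" using \<delta> by simp
  obtain N where N: "\<And>n. n \<ge> N \<Longrightarrow> \<exists>(a'', b'')\<in>?T. \<forall>k\<le>0. \<bar>a (n + k) - a'' (int k + 1)\<bar> < \<delta> / 2 \<and>
      \<bar>b (n + k) - b'' (int k + 1)\<bar> < \<delta> / 2 \<and> \<bar>a (n + k - 1) - a'' (int k)\<bar> < \<delta> / 2"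
    using near[OF \<open>\<delta> / 2 > 0\<close>, of 0] by blast
  have box: "\<delta> / 2 \<le> a n \<and> a n \<le> K + \<delta> \<and> \<bar>b n\<bar> \<le> K + \<delta>" if n: "n \<ge> N" for n
  proof -
    obtain a'' b'' where m: "(a'', b'') \<in> ?T" and "\<bar>a n - a'' 1\<bar> < \<delta> / 2" "\<bar>b n - b'' 1\<bar> < \<delta> / 2"
      using N[OF n] by auto
    moreover have "\<delta> \<le> a'' 1 \<and> a'' 1 \<le> K \<and> \<bar>b'' 1\<bar> \<le> K" using T m by blast
    ultimately show ?thesis using \<delta> by linarith
  qed
  obtain \<delta>' K' where "tame_parameters \<delta>' K' a b"
    using eventually_tame_parameters[of a "\<delta> / 2" N "K + \<delta>" b, OF pos \<open>\<delta> / 2 > 0\<close> box] by blast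
  then show "\<exists>\<delta> K. tame_parameters \<delta> K a b" by blast
  show "asymptotically_periodic p (of_real (jacobi_discriminant p a' b' x)) 1 (jacobi_steps a b x)"
    unfolding asymptotically_periodic_def
  proof (intro exI[of _ C] allI impI)
    fix L and \<epsilon> :: real assume "\<epsilon> > 0"
    then obtain \<eta> where \<eta>: "\<eta> > 0" "\<And>x y. x \<in> S \<Longrightarrow> y \<in> S \<Longrightarrow> dist x y < \<eta> \<Longrightarrow> norm (f x - f y) \<le> \<epsilon>"
      using C(2) by meson
    \<comment> \<open>A third of \<open>\<eta>\<close> for each of the three parameters of a step
      matrix.\<close>
    obtain N' where N': "\<And>n. n \<ge> N' \<Longrightarrow> \<exists>(a'', b'')\<in>?T. \<forall>k\<le>L. \<bar>a (n + k) - a'' (int k + 1)\<bar> < \<eta> / 3 \<and>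
        \<bar>b (n + k) - b'' (int k + 1)\<bar> < \<eta> / 3 \<and> \<bar>a (n + k - 1) - a'' (int k)\<bar> < \<eta> / 3"
      using near[of "\<eta> / 3" L] \<eta>(1) by auto
    \<comment> \<open>The bound \<open>N + 1\<close> in place of \<open>N\<close> is due to the
      parameter at \<open>n + j - 1\<close>, which must lie in the box as well.\<close>
    have "periodic_window p (of_real (jacobi_discriminant p a' b' x)) 1 C (jacobi_steps a b x) L \<epsilon> n"
      if n: "n \<ge> max N' (N + 1)" for n
    proof -
      obtain a'' b'' where m: "(a'', b'') \<in> ?T" and close: "\<And>k. k \<le> L \<Longrightarrow> \<bar>a (n + k) - a'' (int k + 1)\<bar> < \<eta> / 3 \<and>
          \<bar>b (n + k) - b'' (int k + 1)\<bar> < \<eta> / 3 \<and> \<bar>a (n + k - 1) - a'' (int k)\<bar> < \<eta> / 3"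
        using N'[of n] n by auto
      have per'': "periodic_jacobi p a'' b''" "jacobi_discriminant p a'' b'' x = jacobi_discriminant p a' b' x"
        using m by (auto simp: jacobi_torus_def)
      let ?P = "\<lambda>j. jacobi_matrix x (a'' (int j)) (a'' (int j + 1)) (b'' (int j + 1))"
      have S'': "(a'' (int j), a'' (int j + 1), b'' (int j + 1)) \<in> S" for j
      proof -
        have "\<delta> \<le> a'' m \<and> a'' m \<le> K \<and> \<bar>b'' m\<bar> \<le> K" for m using T m by blast
        from this[of "int j"] this[of "int j + 1"] show ?thesis using \<delta> by (auto simp: S_def)
      qed
      show ?thesis
        unfolding periodic_window_def
      proof (intro exI[of _ ?P] conjI allI impI)
        show "?P (j + p) = ?P j" "trace (mprod ?P 0 p) = of_real (jacobi_discriminant p a' b' x)"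
          "det (mprod ?P 0 p) = 1" for j
          using mprod_periodic_jacobi[OF per''(1), of x] per''(2) by auto
        show "norm (?P j) \<le> C" for j using C(1)[OF S''[of j]] by (simp add: f_def)
        show "norm (jacobi_steps a b x (n + j) - ?P j) \<le> \<epsilon>" if "j \<le> L" for j
        proof -
          have "(a (n + j - 1), a (n + j), b (n + j)) \<in> S"
            using box[of "n + j - 1"] box[of "n + j"] n by (auto simp: S_def)
          moreover have "dist (a (n + j - 1), a (n + j), b (n + j)) (a'' (int j), a'' (int j + 1), b'' (int j + 1)) < \<eta>"
          proof -
            have "dist (u, v, w) (u', v', w') \<le> \<bar>u - u'\<bar> + (\<bar>v - v'\<bar> + \<bar>w - w'\<bar>)" for u v w u' v' w' :: real
              unfolding dist_Pair_Pair
              by (rule order_trans[OF sqrt_sum_squares_le_sum]) (auto simp: dist_real_def intro!: sqrt_sum_squares_le_sum_abs[of "v - v'" "w - w'", simplified])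
            from this[of "a (n + j - 1)" "a (n + j)" "b (n + j)" "a'' (int j)" "a'' (int j + 1)" "b'' (int j + 1)"]
            show ?thesis using close[OF that] by linarith
          qed
          ultimately have "norm (f (a (n + j - 1), a (n + j), b (n + j)) - f (a'' (int j), a'' (int j + 1), b'' (int j + 1))) \<le> \<epsilon>"
            using S''[of j] by (intro \<eta>(2))
          then show ?thesis by (simp add: f_def jacobi_steps_def)
        qed
      qed
    qed
    then show "\<exists>N. \<forall>n\<ge>N. periodic_window p (of_real (jacobi_discriminant p a' b' x)) 1 C (jacobi_steps a b x) L \<epsilon> n"
      by blast
  qed
qed

section \<open>The two-sided periodic Jacobi matrix\<close>

text \<open>Together with its counterpart this compares norms across index types: the half-line
  operator lives on the naturals, the two-sided one on the integers.\<close>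

lemma norm_l2_reindex_le:
  assumes h: "inj h" and le: "\<And>n. cmod (l2_fun x n) \<le> cmod (l2_fun y (h n))"
  shows "norm x \<le> norm y"
  unfolding norm_l2_eq[of x]
proof (rule ell2_bounded_sums(2))
  fix F :: "'a set" assume F: "finite F"
  have "(\<Sum>n\<in>F. (cmod (l2_fun x n))\<^sup>2) \<le> (\<Sum>n\<in>F. (cmod (l2_fun y (h n)))\<^sup>2)"
    by (intro sum_mono power_mono le) auto
  also have "\<dots> = (\<Sum>m\<in>h ` F. (cmod (l2_fun y m))\<^sup>2)"
    by (subst sum.reindex) (auto intro: inj_on_subset[OF h])
  also have "\<dots> \<le> (norm y)\<^sup>2" using F by (intro sum_le_norm_l2) auto
  finally show "(\<Sum>n\<in>F. (cmod (l2_fun x n))\<^sup>2) \<le> (norm y)\<^sup>2" .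
qed simp

lemma norm_l2_reindex_ge:
  assumes h: "inj h" and le: "\<And>n. cmod (l2_fun y (h n)) \<le> cmod (l2_fun x n)"
    and zero: "\<And>m. m \<notin> range h \<Longrightarrow> l2_fun y m = 0"
  shows "norm y \<le> norm x"
  unfolding norm_l2_eq[of y]
proof (rule ell2_bounded_sums(2))
  fix F :: "'b set" assume F: "finite F"
  have "(\<Sum>m\<in>F. (cmod (l2_fun y m))\<^sup>2) = (\<Sum>m\<in>h ` (h -` F). (cmod (l2_fun y m))\<^sup>2)"
    using F by (intro sum.mono_neutral_right) (auto simp: zero)
  also have "\<dots> = (\<Sum>n\<in>h -` F. (cmod (l2_fun y (h n)))\<^sup>2)"
    by (subst sum.reindex) (auto intro: inj_on_subset[OF h])
  also have "\<dots> \<le> (\<Sum>n\<in>h -` F. (cmod (l2_fun x n))\<^sup>2)"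
    by (intro sum_mono power_mono le) auto
  also have "\<dots> \<le> (norm x)\<^sup>2" using F h by (intro sum_le_norm_l2 finite_vimageI)
  finally show "(\<Sum>m\<in>F. (cmod (l2_fun y m))\<^sup>2) \<le> (norm x)\<^sup>2" .
qed simp

lemma periodic_jacobi_half:
  assumes per: "periodic_jacobi p a b" and "p \<ge> 1"
  shows "\<exists>\<delta> K. tame_parameters \<delta> K (\<lambda>n. a (int n)) (\<lambda>n. b (int n)) \<and> (\<forall>n. \<bar>a n\<bar> \<le> K \<and> \<bar>b n\<bar> \<le> K)"
    "asymptotically_periodic p (of_real (jacobi_discriminant p a b x)) 1
      (jacobi_steps (\<lambda>n. a (int n)) (\<lambda>n. b (int n)) x)"
proof -
  have self: "(a, b) \<in> jacobi_torus p a b" using per by (simp add: jacobi_torus_def)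
  obtain \<delta> K where \<delta>: "\<delta> > 0" and
    T: "\<forall>a' b' n. (a', b') \<in> jacobi_torus p a b \<longrightarrow> \<delta> \<le> a' n \<and> a' n \<le> K \<and> \<bar>b' n\<bar> \<le> K"
    using jacobi_torus_bounds[OF per \<open>p \<ge> 1\<close>] by metis
  have all: "\<delta> \<le> a n \<and> a n \<le> K \<and> \<bar>b n\<bar> \<le> K" for n using T self by blast
  have "\<bar>a n\<bar> \<le> K" for n using all[of n] \<delta> by linarith
  with all \<delta> show "\<exists>\<delta> K. tame_parameters \<delta> K (\<lambda>n. a (int n)) (\<lambda>n. b (int n)) \<and> (\<forall>n. \<bar>a n\<bar> \<le> K \<and> \<bar>b n\<bar> \<le> K)"
    by (intro exI[of _ \<delta>] exI[of _ K]) (simp add: tame_parameters_def)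
  define P where "P = (\<lambda>j. jacobi_matrix x (a (int j)) (a (int j + 1)) (b (int j + 1)))"
  \<comment> \<open>On the naturals \<open>jacobi_steps\<close> reads \<open>a 0\<close> at index 0,
    because \<open>0 - 1 = 0\<close>, where the periodic continuation has \<open>a (- 1)\<close>.
    \<open>B\<close> is the genuinely periodic sequence; both agree from index 1 on, which is enough
    for an asymptotic property.\<close>
  define B where "B = (\<lambda>n. jacobi_matrix x (a (int n - 1)) (a (int n)) (b (int n)))"
  have perB: "B (j + p) = B j" for j
  proof -
    have "int (j + p) - 1 = (int j - 1) + int p" by simp
    then show ?thesis using per unfolding B_def periodic_jacobi_def by (metis of_nat_add)
  qed
  have "mprod B 1 p = mprod P 0 p" by (rule mprod_cong) (simp add: B_def P_def add.commute)
  then have "trace (mprod B 0 p) = of_real (jacobi_discriminant p a b x)" "det (mprod B 0 p) = 1"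
    using mprod_periodic_start[where A = B and n = 1, OF perB \<open>p \<ge> 1\<close>] mprod_periodic_jacobi(2,3)[OF per, of x]
    by (simp_all add: P_def)
  then have "asymptotically_periodic p (of_real (jacobi_discriminant p a b x)) 1 B"
    using periodic_imp_asymptotically_periodic[where A = B, OF perB \<open>p \<ge> 1\<close>] by simp
  then show "asymptotically_periodic p (of_real (jacobi_discriminant p a b x)) 1
      (jacobi_steps (\<lambda>n. a (int n)) (\<lambda>n. b (int n)) x)"
    by (rule asymptotically_periodic_cong[where m = 1]) (simp add: B_def jacobi_steps_def of_nat_diff)
qed

lemma periodic_jacobi_shift:
  assumes per: "periodic_jacobi p a b"
  shows "a (n + int p * int k) = a n" "b (n + int p * int k) = b n"
proof -
  have "f (n + int p * int k) = f n" if "\<And>n. f (n + int p) = f n" for f :: "int \<Rightarrow> real"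
  proof (induction k)
    case (Suc k)
    then show ?case using that[of "n + int p * int k"] by (simp add: algebra_simps)
  qed simp
  then show "a (n + int p * int k) = a n" "b (n + int p * int k) = b n"
    using per by (auto simp: periodic_jacobi_def)
qed

text \<open>A finitely supported vector is moved by a multiple of the period to the far right, where the
  half-line estimate applies.\<close>

lemma jacobi_full_lower_bound:
  assumes per: "periodic_jacobi p a b" and "p \<ge> 1"
    and no_root: "\<And>\<nu>. cmod \<nu> = 1 \<Longrightarrow> \<nu>\<^sup>2 - of_real (jacobi_discriminant p a b x) * \<nu> + 1 \<noteq> 0"
  obtains c where "c > 0" "\<forall>y. c * norm y \<le> norm (op_of (shifted (jacobi_full a b) (of_real x)) y)"
proof -
  let ?ah = "\<lambda>n. a (int n)" and ?bh = "\<lambda>n. b (int n)"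
  obtain \<delta> K where tame: "tame_parameters \<delta> K ?ah ?bh" and K: "\<And>n. \<bar>a n\<bar> \<le> K" "\<And>n. \<bar>b n\<bar> \<le> K"
    using periodic_jacobi_half(1)[OF per \<open>p \<ge> 1\<close>] by blast
  note ap = periodic_jacobi_half(2)[OF per \<open>p \<ge> 1\<close>, of x]
  let ?H = "shifted (jacobi_half ?ah ?bh) (of_real x)" and ?F = "shifted (jacobi_full a b) (of_real x)"
  have H: "bounded_op UNIV ?H" by (rule jacobi_half_shifted_operator(1)[OF tame])
  have F: "bounded_op UNIV ?F" by (intro bounded_op_shifted(1) jacobi_full_operator(1)[OF K])
  obtain N c where c: "c > 0" and lower: "\<forall>y. l2_fun y \<in> ell2 {N..} \<longrightarrow> c * norm y \<le> norm (op_of ?H y)"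
    by (rule jacobi_half_lower_bound[OF tame ap no_root], assumption, rule that)
  have fin: "c * norm y \<le> norm (op_of ?F y)" if fin: "finite {i. l2_fun y i \<noteq> 0}" for y :: "int l2"
  proof -
    obtain m where m: "\<And>i. l2_fun y i \<noteq> 0 \<Longrightarrow> \<bar>i\<bar> \<le> int m"
    proof -
      have "finite ((\<lambda>i. nat \<bar>i\<bar>) ` {i. l2_fun y i \<noteq> 0})" using fin by simp
      then obtain m where "\<forall>j\<in>(\<lambda>i. nat \<bar>i\<bar>) ` {i. l2_fun y i \<noteq> 0}. j \<le> m"
        using finite_nat_set_iff_bounded_le by blast
      then have "\<bar>i\<bar> \<le> int m" if "l2_fun y i \<noteq> 0" for i using that by fastforce
      then show ?thesis by (rule that)
    qed
    \<comment> \<open>Moving by \<open>k\<close> periods carries a support within distance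
      \<open>m\<close> of 0 to \<open>N + 2\<close> or beyond, out of reach of the boundary.\<close>
    define k where "k = m + N + 2"
    define s where "s = int p * int k"
    have s: "int m + int N + 2 \<le> s"
    proof -
      have "1 * int k \<le> int p * int k" using \<open>p \<ge> 1\<close> by (intro mult_right_mono) auto
      moreover have "int k = int m + int N + 2" by (simp add: k_def)
      ultimately show ?thesis unfolding s_def by linarith
    qed
    have shift: "a (n - s) = a n" "b (n - s) = b n" for n
      using periodic_jacobi_shift[OF per, of "n - s" k] by (simp_all add: s_def)
    define u where "u = (\<lambda>n::nat. l2_fun y (int n - s))"
    have u0: "u n = 0" if "n < N + 2" for n
      using m[of "int n - s"] s that unfolding u_def by fastforce
    have "finite {n. u n \<noteq> 0}"
    proof (rule finite_subset)
      show "{n. u n \<noteq> 0} \<subseteq> (\<lambda>n. int n - s) -` {i. l2_fun y i \<noteq> 0}" by (auto simp: u_def)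
      show "finite ((\<lambda>n. int n - s) -` {i. l2_fun y i \<noteq> 0})"
        using fin by (rule finite_vimageI) (simp add: inj_def)
    qed
    then have u: "u \<in> ell2 UNIV" by (rule ell2_finite_support)
    have uN: "u \<in> ell2 {N..}" using u u0 by (subst ell2_iff) auto
    have inj: "inj (\<lambda>n. int n - s)" by (simp add: inj_def)
    have "norm y \<le> norm (Abs_l2 u)"
    proof (rule norm_l2_reindex_ge[OF inj])
      show "l2_fun y i = 0" if i: "i \<notin> range (\<lambda>n. int n - s)" for i
      proof (rule ccontr)
        assume "l2_fun y i \<noteq> 0"
        then have "i = int (nat (i + s)) - s" using m[of i] s by simp
        with i show False by blast
      qed
    qed (simp only: Abs_l2_inverse'[OF u], simp add: u_def)
    moreover have "c * norm (Abs_l2 u) \<le> norm (op_of ?H (Abs_l2 u))"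
      using lower uN u by simp
    \<comment> \<open>Up to the shift, the entries of \<open>?H u\<close> occur among those of
      \<open>?F\<close> applied to \<open>y\<close>; at index 0 \<open>?H u\<close>
      vanishes.\<close>
    moreover have "norm (op_of ?H (Abs_l2 u)) \<le> norm (op_of ?F y)"
    proof (rule norm_l2_reindex_le[OF inj])
      fix n
      show "cmod (l2_fun (op_of ?H (Abs_l2 u)) n) \<le> cmod (l2_fun (op_of ?F y) (int n - s))"
      proof (cases "n = 0")
        case True
        then show ?thesis using u0[of 0] u by (simp add: l2_fun_op_of[OF H] shifted_def jacobi_half_def)
      next
        case False
        then have idx: "int n - s + 1 = int (n + 1) - s" "int n - s - 1 = int (n - 1) - s" by (simp_all add: of_nat_diff)
        have a1: "a (int n - 1 - s) = a (int (n - 1))" using shift(1)[of "int n - 1"] False by (simp add: of_nat_diff)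
        have "?F (l2_fun y) (int n - s) = ?H u n"
          using False u0[of 0] a1 unfolding shifted_def jacobi_full_def jacobi_half_def idx shift
          by (simp add: u_def)
        then show ?thesis using u by (simp add: l2_fun_op_of[OF H] l2_fun_op_of[OF F])
      qed
    qed
    ultimately show ?thesis using c by (smt (verit) mult_left_mono)
  qed
  have "c * norm y \<le> norm (op_of ?F y)" for y
  proof (rule lower_bound_from_finite_support[OF bounded_linear_op_of[OF F], where S = UNIV])
    show "c * norm z \<le> norm (op_of ?F z)" if "finite {i. l2_fun z i \<noteq> 0}" for z using that by (rule fin)
  qed (use c in auto)
  with c show ?thesis using that by blast
qed

text \<open>Half-line Weyl vectors, extended by zero, are Weyl vectors on the full line; conversely
  the full-line lower bound together with self-adjointness gives invertibility.\<close>

lemma jacobi_full_invertible_iff: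
  assumes per: "periodic_jacobi p a b" and "p \<ge> 1"
  shows "invertible_op UNIV (shifted (jacobi_full a b) (of_real x)) \<longleftrightarrow>
    (\<forall>\<nu>. cmod \<nu> = 1 \<longrightarrow> \<nu>\<^sup>2 - of_real (jacobi_discriminant p a b x) * \<nu> + 1 \<noteq> 0)"
proof -
  let ?ah = "\<lambda>n. a (int n)" and ?bh = "\<lambda>n. b (int n)" and ?\<Delta> = "complex_of_real (jacobi_discriminant p a b x)"
  let ?H = "shifted (jacobi_half ?ah ?bh) (of_real x)" and ?F = "shifted (jacobi_full a b) (of_real x)"
  obtain \<delta> K where tame: "tame_parameters \<delta> K ?ah ?bh" and K: "\<And>n. \<bar>a n\<bar> \<le> K" "\<And>n. \<bar>b n\<bar> \<le> K"
    using periodic_jacobi_half(1)[OF per \<open>p \<ge> 1\<close>] by blast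
  note ap = periodic_jacobi_half(2)[OF per \<open>p \<ge> 1\<close>, of x]
  note J = jacobi_full_operator[where a = a and b = b, OF K]
  have H: "bounded_op UNIV ?H" by (rule jacobi_half_shifted_operator(1)[OF tame])
  have F: "bounded_op UNIV ?F" by (intro bounded_op_shifted(1) J)
  have 1: "invertible_op UNIV ?F" if no_root: "\<forall>\<nu>. cmod \<nu> = 1 \<longrightarrow> \<nu>\<^sup>2 - ?\<Delta> * \<nu> + 1 \<noteq> 0"
  proof -
    obtain c where c: "c > 0" "\<forall>y. c * norm y \<le> norm (op_of ?F y)"
      by (rule jacobi_full_lower_bound[OF per \<open>p \<ge> 1\<close> no_root[rule_format]], assumption, rule that)
    have "inner (op_of ?F v) w = inner v (op_of ?F w)" for v w
      using shifted_adjoint[OF J(1) J(1) J(2), of "of_real x" v w] by simp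
    then show ?thesis using invertible_opI[OF F F _ c(1)] c(2) by blast
  qed
  have 2: "\<forall>\<nu>. cmod \<nu> = 1 \<longrightarrow> \<nu>\<^sup>2 - ?\<Delta> * \<nu> + 1 \<noteq> 0" if inv: "invertible_op UNIV ?F"
  proof (rule ccontr)
    assume "\<not> (\<forall>\<nu>. cmod \<nu> = 1 \<longrightarrow> \<nu>\<^sup>2 - ?\<Delta> * \<nu> + 1 \<noteq> 0)"
    then obtain \<nu> where root: "cmod \<nu> = 1" "\<nu>\<^sup>2 - ?\<Delta> * \<nu> + 1 = 0" by blast
    have "\<not> invertible_op UNIV ?F"
    proof (rule not_invertible_opI)
      fix \<epsilon> :: real assume "\<epsilon> > 0"
      \<comment> \<open>Support in \<open>{2..}\<close> makes both operators vanish at 0, and the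
        two-sided one also to the left of it, so the extension by zero has no larger
        residual.\<close>
      obtain u where u: "u \<in> ell2 ({1..} \<inter> {2..})" "finite {i. u i \<noteq> 0}" "ell2_norm u > 0"
          "ell2_norm (?H u) \<le> \<epsilon> * ell2_norm u"
        using jacobi_half_weyl[OF tame ap \<open>p \<ge> 1\<close> root \<open>\<epsilon> > 0\<close>, of 2] by blast
      have u0: "u 0 = 0" "u 1 = 0" and u': "u \<in> ell2 UNIV" using u(1) by (auto simp: ell2_def)
      define w where "w = (\<lambda>m::int. if m \<ge> 0 then u (nat m) else 0)"
      have "finite {m. w m \<noteq> 0}"
      proof (rule finite_subset)
        show "{m. w m \<noteq> 0} \<subseteq> int ` {i. u i \<noteq> 0}"
        proof
          fix m assume "m \<in> {m. w m \<noteq> 0}"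
          then have "m = int (nat m)" "u (nat m) \<noteq> 0" by (auto simp: w_def split: if_splits)
          then show "m \<in> int ` {i. u i \<noteq> 0}" by blast
        qed
        show "finite (int ` {i. u i \<noteq> 0})" using u(2) by simp
      qed
      then have w: "w \<in> ell2 UNIV" by (rule ell2_finite_support)
      have range: "m \<notin> range int \<Longrightarrow> m < 0" for m :: int
        by (metis not_less rangeI zero_le_imp_eq_int)
      have "norm (Abs_l2 u) \<le> norm (Abs_l2 w)"
        by (rule norm_l2_reindex_le[of int]) (simp_all only: Abs_l2_inverse'[OF w] Abs_l2_inverse'[OF u'], simp_all add: w_def)
      then have uw: "ell2_norm u \<le> ell2_norm w" by (simp add: norm_Abs_l2 w u')
      have "norm (op_of ?F (Abs_l2 w)) \<le> norm (op_of ?H (Abs_l2 u))"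
      proof (rule norm_l2_reindex_ge[of int])
        show "cmod (l2_fun (op_of ?F (Abs_l2 w)) (int n)) \<le> cmod (l2_fun (op_of ?H (Abs_l2 u)) n)" for n
        proof (cases "n = 0")
          case True
          then show ?thesis
            using u0 w by (simp add: l2_fun_op_of[OF F] shifted_def jacobi_full_def w_def)
        next
          case False
          then have idx: "int n - 1 = int (n - 1)" "int n + 1 = int (n + 1)" by (simp_all add: of_nat_diff)
          have "?F w (int n) = ?H u n"
          proof -
            have wi: "w (int k) = u k" for k by (simp add: w_def)
            show ?thesis
              using False u0 unfolding shifted_def jacobi_full_def jacobi_half_def idx wi by simp
          qed
          then show ?thesis using u' w by (simp add: l2_fun_op_of[OF F] l2_fun_op_of[OF H])
        qed
        show "l2_fun (op_of ?F (Abs_l2 w)) m = 0" if "m \<notin> range int" for m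
          using range[OF that] u0 w by (auto simp: l2_fun_op_of[OF F] shifted_def jacobi_full_def w_def)
      qed simp
      then have "ell2_norm (?F w) \<le> ell2_norm (?H u)"
        by (simp add: norm_l2_eq l2_fun_op_of[OF F] l2_fun_op_of[OF H] w u')
      also have "\<dots> \<le> \<epsilon> * ell2_norm u" by (rule u(4))
      also have "\<dots> \<le> \<epsilon> * ell2_norm w" using uw \<open>\<epsilon> > 0\<close> by simp
      finally show "\<exists>u\<in>ell2 UNIV. 0 < ell2_norm u \<and> ell2_norm (?F u) \<le> \<epsilon> * ell2_norm u"
        using w u(3) uw by (intro bexI[of _ w]) auto
    qed
    with inv show False by contradiction
  qed
  show ?thesis using 1 2 by blast
qed

lemma jacobi_full_invertible_nonreal:
  assumes per: "periodic_jacobi p a b" and "p \<ge> 1" and z: "Im z \<noteq> 0"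
  shows "invertible_op UNIV (shifted (jacobi_full a b) z)"
proof -
  obtain K where K: "\<And>n. \<bar>a n\<bar> \<le> K" "\<And>n. \<bar>b n\<bar> \<le> K"
    using periodic_jacobi_half(1)[OF per \<open>p \<ge> 1\<close>] by blast
  note J = jacobi_full_operator[where a = a and b = b, OF K]
  have lower: "\<bar>Im w\<bar> * norm x \<le> norm (op_of (shifted (jacobi_full a b) w) x)" for w x
    unfolding bounded_op_shifted(2)[OF J(1)]
    by (rule selfadjoint_lower_bound) (simp_all add: op_of_cscale J)
  show ?thesis
  proof (rule invertible_opI[OF bounded_op_shifted(1)[OF J(1)] bounded_op_shifted(1)[OF J(1)] shifted_adjoint[OF J(1) J(1) J(2)]])
    show "\<bar>Im z\<bar> > 0" using z by simp
    show "\<bar>Im z\<bar> * norm x \<le> norm (op_of (shifted (jacobi_full a b) (cnj z)) x)" for x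
      using lower[of "cnj z" x] by simp
  qed (rule lower)
qed

lemma jacobi_essential_spectrum:
  assumes "p \<ge> 1" and per: "periodic_jacobi p a' b'" and pos: "\<forall>n\<ge>1. a n > 0"
    and asym: "jacobi_asymptotic a b (jacobi_torus p a' b')"
  shows "ess_spectrum {1..} (jacobi_half a b) = spectrum_op UNIV (jacobi_full a' b')"
proof -
  note transfer = jacobi_asymptotic_transfer[OF per \<open>p \<ge> 1\<close> _ asym]
  obtain \<delta> K where tame: "tame_parameters \<delta> K a b" using transfer(1) pos by blast
  have "fredholm {1..} (shifted (jacobi_half a b) z) \<longleftrightarrow> invertible_op UNIV (shifted (jacobi_full a' b') z)" for z
  proof (cases "Im z = 0")
    case True
    then obtain x where "z = of_real x" by (metis complex_is_Real_iff Reals_cases)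
    then show ?thesis
      using jacobi_half_fredholm_iff[OF tame transfer(2) \<open>p \<ge> 1\<close>, of x] pos
        jacobi_full_invertible_iff[OF per \<open>p \<ge> 1\<close>, of x] by simp
  next
    case False
    then show ?thesis
      using jacobi_half_fredholm_nonreal[OF tame] jacobi_full_invertible_nonreal[OF per \<open>p \<ge> 1\<close>] by blast
  qed
  then show ?thesis by (simp add: ess_spectrum_def spectrum_op_def)
qed

section \<open>The isospectral torus of periodic Verblunsky coefficients\<close>

lemma cmv_transfer_mprod: "cmv_transfer k \<alpha> z = mprod (\<lambda>j. szego_step (\<alpha> j) z) 0 k"
  by (induction k) simp_all

lemma szego_step_nth:
  "szego_step \<alpha> z $ 1 $ 1 = z / of_real (rho \<alpha>)" "szego_step \<alpha> z $ 1 $ 2 = - cnj \<alpha> / of_real (rho \<alpha>)"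
  "szego_step \<alpha> z $ 2 $ 1 = - \<alpha> * z / of_real (rho \<alpha>)" "szego_step \<alpha> z $ 2 $ 2 = 1 / of_real (rho \<alpha>)"
  unfolding szego_step_def vector_scaleR_component vector_2
  by (simp_all add: scaleR_conv_of_real divide_inverse mult.commute)

lemma szego_step_mult:
  "(szego_step \<alpha> z *v V) $ 1 = (z * V $ 1 - cnj \<alpha> * V $ 2) / of_real (rho \<alpha>)"
  "(szego_step \<alpha> z *v V) $ 2 = (V $ 2 - \<alpha> * z * V $ 1) / of_real (rho \<alpha>)"
  by (simp_all add: matrix_vector_mult_def sum_2 szego_step_nth diff_divide_distrib add_divide_distrib)

lemma det_szego_step:
  assumes "cmod \<alpha> < 1"
  shows "det (szego_step \<alpha> z) = z"
proof -
  let ?r = "complex_of_real (rho \<alpha>)"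
  have r: "?r \<noteq> 0" using rho_props(1)[OF assms] by simp
  have "det (szego_step \<alpha> z) = z * (1 - \<alpha> * cnj \<alpha>) / (?r * ?r)"
    using r by (simp add: det_2 szego_step_nth field_simps)
  also have "\<dots> = z" unfolding rho_props(4)[OF assms, symmetric] using r by simp
  finally show ?thesis .
qed

lemma det_mprod_szego:
  assumes "\<And>n. cmod (\<alpha> n) < 1"
  shows "det (mprod (\<lambda>j. szego_step (\<alpha> j) z) n k) = z ^ k"
  by (induction k) (simp_all add: det_I det_mul det_szego_step assms)

lemma cmv_torus_trace:
  assumes "\<beta> \<in> cmv_torus p \<alpha>" "z \<noteq> 0"
  shows "trace (cmv_transfer p \<beta> z) = trace (cmv_transfer p \<alpha> z)"
  using assms by (auto simp: cmv_torus_def cmv_discriminant_def)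

text \<open>At \<open>z = 0\<close> the first column of every step matrix vanishes. Hence so does
  that of the product, and its lower right entry is just the product of the entries
  \<open>1 / rho\<close>.\<close>

lemma mprod_szego_zero:
  "mprod (\<lambda>j. szego_step (\<alpha> j) 0) 0 (Suc k) $ 1 $ 1 = 0 \<and> mprod (\<lambda>j. szego_step (\<alpha> j) 0) 0 (Suc k) $ 2 $ 1 = 0 \<and>
   mprod (\<lambda>j. szego_step (\<alpha> j) 0) 0 (Suc k) $ 2 $ 2 = of_real (\<Prod>j\<le>k. 1 / rho (\<alpha> j))"
proof (induction k)
  case 0
  show ?case by (simp add: matrix_matrix_mult_def sum_2 szego_step_nth mat_def)
next
  case (Suc k)
  then show ?case
    by (subst (1 2 3) mprod.simps(2)) (simp add: matrix_matrix_mult_def sum_2 szego_step_nth mult.commute del: mprod.simps(2))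
qed

text \<open>The torus fixes the trace only for \<open>z \<noteq> 0\<close>; continuity extends the
  equality to \<open>z = 0\<close>, where the trace is explicit.\<close>

lemma continuous_on_cmv_trace: "continuous_on UNIV (\<lambda>z. trace (cmv_transfer p \<alpha> z))"
proof -
  have step: "continuous_on UNIV (\<lambda>z. szego_step a z $ i $ l)" for a i l
    unfolding szego_step_def using exhaust_2[of i] exhaust_2[of l]
    by (elim disjE) (auto intro!: continuous_intros)
  have entry: "continuous_on UNIV (\<lambda>z. mprod (\<lambda>j. szego_step (\<alpha> j) z) 0 k $ i $ l)" for k i l
  proof (induction k arbitrary: i l)
    case (Suc k)
    then show ?case
      by (simp add: matrix_matrix_mult_def sum_2) (intro continuous_on_add continuous_on_mult step Suc)
  qed simp
  then show ?thesis
    unfolding cmv_transfer_mprod trace_def sum_2 by (intro continuous_on_add entry)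
qed

text \<open>At \<open>z = 0\<close> the trace of the transfer matrix is the reciprocal of \<open>\<Prod> \<rho>\<^sub>j\<close>, which is therefore
  constant on the torus.\<close>

lemma cmv_torus_bound:
  assumes per: "periodic_verblunsky p \<alpha>" and "p \<ge> 1"
  obtains r where "0 \<le> r" "r < 1" "\<forall>\<beta> n. \<beta> \<in> cmv_torus p \<alpha> \<longrightarrow> cmod (\<beta> n) \<le> r"
proof -
  define c where "c = (\<Prod>j<p. rho (\<alpha> j))"
  have \<alpha>: "cmod (\<alpha> n) < 1" for n using per by (simp add: periodic_verblunsky_def)
  have c: "0 < c" unfolding c_def by (rule prod_pos) (simp add: rho_props(1)[OF \<alpha>])
  have "c \<le> 1" unfolding c_def by (rule prod_le_1) (simp add: less_imp_le rho_props(1,2)[OF \<alpha>])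
  \<comment> \<open>All factors \<open>rho\<close> are at most 1, so each one is at least their
    product \<open>c\<close>; and \<open>rho (\<beta> n) \<ge> c\<close> means
    \<open>cmod (\<beta> n) \<le> r\<close>.\<close>
  define r where "r = sqrt (1 - c\<^sup>2)"
  have c2: "0 < c\<^sup>2" "c\<^sup>2 \<le> 1" using c \<open>c \<le> 1\<close> by (auto simp: power_le_one)
  show ?thesis
  proof (rule that[of r])
    show "0 \<le> r" "r < 1" using c2 by (auto simp: r_def)
    have "cmod (\<beta> n) \<le> r" if T: "\<beta> \<in> cmv_torus p \<alpha>" for \<beta> n
    proof -
      have \<beta>: "cmod (\<beta> n) < 1" "\<beta> (n + p) = \<beta> n" for n
        using T by (auto simp: cmv_torus_def periodic_verblunsky_def)
      have zero: "trace (cmv_transfer p \<alpha> 0) = of_real (1 / (\<Prod>j<p. rho (\<alpha> j)))" for \<alpha>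
      proof -
        obtain q where q: "p = Suc q" using \<open>p \<ge> 1\<close> by (cases p) auto
        have "trace (cmv_transfer p \<alpha> 0) = of_real (\<Prod>j\<le>q. 1 / rho (\<alpha> j))"
          using mprod_szego_zero[of \<alpha> q] by (simp add: cmv_transfer_mprod trace_def sum_2 q del: mprod.simps(2))
        then show ?thesis unfolding q lessThan_Suc_atMost by (simp add: prod_dividef)
      qed
      have "trace (cmv_transfer p \<beta> 0) = trace (cmv_transfer p \<alpha> 0)"
      proof (rule tendsto_unique)
        have cont: "((\<lambda>z. trace (cmv_transfer p \<gamma> z)) \<longlongrightarrow> trace (cmv_transfer p \<gamma> 0)) (at 0)" for \<gamma>
          using continuous_on_cmv_trace[of p \<gamma>] by (simp add: continuous_on_def)
        show "((\<lambda>z. trace (cmv_transfer p \<alpha> z)) \<longlongrightarrow> trace (cmv_transfer p \<alpha> 0)) (at 0)" by (rule cont)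
        show "((\<lambda>z. trace (cmv_transfer p \<alpha> z)) \<longlongrightarrow> trace (cmv_transfer p \<beta> 0)) (at 0)"
        proof (rule Lim_transform_eventually[OF cont[of \<beta>]])
          show "eventually (\<lambda>z. trace (cmv_transfer p \<beta> z) = trace (cmv_transfer p \<alpha> z)) (at 0)"
            using cmv_torus_trace[OF T] by (simp add: eventually_at_filter)
        qed
      qed simp
      then have "(\<Prod>j<p. rho (\<beta> j)) = c" unfolding zero c_def of_real_eq_iff by simp
      moreover have "(\<Prod>j<p. rho (\<beta> j)) \<le> rho (\<beta> (n mod p))"
      proof -
        have "n mod p < p" using \<open>p \<ge> 1\<close> by simp
        then have "(\<Prod>j<p. rho (\<beta> j)) = rho (\<beta> (n mod p)) * (\<Prod>j\<in>{..<p} - {n mod p}. rho (\<beta> j))"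
          by (intro prod.remove) auto
        also have "\<dots> \<le> rho (\<beta> (n mod p)) * 1"
          using rho_props(1,2)[OF \<beta>(1)] by (intro mult_left_mono prod_le_1) (auto intro: less_imp_le)
        finally show ?thesis by simp
      qed
      moreover have "\<beta> n = \<beta> (n mod p)"
      proof -
        have "\<beta> (m + k * p) = \<beta> m" for m k
        proof (induction k)
          case (Suc k)
          have "m + Suc k * p = (m + k * p) + p" by simp
          then show ?case using \<beta>(2) Suc by metis
        qed simp
        from this[of "n mod p" "n div p"] show ?thesis by (simp only: mod_div_mult_eq)
      qed
      ultimately have "c\<^sup>2 \<le> (rho (\<beta> n))\<^sup>2" using c by (intro power_mono) auto
      then have "(cmod (\<beta> n))\<^sup>2 \<le> 1 - c\<^sup>2" using rho_props(3)[OF \<beta>(1)] by simp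
      then show ?thesis unfolding r_def by (rule real_le_rsqrt)
    qed
    then show "\<forall>\<beta> n. \<beta> \<in> cmv_torus p \<alpha> \<longrightarrow> cmod (\<beta> n) \<le> r" by blast
  qed
qed

section \<open>From asymptotic Verblunsky coefficients to windows of Szego matrices\<close>

lemma cmv_asymptotic_window:
  assumes asym: "cmv_asymptotic \<gamma> T" and "T \<noteq> {}" and \<gamma>: "\<And>n. cmod (\<gamma> n) < 1"
    and T: "\<And>\<beta> n. \<beta> \<in> T \<Longrightarrow> cmod (\<beta> n) < 1" and "\<eta> > 0"
  shows "\<exists>N. \<forall>n\<ge>N. \<exists>\<beta>\<in>T. \<forall>k\<le>L. cmod (\<gamma> (n + k) - \<beta> k) < \<eta>"
proof -
  define c where "c = \<eta> * exp (- real L)"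
  have "c > 0" using \<open>\<eta> > 0\<close> by (simp add: c_def)
  then have "eventually (\<lambda>m. (INF \<beta>\<in>T. verblunsky_dist (\<lambda>n. \<gamma> (n + m)) \<beta>) < c) sequentially"
    using asym unfolding cmv_asymptotic_def by (intro order_tendstoD) auto
  then obtain N where N: "\<And>m. m \<ge> N \<Longrightarrow> (INF \<beta>\<in>T. verblunsky_dist (\<lambda>n. \<gamma> (n + m)) \<beta>) < c"
    by (auto simp: eventually_at_top_linorder)
  have "\<exists>\<beta>\<in>T. \<forall>k\<le>L. cmod (\<gamma> (n + k) - \<beta> k) < \<eta>" if n: "n \<ge> N" for n
  proof -
    \<comment> \<open>The infimum is taken in the reals, so extracting a near-minimiser requires a
      nonempty torus.\<close>
    have "(\<lambda>\<beta>. verblunsky_dist (\<lambda>k. \<gamma> (k + n)) \<beta>) ` T \<noteq> {}" using \<open>T \<noteq> {}\<close> by simp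
    from cInf_lessD[OF this N[OF n]] obtain \<beta>
      where \<beta>: "\<beta> \<in> T" and dist: "verblunsky_dist (\<lambda>k. \<gamma> (k + n)) \<beta> < c" by blast
    have "cmod (\<gamma> (n + k) - \<beta> k) < \<eta>" if k: "k \<le> L" for k
    proof -
      let ?f = "\<lambda>k. exp (- real k) * cmod (\<gamma> (k + n) - \<beta> k)"
      have "summable ?f"
      \<comment> \<open>Points of the unit disk differ by at most 2, so a geometric series
        dominates. Summability is what allows a single term to be bounded by the infinite
        sum.\<close>
      proof (rule summable_comparison_test')
        show "summable (\<lambda>k. 2 * exp (- 1) ^ k :: real)"
          by (intro summable_mult summable_geometric) simp
        fix k
        have "cmod (\<gamma> (k + n) - \<beta> k) \<le> 2"
          using norm_triangle_ineq4[of "\<gamma> (k + n)" "\<beta> k"] \<gamma>[of "k + n"] T[OF \<beta>, of k] by linarith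
        moreover have "exp (- real k) = exp (- 1) ^ k" by (simp add: exp_of_nat_mult[symmetric])
        ultimately show "norm (?f k) \<le> 2 * exp (- 1) ^ k" by (simp add: abs_mult mult.commute)
      qed
      then have "sum ?f {k} \<le> suminf ?f" by (intro sum_le_suminf) auto
      then have "?f k < c" using dist unfolding verblunsky_dist_def by simp
      also have "c \<le> \<eta> * exp (- real k)" using k \<open>\<eta> > 0\<close> by (simp add: c_def)
      finally show ?thesis by (simp add: mult.commute add.commute)
    qed
    with \<beta> show ?thesis by blast
  qed
  then show ?thesis by blast
qed

lemma cmv_asymptotic_transfer:
  assumes per: "periodic_verblunsky p \<alpha>" and "p \<ge> 1" and \<gamma>: "\<And>n. cmod (\<gamma> n) < 1"
    and asym: "cmv_asymptotic \<gamma> (cmv_torus p \<alpha>)" and "z \<noteq> 0"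
  shows "asymptotically_periodic p (trace (cmv_transfer p \<alpha> z)) (z ^ p) (\<lambda>n. szego_step (\<gamma> n) z)"
proof -
  let ?T = "cmv_torus p \<alpha>"
  have "\<alpha> \<in> ?T" using per by (simp add: cmv_torus_def)
  then have ne: "?T \<noteq> {}" by blast
  have T1: "cmod (\<beta> n) < 1" "\<beta> (n + p) = \<beta> n" if "\<beta> \<in> ?T" for \<beta> n
    using that by (auto simp: cmv_torus_def periodic_verblunsky_def)
  obtain r where r: "0 \<le> r" "r < 1" and T: "\<forall>\<beta> n. \<beta> \<in> ?T \<longrightarrow> cmod (\<beta> n) \<le> r"
    using cmv_torus_bound[OF per \<open>p \<ge> 1\<close>] by metis
  have window: "\<exists>N. \<forall>n\<ge>N. \<exists>\<beta>\<in>?T. \<forall>k\<le>L. cmod (\<gamma> (n + k) - \<beta> k) < \<eta>" if "\<eta> > 0" for \<eta> L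
    by (rule cmv_asymptotic_window[OF asym ne]) (use \<gamma> T1(1) that in auto)
  \<comment> \<open>The radius lies halfway between \<open>r\<close> and 1: torus values have room
    for nearby \<open>\<gamma>\<close>, and \<open>rho\<close> stays positive on the disk.\<close>
  define S where "S = cball (0 :: complex) ((1 + r) / 2)"
  have S: "cmod w < 1" if "w \<in> S" for w using that r by (simp add: S_def)
  have "compact S" by (simp add: S_def)
  moreover have "continuous_on S (\<lambda>w. szego_step w z)"
    unfolding szego_step_def rho_def
  proof (intro continuous_intros)
    show "\<forall>w\<in>S. sqrt (1 - (cmod w)\<^sup>2) \<noteq> 0"
      using rho_props(1)[OF S] unfolding rho_def by (metis less_irrefl)
  qed
  ultimately obtain C where C: "\<And>w. w \<in> S \<Longrightarrow> norm (szego_step w z) \<le> C"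
    "\<And>\<epsilon>. \<epsilon> > 0 \<Longrightarrow> \<exists>\<eta>>0. \<forall>x\<in>S. \<forall>y\<in>S. dist x y < \<eta> \<longrightarrow> norm (szego_step x z - szego_step y z) \<le> \<epsilon>"
    by (rule compact_modulus) (rule that; assumption)
  show ?thesis
    unfolding asymptotically_periodic_def
  proof (intro exI[of _ C] allI impI)
    fix L and \<epsilon> :: real assume "\<epsilon> > 0"
    then obtain \<eta> where \<eta>: "\<eta> > 0" "\<And>x y. x \<in> S \<Longrightarrow> y \<in> S \<Longrightarrow> dist x y < \<eta> \<Longrightarrow> norm (szego_step x z - szego_step y z) \<le> \<epsilon>"
      using C(2) by meson
    define \<eta>' where "\<eta>' = min \<eta> ((1 - r) / 2)"
    have \<eta>': "\<eta>' > 0" "\<eta>' \<le> \<eta>" "\<eta>' \<le> (1 - r) / 2"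
      using \<eta>(1) r by (simp_all only: \<eta>'_def min.cobounded1 min.cobounded2) simp
    obtain N where N: "\<And>n. n \<ge> N \<Longrightarrow> \<exists>\<beta>\<in>?T. \<forall>k\<le>L. cmod (\<gamma> (n + k) - \<beta> k) < \<eta>'"
      using window[OF \<eta>'(1), of L] by blast
    have "periodic_window p (trace (cmv_transfer p \<alpha> z)) (z ^ p) C (\<lambda>n. szego_step (\<gamma> n) z) L \<epsilon> n"
      if n: "n \<ge> N" for n
    proof -
      obtain \<beta> where \<beta>: "\<beta> \<in> ?T" and close: "\<And>k. k \<le> L \<Longrightarrow> cmod (\<gamma> (n + k) - \<beta> k) < \<eta>'"
        using N[OF n] by blast
      have \<beta>r: "cmod (\<beta> k) \<le> r" for k using T \<beta> by blast
      have \<beta>S: "\<beta> k \<in> S" for k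
      proof -
        have "r \<le> (1 + r) / 2" using r(2) by (simp add: field_simps)
        then have "cmod (\<beta> k) \<le> (1 + r) / 2" using \<beta>r[of k] by (rule order_trans[rotated])
        then show ?thesis by (simp add: S_def)
      qed
      show ?thesis
        unfolding periodic_window_def
      proof (intro exI[of _ "\<lambda>j. szego_step (\<beta> j) z"] conjI allI impI)
        show "trace (mprod (\<lambda>j. szego_step (\<beta> j) z) 0 p) = trace (cmv_transfer p \<alpha> z)"
          using cmv_torus_trace[OF \<beta> \<open>z \<noteq> 0\<close>] by (simp add: cmv_transfer_mprod)
        show "det (mprod (\<lambda>j. szego_step (\<beta> j) z) 0 p) = z ^ p"
          by (rule det_mprod_szego) (rule T1(1)[OF \<beta>])
        show "norm (szego_step (\<gamma> (n + j)) z - szego_step (\<beta> j) z) \<le> \<epsilon>" if j: "j \<le> L" for j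
        proof (rule \<eta>(2))
          have "cmod (\<gamma> (n + j)) \<le> cmod (\<beta> j) + cmod (\<gamma> (n + j) - \<beta> j)" by (rule norm_triangle_sub)
          then have "cmod (\<gamma> (n + j)) \<le> (1 + r) / 2"
            using close[OF j] \<eta>'(3) \<beta>r[of j] by (simp add: field_simps)
          then show "\<gamma> (n + j) \<in> S" by (simp add: S_def)
          show "dist (\<gamma> (n + j)) (\<beta> j) < \<eta>" using close[OF j] \<eta>'(2) by (simp add: dist_norm)
        qed (rule \<beta>S)
      qed (auto simp: T1(2)[OF \<beta>] C(1)[OF \<beta>S])
    qed
    then show "\<exists>N. \<forall>n\<ge>N. periodic_window p (trace (cmv_transfer p \<alpha> z)) (z ^ p) C (\<lambda>n. szego_step (\<gamma> n) z) L \<epsilon> n"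
      by blast
  qed
qed

text \<open>The periodic coefficients serve as their own model, with the same \<open>t\<close> and
  \<open>D\<close>, so that \<open>cmv_fredholm_iff\<close> applies to both sides of the equality of
  essential spectra.\<close>

lemma cmv_periodic_transfer:
  assumes per: "periodic_verblunsky p \<alpha>" and "p \<ge> 1"
  shows "asymptotically_periodic p (trace (cmv_transfer p \<alpha> z)) (z ^ p) (\<lambda>n. szego_step (\<alpha> n) z)"
proof -
  have \<alpha>: "cmod (\<alpha> n) < 1" "\<alpha> (n + p) = \<alpha> n" for n using per by (auto simp: periodic_verblunsky_def)
  have "asymptotically_periodic p (trace (mprod (\<lambda>n. szego_step (\<alpha> n) z) 0 p))
      (det (mprod (\<lambda>n. szego_step (\<alpha> n) z) 0 p)) (\<lambda>n. szego_step (\<alpha> n) z)"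
    by (rule periodic_imp_asymptotically_periodic) (use \<open>p \<ge> 1\<close> in \<open>simp_all add: \<alpha>\<close>)
  then show ?thesis by (simp add: cmv_transfer_mprod det_mprod_szego \<alpha>)
qed

section \<open>CMV matrices with asymptotically periodic transfer matrices\<close>

lemma norm_vec_2_le: "norm (v :: complex^2) \<le> cmod (v $ 1) + cmod (v $ 2)"
proof (rule power2_le_imp_le)
  show "(norm v)\<^sup>2 \<le> (cmod (v $ 1) + cmod (v $ 2))\<^sup>2" unfolding norm_vec_2 by (simp add: power2_sum)
qed simp

lemma cmv_L_eqs:
  assumes "even n"
  shows "cmv_L \<alpha> v n = cnj (\<alpha> n) * v n + of_real (rho (\<alpha> n)) * v (Suc n)"
    "cmv_L \<alpha> v (Suc n) = of_real (rho (\<alpha> n)) * v n - \<alpha> n * v (Suc n)"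
  using assms by (simp_all add: cmv_L_def Theta_def)

lemma cmv_M_eqs:
  "cmv_M \<alpha> u 0 = u 0"
  "odd n \<Longrightarrow> cmv_M \<alpha> u n = cnj (\<alpha> n) * u n + of_real (rho (\<alpha> n)) * u (Suc n)"
  "odd n \<Longrightarrow> cmv_M \<alpha> u (Suc n) = of_real (rho (\<alpha> n)) * u n - \<alpha> n * u (Suc n)"
  by (auto simp: cmv_M_def Theta_def)

text \<open>The pair of \<open>h n\<close> and \<open>v n\<close>, with \<open>v\<close> the image
  of \<open>h\<close> under \<open>cmv_M\<close>, is propagated to the right: from even
  \<open>n\<close> through a block of \<open>cmv_L\<close>, from odd \<open>n\<close> through one of
  \<open>cmv_M\<close>. The even step divides by \<open>z\<close>, so \<open>z = 0\<close> is
  settled by inverting both factors.\<close>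

lemma cmv_formal_solution_unique:
  assumes \<alpha>: "\<And>n. cmod (\<alpha> n) < 1" and h: "shifted (cmv \<alpha>) z h = (\<lambda>i. 0)" and "h 0 = 0"
  shows "h = (\<lambda>i. 0)"
proof -
  define v where "v = cmv_M \<alpha> h"
  have L: "cmv_L \<alpha> v n = z * h n" for n
    using fun_cong[OF h, of n] by (simp add: shifted_def cmv_def v_def)
  have r: "complex_of_real (rho (\<alpha> n)) \<noteq> 0" for n using rho_props(1)[OF \<alpha>[of n]] by simp
  show ?thesis
  proof (cases "z = 0")
    case True
    have zero: "cmv_L (\<lambda>n. cnj (\<alpha> n)) (\<lambda>i. 0) = (\<lambda>i. 0)" "cmv_M (\<lambda>n. cnj (\<alpha> n)) (\<lambda>i. 0) = (\<lambda>i. 0)"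
      by (auto simp: cmv_L_def cmv_M_def)
    have "cmv_L \<alpha> v = (\<lambda>i. 0)" using L True by auto
    then have "v = (\<lambda>i. 0)" using cmv_L_inverse[of \<alpha> v, OF \<alpha>] zero by simp
    then show ?thesis using cmv_M_inverse[of \<alpha> h, OF \<alpha>] zero by (simp add: v_def)
  next
    case False
    have "h n = 0 \<and> v n = 0" for n
    proof (induction n)
      case 0
      then show ?case using \<open>h 0 = 0\<close> by (simp add: v_def cmv_M_eqs)
    next
      case (Suc n)
      show ?case
      proof (cases "even n")
        case True
        have "v (Suc n) = 0" using L[of n] Suc r[of n] by (simp add: cmv_L_eqs[OF True])
        moreover have "h (Suc n) = 0"
          using L[of "Suc n"] Suc \<open>z \<noteq> 0\<close> \<open>v (Suc n) = 0\<close> by (simp add: cmv_L_eqs[OF True])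
        ultimately show ?thesis by simp
      next
        case odd: False
        have "h (Suc n) = 0"
          using cmv_M_eqs(2)[OF odd, of \<alpha> h] Suc r[of n] by (simp add: v_def)
        moreover have "v (Suc n) = 0"
          using cmv_M_eqs(3)[OF odd, of \<alpha> h] Suc \<open>h (Suc n) = 0\<close> by (simp add: v_def)
        ultimately show ?thesis by simp
      qed
    qed
    then show ?thesis by blast
  qed
qed

text \<open>The two scalar expressions compare with the rows of \<open>Theta \<alpha>\<close>
  applied to \<open>(W $ 2, W' $ 1)\<close>, the form in which the CMV equations come; solving for
  \<open>W'\<close> yields the step matrix at the cost of dividing by \<open>rho\<close>.\<close>

lemma szego_step_defect:
  assumes \<alpha>: "cmod \<alpha> < 1"
  defines "\<rho> \<equiv> complex_of_real (rho \<alpha>)"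
  shows "norm (W' - szego_step \<alpha> z *v W) \<le>
    2 / rho \<alpha> * cmod (z * W $ 1 - cnj \<alpha> * W $ 2 - \<rho> * W' $ 1) + cmod (W' $ 2 - \<rho> * W $ 2 + \<alpha> * W' $ 1)"
proof -
  let ?e = "z * W $ 1 - cnj \<alpha> * W $ 2 - \<rho> * W' $ 1" and ?e' = "W' $ 2 - \<rho> * W $ 2 + \<alpha> * W' $ 1"
  let ?d = "W' - szego_step \<alpha> z *v W"
  have r: "rho \<alpha> > 0" by (rule rho_props(1)[OF \<alpha>])
  then have \<rho>: "\<rho> \<noteq> 0" by (simp add: \<rho>_def)
  have \<rho>2: "\<rho> * \<rho> = 1 - \<alpha> * cnj \<alpha>" unfolding \<rho>_def by (rule rho_props(4)[OF \<alpha>])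
  have A: "\<rho> * (szego_step \<alpha> z *v W) $ 1 = z * W $ 1 - cnj \<alpha> * W $ 2"
    "\<rho> * (szego_step \<alpha> z *v W) $ 2 = W $ 2 - \<alpha> * z * W $ 1"
    unfolding szego_step_mult \<rho>_def[symmetric] using \<rho> by simp_all
  have "\<rho> * ?d $ 1 = - ?e" by (simp add: right_diff_distrib A)
  then have "rho \<alpha> * cmod (?d $ 1) = cmod ?e"
    using r by (metis \<rho>_def abs_of_pos norm_minus_cancel norm_mult norm_of_real)
  then have 1: "cmod (?d $ 1) = cmod ?e / rho \<alpha>" using r by (simp add: field_simps)
  have "\<rho> * ?d $ 2 = \<rho> * W' $ 2 - W $ 2 + \<alpha> * z * W $ 1"
    by (simp add: right_diff_distrib A)
  also have "\<dots> = \<rho> * ?e' + \<alpha> * ?e"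
  proof -
    have "\<rho> * ?e' + \<alpha> * ?e = \<rho> * W' $ 2 - (\<rho> * \<rho>) * W $ 2 + \<alpha> * z * W $ 1 - \<alpha> * cnj \<alpha> * W $ 2"
      by (simp add: algebra_simps)
    then show ?thesis unfolding \<rho>2 by (simp add: algebra_simps)
  qed
  finally have "rho \<alpha> * cmod (?d $ 2) = cmod (\<rho> * ?e' + \<alpha> * ?e)"
    using r by (metis \<rho>_def abs_of_pos norm_mult norm_of_real)
  also have "\<dots> \<le> rho \<alpha> * cmod ?e' + 1 * cmod ?e"
  proof (rule order_trans[OF norm_triangle_ineq add_mono])
    show "cmod (\<rho> * ?e') \<le> rho \<alpha> * cmod ?e'" using r by (simp add: \<rho>_def norm_mult)
    show "cmod (\<alpha> * ?e) \<le> 1 * cmod ?e" using \<alpha> unfolding norm_mult by (intro mult_right_mono) auto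
  qed
  finally have 2: "cmod (?d $ 2) \<le> cmod ?e' + cmod ?e / rho \<alpha>" using r by (simp add: field_simps)
  have "norm ?d \<le> cmod (?d $ 1) + cmod (?d $ 2)" by (rule norm_vec_2_le)
  also have "\<dots> \<le> cmod ?e / rho \<alpha> + (cmod ?e' + cmod ?e / rho \<alpha>)" using 1 2 by (intro add_mono) simp_all
  finally show ?thesis by simp
qed

lemma szego_step_solution:
  assumes \<alpha>: "cmod \<alpha> < 1" and W: "W' = szego_step \<alpha> z *v W"
  shows "z * W $ 1 = cnj \<alpha> * W $ 2 + of_real (rho \<alpha>) * W' $ 1"
    "W' $ 2 = of_real (rho \<alpha>) * W $ 2 - \<alpha> * W' $ 1"
proof -
  let ?r = "complex_of_real (rho \<alpha>)"
  have r: "?r \<noteq> 0" using rho_props(1)[OF \<alpha>] by simp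
  show 1: "z * W $ 1 = cnj \<alpha> * W $ 2 + ?r * W' $ 1"
    using r by (simp add: W szego_step_mult)
  have "?r * W' $ 2 = W $ 2 - \<alpha> * (z * W $ 1)"
    using r by (simp add: W szego_step_mult mult.assoc)
  also have "\<dots> = (1 - \<alpha> * cnj \<alpha>) * W $ 2 - ?r * (\<alpha> * W' $ 1)" unfolding 1 by (simp add: algebra_simps)
  also have "\<dots> = ?r * (?r * W $ 2 - \<alpha> * W' $ 1)"
    unfolding rho_props(4)[OF \<alpha>, symmetric] by (simp add: algebra_simps)
  finally show "W' $ 2 = ?r * W $ 2 - \<alpha> * W' $ 1" using r by simp
qed

text \<open>With \<open>v = \<M> u\<close> and \<open>m = n div 2\<close>, the vectors \<open>z\<^sup>m (u\<^sub>n, v\<^sub>n)\<close> for even \<open>n\<close> and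
  \<open>z\<^sup>m (v\<^sub>n, z u\<^sub>n)\<close> for odd \<open>n\<close> turn the equation \<open>(\<C> - z) u = f\<close> into the Szego recursion.\<close>

definition szego_vector :: "complex \<Rightarrow> (nat \<Rightarrow> complex) \<Rightarrow> (nat \<Rightarrow> complex) \<Rightarrow> nat \<Rightarrow> complex^2" where
  "szego_vector z u v n = (if even n then vector [z ^ (n div 2) * u n, z ^ (n div 2) * v n]
     else vector [z ^ (n div 2) * v n, z ^ (n div 2) * (z * u n)])"

lemma norm_szego_vector:
  assumes "cmod z = 1"
  shows "(norm (szego_vector z u v n))\<^sup>2 = (cmod (u n))\<^sup>2 + (cmod (v n))\<^sup>2"
  unfolding norm_vec_2 szego_vector_def using assms by (simp add: norm_mult norm_power)

text \<open>At even \<open>n\<close> the step runs through a block of \<open>cmv_L\<close>, where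
  the defects are entries of \<open>f\<close> up to a unimodular factor; at odd \<open>n\<close> it
  runs through a block of \<open>cmv_M\<close>, where they vanish because the second sequence is
  exactly \<open>cmv_M \<gamma> u\<close>.\<close>

lemma szego_vector_residual:
  fixes u :: "nat \<Rightarrow> complex"
  assumes \<gamma>: "\<And>n. cmod (\<gamma> n) < 1" and z: "cmod z = 1" and K: "1 / rho (\<gamma> n) \<le> K" "K \<ge> 1"
  defines "f \<equiv> shifted (cmv \<gamma>) z u"
  shows "norm (szego_vector z u (cmv_M \<gamma> u) (Suc n) - szego_step (\<gamma> n) z *v szego_vector z u (cmv_M \<gamma> u) n)
    \<le> 2 * K * (cmod (f n) + cmod (f (Suc n)))"
proof -
  let ?v = "cmv_M \<gamma> u"
  let ?W = "szego_vector z u ?v"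
  let ?\<rho> = "complex_of_real (rho (\<gamma> n))"
  define e where "e = z * ?W n $ 1 - cnj (\<gamma> n) * ?W n $ 2 - ?\<rho> * ?W (Suc n) $ 1"
  define e' where "e' = ?W (Suc n) $ 2 - ?\<rho> * ?W n $ 2 + \<gamma> n * ?W (Suc n) $ 1"
  have bound: "cmod e \<le> cmod (f n) \<and> cmod e' \<le> cmod (f (Suc n))"
  proof (cases "even n")
    case True
    have "e = z ^ (n div 2) * (z * u n - cmv_L \<gamma> ?v n)"
      using True by (simp add: e_def szego_vector_def cmv_L_eqs(1)[OF True] algebra_simps)
    moreover have "e' = z ^ (n div 2) * (z * u (Suc n) - cmv_L \<gamma> ?v (Suc n))"
      using True by (simp add: e'_def szego_vector_def cmv_L_eqs(2)[OF True] algebra_simps)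
    ultimately show ?thesis
      using z by (simp add: f_def shifted_def cmv_def norm_mult norm_power norm_minus_commute)
  next
    case odd: False
    have "e = z ^ (Suc n div 2) * (?v n - cnj (\<gamma> n) * u n - ?\<rho> * u (Suc n))"
      using odd by (simp add: e_def szego_vector_def algebra_simps)
    moreover have "e' = z ^ (Suc n div 2) * (?v (Suc n) - ?\<rho> * u n + \<gamma> n * u (Suc n))"
      using odd by (simp add: e'_def szego_vector_def algebra_simps)
    ultimately show ?thesis using cmv_M_eqs(2,3)[OF odd, of \<gamma> u] by simp
  qed
  have "norm (?W (Suc n) - szego_step (\<gamma> n) z *v ?W n) \<le> 2 / rho (\<gamma> n) * cmod e + cmod e'"
    unfolding e_def e'_def by (rule szego_step_defect[OF \<gamma>])
  also have "\<dots> \<le> (2 * K) * cmod (f n) + (2 * K) * cmod (f (Suc n))"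
  proof (intro add_mono mult_mono)
    show "2 / rho (\<gamma> n) \<le> 2 * K" using K(1) by simp
    have "1 * cmod e' \<le> (2 * K) * cmod (f (Suc n))" using bound K(2) by (intro mult_mono) auto
    then show "cmod e' \<le> (2 * K) * cmod (f (Suc n))" by simp
  qed (use bound K in auto)
  finally show ?thesis by (simp add: distrib_left)
qed

lemma cmv_lower_bound:
  assumes \<gamma>: "\<And>n. cmod (\<gamma> n) < 1" and z: "cmod z = 1"
    and ap: "asymptotically_periodic p t D (\<lambda>n. szego_step (\<gamma> n) z)"
    and no_root: "\<And>\<nu>. cmod \<nu> = 1 \<Longrightarrow> \<nu>\<^sup>2 - t * \<nu> + D \<noteq> 0"
  obtains N c where "c > 0" "\<forall>y. l2_fun y \<in> ell2 {N..} \<longrightarrow> c * norm y \<le> norm (op_of (shifted (cmv \<gamma>) z) y)"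
proof -
  let ?A = "\<lambda>n. szego_step (\<gamma> n) z" and ?B = "shifted (cmv \<gamma>) z"
  obtain N C where NC: "C > 0" "\<forall>U M. (\<forall>n. n < N \<or> n \<ge> M \<longrightarrow> U n = 0) \<longrightarrow> L2_set (\<lambda>n. norm (U n)) {..<M} \<le>
       C * L2_set (\<lambda>n. norm (U (Suc n) - ?A n *v U n)) {..<M}"
    by (rule transfer_lower_bound[OF ap no_root], assumption, rule that)
  obtain K where K: "K \<ge> 1" "\<And>n. norm (?A n) \<le> K"
    by (rule asymptotically_periodicE[OF ap]) (rule that)
  \<comment> \<open>The bound on \<open>1 / rho\<close> is already contained in the bound on the
    step matrices, as it is their lower right entry.\<close>
  have rho: "1 / rho (\<gamma> n) \<le> K" for n
  proof -
    have "cmod (?A n $ 2 $ 2) \<le> norm (?A n)"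
      using Finite_Cartesian_Product.norm_nth_le[of "?A n $ 2" 2] Finite_Cartesian_Product.norm_nth_le[of "?A n" 2]
      by linarith
    then show ?thesis
      using K(2)[of n] rho_props(1)[OF \<gamma>[of n]] by (simp add: szego_step_nth norm_divide)
  qed
  have B: "bounded_op UNIV ?B" by (intro bounded_op_shifted(1) cmv_operator(1) \<gamma>)
  show ?thesis
  \<comment> \<open>The constant collects \<open>C\<close> from the recursion, \<open>2 * K\<close>
    from the residual, and 2 because each residual involves two neighbouring entries of
    \<open>f\<close>.\<close>
  proof (rule that[of "1 / (4 * C * K)" "N + 2"])
    show pos: "1 / (4 * C * K) > 0" using NC(1) K(1) by simp
    have "1 / (4 * C * K) * norm y \<le> norm (op_of ?B y)" if y: "l2_fun y \<in> ell2 {N + 2..}" for y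
    proof (rule lower_bound_from_finite_support[OF bounded_linear_op_of[OF B] _ _ y])
      show "0 \<le> 1 / (4 * C * K)" using pos by simp
      fix y :: "nat l2" assume y: "l2_fun y \<in> ell2 {N + 2..}" and fin: "finite {i. l2_fun y i \<noteq> 0}"
      define u where "u = l2_fun y"
      define f where "f = ?B u"
      define W where "W = szego_vector z u (cmv_M \<gamma> u)"
      obtain M where M: "\<And>n. n \<ge> M \<Longrightarrow> u n = 0"
        using finite_support_bound[OF fin] unfolding u_def by blast
      have u0: "u n = 0" if "n < N + 2" for n using y that by (auto simp: u_def ell2_def)
      have v0: "cmv_M \<gamma> u n = 0" if "u n = 0" "u (n - 1) = 0" "u (n + 1) = 0" for n
        using that by (cases n) (auto simp: cmv_M_def)
      have W0: "W n = 0" if "n < N \<or> n \<ge> M + 1" for n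
      proof -
        have "u n = 0" "u (n - 1) = 0" "u (n + 1) = 0" using that M u0 by auto
        then show ?thesis using v0[of n] by (simp add: W_def szego_vector_def vec_eq_iff forall_2)
      qed
      have "norm y = L2_set (\<lambda>n. cmod (u n)) {..<M + 1}"
        unfolding u_def by (rule norm_l2_finite_support) (use M in \<open>simp add: u_def\<close>)
      also have "\<dots> \<le> L2_set (\<lambda>n. norm (W n)) {..<M + 1}"
      proof (rule L2_set_mono)
        show "cmod (u n) \<le> norm (W n)" for n
          by (rule power2_le_imp_le) (simp_all add: W_def norm_szego_vector[OF z])
      qed simp
      also have "\<dots> \<le> C * L2_set (\<lambda>n. norm (W (Suc n) - ?A n *v W n)) {..<M + 1}"
        using W0 by (intro NC(2)[rule_format]) auto
      also have "\<dots> \<le> C * (2 * K * (norm (op_of ?B y) + norm (op_of ?B y)))"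
      proof (rule mult_left_mono)
        have "L2_set (\<lambda>n. norm (W (Suc n) - ?A n *v W n)) {..<M + 1} \<le>
            L2_set (\<lambda>n. 2 * K * (cmod (f n) + cmod (f (Suc n)))) {..<M + 1}"
          unfolding W_def f_def by (intro L2_set_mono szego_vector_residual \<gamma> z rho K) simp
        also have "\<dots> = 2 * K * L2_set (\<lambda>n. cmod (f n) + cmod (f (Suc n))) {..<M + 1}"
          using K(1) by (intro L2_set_right_distrib[symmetric]) simp
        also have "\<dots> \<le> 2 * K * (norm (op_of ?B y) + norm (op_of ?B y))"
        proof (rule mult_left_mono[OF order_trans[OF L2_set_triangle_ineq add_mono]])
          have f: "f = l2_fun (op_of ?B y)" by (simp add: f_def u_def l2_fun_op_of[OF B])
          show "L2_set (\<lambda>n. cmod (f n)) {..<M + 1} \<le> norm (op_of ?B y)"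
            unfolding f by (rule L2_set_le_norm_l2) simp
          have "L2_set (\<lambda>n. cmod (f (Suc n))) {..<M + 1} = L2_set (\<lambda>n. cmod (f n)) (Suc ` {..<M + 1})"
            unfolding L2_set_def by (subst sum.reindex) auto
          also have "\<dots> \<le> norm (op_of ?B y)" unfolding f by (rule L2_set_le_norm_l2) simp
          finally show "L2_set (\<lambda>n. cmod (f (Suc n))) {..<M + 1} \<le> norm (op_of ?B y)" .
        qed (use K in simp)
        finally show "L2_set (\<lambda>n. norm (W (Suc n) - ?A n *v W n)) {..<M + 1} \<le>
            2 * K * (norm (op_of ?B y) + norm (op_of ?B y))" .
      qed (use NC(1) in simp)
      finally show "1 / (4 * C * K) * norm y \<le> norm (op_of ?B y)"
        using NC(1) K(1) by (simp add: field_simps)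
    qed
    then show "\<forall>y. l2_fun y \<in> ell2 {N + 2..} \<longrightarrow> 1 / (4 * C * K) * norm y \<le> norm (op_of ?B y)" by blast
  qed
qed

text \<open>As in the Jacobi case, but the window has to start at an odd and to end at an even index, so
  that truncation commutes with \<open>\<M>\<close>.\<close>

lemma cmv_weyl:
  assumes \<gamma>: "\<And>n. cmod (\<gamma> n) < 1" and z: "cmod z = 1"
    and ap: "asymptotically_periodic p t D (\<lambda>n. szego_step (\<gamma> n) z)" and "p \<ge> 1"
    and root: "cmod \<nu> = 1" "\<nu>\<^sup>2 - t * \<nu> + D = 0" and "\<epsilon> > 0"
  shows "\<exists>u\<in>ell2 (UNIV \<inter> {N..}). finite {i. u i \<noteq> 0} \<and> ell2_norm u > 0 \<and>
    ell2_norm (shifted (cmv \<gamma>) z u) \<le> \<epsilon> * ell2_norm u"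
proof -
  let ?A = "\<lambda>n. szego_step (\<gamma> n) z" and ?B = "shifted (cmv \<gamma>) z"
  obtain C where C: "C > 0" "\<forall>L. \<exists>N. \<forall>n\<ge>N. \<exists>V. (\<forall>j. V (Suc j) = ?A (n + j) *v V j) \<and>
      (\<forall>j\<le>L * p. norm (V j) \<le> C) \<and> (\<forall>k\<le>L. 1 / 2 \<le> norm (V (k * p)))"
    by (rule bounded_transfer_solutions[OF ap \<open>p \<ge> 1\<close> root]) (rule that)
  \<comment> \<open>An entry of the residual has two terms from \<open>cmv_L\<close> and one from
    the multiple of \<open>u\<close> by \<open>z\<close>, with coefficients of modulus at most
    1.\<close>
  define Q where "Q = 3 * C"
  have "Q > 0" using C(1) by (simp add: Q_def)
  obtain L :: nat where "L > 32 * Q\<^sup>2 / \<epsilon>\<^sup>2" using reals_Archimedean2 by blast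
  then have L: "4 * Q\<^sup>2 < \<epsilon>\<^sup>2 * (real L / 8)" using \<open>\<epsilon> > 0\<close> by (simp add: field_simps)
  then have "L > 0" using \<open>Q > 0\<close> by (cases "L = 0") auto
  then have Lp: "L * p \<ge> 1" using \<open>p \<ge> 1\<close> by (simp add: Suc_le_eq)
  obtain N0 where N0: "\<And>n. n \<ge> N0 \<Longrightarrow> \<exists>V. (\<forall>j. V (Suc j) = ?A (n + j) *v V j) \<and>
      (\<forall>j\<le>L * p. norm (V j) \<le> C) \<and> (\<forall>k\<le>L. 1 / 2 \<le> norm (V (k * p)))"
    using C(2) by blast
  define n where "n = 2 * (N0 + N) + 1"
  define e where "e = (if even (n + L * p) then n + L * p else n + L * p - 1)"
  have n: "n \<ge> N0" "n \<ge> N" "odd n" "n \<ge> 1" by (auto simp: n_def)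
  have e: "even e" "e \<le> n + L * p" "n + L * p - 1 \<le> e" using Lp by (auto simp: e_def)
  have "n < e"
  proof -
    have "n \<le> e" using e(3) Lp by linarith
    moreover have "n \<noteq> e" using n(3) e(1) by blast
    ultimately show ?thesis by simp
  qed
  obtain V where V: "\<And>j. V (Suc j) = ?A (n + j) *v V j" "\<And>j. j \<le> L * p \<Longrightarrow> norm (V j) \<le> C"
      "\<And>k. k \<le> L \<Longrightarrow> 1 / 2 \<le> norm (V (k * p))"
    using N0[OF n(1)] by blast
  define w where "w = cnj z"
  have wz: "w * z = 1" "cmod w = 1"
    using z unfolding w_def by (metis complex_norm_square mult.commute of_real_1 one_power2, simp)
  \<comment> \<open>The formula for \<open>szego_vector\<close> solved for its two sequences, with
    \<open>w\<close> the inverse of \<open>z\<close>, and cut off outside the window.\<close>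
  define u v where "u = (\<lambda>i. if n \<le> i \<and> i \<le> e then
      w ^ (i div 2) * (if even i then V (i - n) $ 1 else w * V (i - n) $ 2) else 0)"
    and "v = (\<lambda>i. if n \<le> i \<and> i \<le> e then
      w ^ (i div 2) * (if even i then V (i - n) $ 2 else V (i - n) $ 1) else 0)"
  have zero: "u i = 0" "v i = 0" if "\<not> (n \<le> i \<and> i \<le> e)" for i
    using that by (simp_all only: u_def v_def if_False)
  have sol: "z * V (i - n) $ 1 = cnj (\<gamma> i) * V (i - n) $ 2 + of_real (rho (\<gamma> i)) * V (Suc i - n) $ 1"
    "V (Suc i - n) $ 2 = of_real (rho (\<gamma> i)) * V (i - n) $ 2 - \<gamma> i * V (Suc i - n) $ 1" if "n \<le> i" for i
  proof -
    have "V (Suc i - n) = ?A i *v V (i - n)" using V(1)[of "i - n"] that by (simp add: Suc_diff_le)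
    from szego_step_solution[OF \<gamma> this] show
      "z * V (i - n) $ 1 = cnj (\<gamma> i) * V (i - n) $ 2 + of_real (rho (\<gamma> i)) * V (Suc i - n) $ 1"
      "V (Suc i - n) $ 2 = of_real (rho (\<gamma> i)) * V (i - n) $ 2 - \<gamma> i * V (Suc i - n) $ 1" .
  qed
  \<comment> \<open>An interval from odd \<open>n\<close> to even \<open>e\<close> is a union of
    blocks of \<open>cmv_M\<close>, so these equations survive the truncation at every odd
    index.\<close>
  have odd_step: "v i = cnj (\<gamma> i) * u i + of_real (rho (\<gamma> i)) * u (Suc i)"
    "v (Suc i) = of_real (rho (\<gamma> i)) * u i - \<gamma> i * u (Suc i)" if i: "odd i" for i
  proof -
    consider "i < n" | "n \<le> i" "Suc i \<le> e" | "e < i"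
      using i e(1) by (metis Suc_leI linorder_not_le nat_less_le)
    then have "v i = cnj (\<gamma> i) * u i + of_real (rho (\<gamma> i)) * u (Suc i) \<and>
        v (Suc i) = of_real (rho (\<gamma> i)) * u i - \<gamma> i * u (Suc i)"
    proof cases
      case 1
      then have "Suc i < n" using i n(3) by (metis even_Suc linorder_not_le nat_less_le not_less_eq_eq)
      then show ?thesis using 1 by (simp add: zero)
    next
      case 2
      define m where "m = i div 2"
      have uv: "v i = w ^ m * V (i - n) $ 1" "u i = w ^ m * (w * V (i - n) $ 2)"
        "u (Suc i) = w ^ m * (w * V (Suc i - n) $ 1)" "v (Suc i) = w ^ m * (w * V (Suc i - n) $ 2)"
        using 2 i by (simp_all add: u_def v_def m_def)
      have "V (i - n) $ 1 = w * (z * V (i - n) $ 1)" using wz(1) by (simp add: mult.assoc[symmetric])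
      then have "v i = w ^ m * (w * (z * V (i - n) $ 1))" unfolding uv(1) by simp
      then have "v i = cnj (\<gamma> i) * u i + of_real (rho (\<gamma> i)) * u (Suc i)"
        unfolding sol(1)[OF 2(1)] uv(2,3) by (simp add: algebra_simps)
      moreover have "v (Suc i) = of_real (rho (\<gamma> i)) * u i - \<gamma> i * u (Suc i)"
        unfolding uv sol(2)[OF 2(1)] by (simp add: algebra_simps)
      ultimately show ?thesis by blast
    qed (simp add: zero)
    then show "v i = cnj (\<gamma> i) * u i + of_real (rho (\<gamma> i)) * u (Suc i)"
      "v (Suc i) = of_real (rho (\<gamma> i)) * u i - \<gamma> i * u (Suc i)" by blast+
  qed
  have Mu: "cmv_M \<gamma> u = v"
  proof
    fix i
    show "cmv_M \<gamma> u i = v i"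
    proof (cases i)
      case 0
      then show ?thesis using n(4) by (simp add: cmv_M_eqs zero)
    next
      case (Suc k)
      show ?thesis
      proof (cases "odd i")
        case True
        then show ?thesis using cmv_M_eqs(2)[of i \<gamma> u] odd_step(1)[of i] by simp
      next
        case False
        then have "odd k" using Suc by simp
        then show ?thesis using cmv_M_eqs(3)[of k \<gamma> u] odd_step(2)[of k] Suc by simp
      qed
    qed
  qed
  have f: "?B u i = cmv_L \<gamma> v i - z * u i" for i by (simp add: shifted_def cmv_def Mu)
  \<comment> \<open>The cuts split exactly two blocks of \<open>cmv_L\<close>, those starting at
    \<open>n - 1\<close> and at \<open>e\<close>; they make up the four entries of
    \<open>?E\<close>.\<close>
  have even_step: "?B u i = 0" "?B u (Suc i) = 0" if i: "even i" "i \<noteq> n - 1" "i \<noteq> e" for i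
  proof -
    have "Suc i < n \<or> n \<le> i \<and> Suc i \<le> e \<or> e < i" using i(2,3) n(4) by arith
    then consider "Suc i < n" | "n \<le> i" "Suc i \<le> e" | "e < i" by blast
    then have "?B u i = 0 \<and> ?B u (Suc i) = 0"
    proof cases
      case 2
      define m where "m = i div 2"
      have uv: "u i = w ^ m * V (i - n) $ 1" "v i = w ^ m * V (i - n) $ 2"
        "v (Suc i) = w ^ m * V (Suc i - n) $ 1" "u (Suc i) = w ^ m * (w * V (Suc i - n) $ 2)"
        using 2 i by (simp_all add: u_def v_def m_def)
      have "z * u i = w ^ m * (z * V (i - n) $ 1)" unfolding uv by (simp add: mult_ac)
      then have "z * u i = cmv_L \<gamma> v i"
        unfolding sol(1)[OF 2(1)] cmv_L_eqs[OF i(1)] uv by (simp add: algebra_simps)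
      moreover have "z * u (Suc i) = w ^ m * ((w * z) * V (Suc i - n) $ 2)" unfolding uv by (simp add: mult_ac)
      then have "z * u (Suc i) = cmv_L \<gamma> v (Suc i)"
        unfolding wz sol(2)[OF 2(1)] cmv_L_eqs[OF i(1)] uv by (simp add: algebra_simps)
      ultimately show ?thesis by (simp add: f)
    qed (simp_all add: f cmv_L_eqs[OF i(1)] zero)
    then show "?B u i = 0" "?B u (Suc i) = 0" by blast+
  qed
  let ?E = "{n - 1, n, e, Suc e}"
  have outside: "?B u i = 0" if i: "i \<notin> ?E" for i
  proof (cases "even i")
    case True
    then show ?thesis using i by (intro even_step(1)) auto
  next
    case False
    then obtain k where k: "i = Suc k" "even k" by (cases i) auto
    then show ?thesis using i n(4) even_step(2)[of k] by auto
  qed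
  have uC: "cmod (u i) \<le> C" "cmod (v i) \<le> C" for i
  proof -
    have "cmod (u i) \<le> C \<and> cmod (v i) \<le> C"
    proof (cases "n \<le> i \<and> i \<le> e")
      case True
      then have "norm (V (i - n)) \<le> C" using e(2) by (intro V(2)) auto
      then have "cmod (V (i - n) $ 1) \<le> C" "cmod (V (i - n) $ 2) \<le> C"
        using Finite_Cartesian_Product.norm_nth_le[of "V (i - n)"] order_trans by blast+
      then show ?thesis using True wz(2) by (simp add: u_def v_def norm_mult norm_power)
    qed (use zero C(1) in simp)
    then show "cmod (u i) \<le> C" "cmod (v i) \<le> C" by blast+
  qed
  have small: "cmod (?B u i) \<le> Q" for i
  proof -
    have bd: "cmod (a * v j) \<le> C" if "cmod a \<le> 1" for a j
      using that uC(2)[of j] mult_mono[of "cmod a" 1 "cmod (v j)" C] C(1) by (simp add: norm_mult)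
    have \<rho>: "cmod (of_real (rho (\<gamma> j))) \<le> 1" "cmod (cnj (\<gamma> j)) \<le> 1" "cmod (\<gamma> j) \<le> 1" for j
      using rho_props(1,2)[OF \<gamma>[of j]] \<gamma>[of j] by auto
    have "cmod (cmv_L \<gamma> v i) \<le> C + C"
    proof (cases "even i")
      case True
      then show ?thesis
        unfolding cmv_L_eqs[OF True] by (intro norm_triangle_le add_mono bd \<rho>)
    next
      case False
      then obtain k where k: "i = Suc k" "even k" by (cases i) auto
      then show ?thesis
        unfolding k(1) cmv_L_eqs[OF k(2)] by (intro norm_triangle_le_diff add_mono bd \<rho>)
    qed
    moreover have "cmod (z * u i) \<le> C" using uC(1) z by (simp add: norm_mult)
    ultimately show ?thesis
      unfolding f Q_def using norm_triangle_ineq4[of "cmv_L \<gamma> v i" "z * u i"] by linarith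
  qed
  have fin: "finite {i. u i \<noteq> 0}"
    by (rule finite_subset[of _ "{n..e}"]) (use zero(1) in force, simp)
  have u_ell2: "u \<in> ell2 UNIV" using fin by (rule ell2_finite_support)
  define y where "y = Abs_l2 u"
  have y: "l2_fun y = u" unfolding y_def using u_ell2 by simp
  have B: "bounded_op UNIV ?B" by (intro bounded_op_shifted(1) cmv_operator(1) \<gamma>)
  have My: "l2_fun (op_of (cmv_M \<gamma>) y) = v" by (simp add: l2_fun_op_of[OF cmv_factors(2)[OF \<gamma>]] y Mu)
  have lower: "real L / 8 \<le> (norm y)\<^sup>2"
  proof -
    let ?g = "\<lambda>k. n + k * p"
    have inj: "inj_on ?g {..<L}" using \<open>p \<ge> 1\<close> by (auto simp: inj_on_def)
    have pair: "(cmod (u i))\<^sup>2 + (cmod (v i))\<^sup>2 = (norm (V (i - n)))\<^sup>2" if "n \<le> i \<and> i \<le> e" for i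
      using that wz(2) unfolding norm_vec_2 by (cases "even i") (simp_all add: u_def v_def norm_mult norm_power)
    \<comment> \<open>Here \<open>k < L\<close>, because parity may have moved the end
      \<open>e\<close> one place before \<open>n + L * p\<close>.\<close>
    have quarter: "1 / 4 \<le> (cmod (u (?g k)))\<^sup>2 + (cmod (v (?g k)))\<^sup>2" if k: "k \<in> {..<L}" for k
    proof -
      have "(k + 1) * p \<le> L * p" using k by (intro mult_le_mono1) auto
      then have "k * p + p \<le> L * p" by simp
      then have win: "n \<le> ?g k \<and> ?g k \<le> e" using \<open>p \<ge> 1\<close> e(3) by linarith
      then have "(cmod (u (?g k)))\<^sup>2 + (cmod (v (?g k)))\<^sup>2 = (norm (V (k * p)))\<^sup>2"
        using pair[of "?g k"] by simp
      moreover have "(1 / 2)\<^sup>2 \<le> (norm (V (k * p)))\<^sup>2" using V(3)[of k] k by (intro power_mono) auto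
      ultimately show ?thesis by (simp add: power2_eq_square)
    qed
    have "real L / 4 = (\<Sum>k\<in>{..<L}. 1 / 4)" by simp
    also have "\<dots> \<le> (\<Sum>k\<in>{..<L}. (cmod (u (?g k)))\<^sup>2 + (cmod (v (?g k)))\<^sup>2)"
      by (rule sum_mono) (rule quarter)
    also have "\<dots> = (\<Sum>i\<in>?g ` {..<L}. (cmod (l2_fun y i))\<^sup>2) + (\<Sum>i\<in>?g ` {..<L}. (cmod (l2_fun (op_of (cmv_M \<gamma>) y) i))\<^sup>2)"
      unfolding sum.distrib y My by (simp add: sum.reindex[OF inj])
    also have "\<dots> \<le> (norm y)\<^sup>2 + (norm (op_of (cmv_M \<gamma>) y))\<^sup>2"
      by (intro add_mono sum_le_norm_l2) auto
    \<comment> \<open>The lower bound is for \<open>u\<close> and \<open>v\<close> jointly;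
      \<open>v\<close> has the same norm as \<open>u\<close> since \<open>cmv_M\<close> is
      isometric.\<close>
    also have "\<dots> = 2 * (norm y)\<^sup>2" by (simp add: cmv_M_norm \<gamma>)
    finally show ?thesis by simp
  qed
  have card: "card ?E \<le> 4" by (simp add: card_insert_if)
  note approx = approximate_eigenvectorI[where B = ?B and E = ?E and Q = Q and \<Lambda> = "real L / 8" and \<epsilon> = \<epsilon>,
      OF B u_ell2 _ card outside small _ L \<open>\<epsilon> > 0\<close>]
  have "ell2_norm u > 0" "ell2_norm (?B u) \<le> \<epsilon> * ell2_norm u"
    using lower by (auto intro!: approx simp: y_def)
  moreover have "u \<in> ell2 (UNIV \<inter> {N..})"
    using n by (subst ell2_iff) (auto simp: u_ell2 intro!: zero)
  ultimately show ?thesis using fin by blast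
qed

text \<open>By unitarity the lower bound for the shifted operator is also one for its adjoint, so a
  single estimate feeds \<open>fredholmI\<close>; a formal solution is determined by its coordinate
  0.\<close>

lemma cmv_fredholm_iff:
  assumes \<gamma>: "\<And>n. cmod (\<gamma> n) < 1" and z: "cmod z = 1"
    and ap: "asymptotically_periodic p t D (\<lambda>n. szego_step (\<gamma> n) z)" and "p \<ge> 1"
  shows "fredholm UNIV (shifted (cmv \<gamma>) z) \<longleftrightarrow> (\<forall>\<nu>. cmod \<nu> = 1 \<longrightarrow> \<nu>\<^sup>2 - t * \<nu> + D \<noteq> 0)"
proof -
  let ?B = "shifted (cmv \<gamma>) z"
  note c = cmv_operator[of \<gamma>, OF \<gamma>]
  have B: "bounded_op UNIV ?B" "bounded_op UNIV (shifted (cmv_adj \<gamma>) (cnj z))"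
    by (intro bounded_op_shifted(1) c)+
  have 1: "fredholm UNIV ?B" if no_root: "\<forall>\<nu>. cmod \<nu> = 1 \<longrightarrow> \<nu>\<^sup>2 - t * \<nu> + D \<noteq> 0"
  proof -
    obtain N k where k: "k > 0" and Nk: "\<forall>y. l2_fun y \<in> ell2 {N..} \<longrightarrow> k * norm y \<le> norm (op_of ?B y)"
      by (rule cmv_lower_bound[OF \<gamma> z ap no_root[rule_format]], assumption, rule that)
    have lower: "k * norm y \<le> norm (op_of ?B y)" if "l2_fun y \<in> ell2 (UNIV - {..<N})" for y
      by (rule Nk[rule_format]) (use that in \<open>auto simp: ell2_def\<close>)
    show ?thesis
    proof (rule fredholmI[where F = "{..<N}" and base = 0, OF B _ _ _ _ k lower])
      show "inner (op_of ?B x) y = inner x (op_of (shifted (cmv_adj \<gamma>) (cnj z)) y)" for x y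
        by (rule shifted_adjoint[OF c(1,2,3)])
      show "k * norm y \<le> norm (op_of (shifted (cmv_adj \<gamma>) (cnj z)) y)"
        if "l2_fun y \<in> ell2 (UNIV - {..<N})" for y
        using lower[OF that] by (simp add: cmv_adj_norm_shifted[OF \<gamma> z])
      show "u = (\<lambda>i. 0)" if "u \<in> ell2 UNIV" "?B u = (\<lambda>i. 0)" "u 0 = 0" for u
        by (rule cmv_formal_solution_unique[OF \<gamma> that(2,3)])
    qed (use bounded_opD(1) B in blast)+
  qed
  have 2: "\<forall>\<nu>. cmod \<nu> = 1 \<longrightarrow> \<nu>\<^sup>2 - t * \<nu> + D \<noteq> 0" if fred: "fredholm UNIV ?B"
  proof (rule ccontr)
    assume "\<not> (\<forall>\<nu>. cmod \<nu> = 1 \<longrightarrow> \<nu>\<^sup>2 - t * \<nu> + D \<noteq> 0)"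
    then obtain \<nu> where root: "cmod \<nu> = 1" "\<nu>\<^sup>2 - t * \<nu> + D = 0" by blast
    have "\<not> fredholm UNIV ?B"
    \<comment> \<open>Row \<open>n\<close> of the five-diagonal matrix reaches at most to column
      \<open>n + 2\<close>.\<close>
    proof (rule not_fredholmI[where b = 2 and base = 0, OF B(1)])
      show "?B (\<lambda>i. u i + v i) = (\<lambda>i. ?B u i + ?B v i)" for u v
        by (auto simp: fun_eq_iff shifted_def cmv_def cmv_L_def cmv_M_def algebra_simps)
      show "?B (\<lambda>i. c * u i) = (\<lambda>i. c * ?B u i)" for c u
        by (auto simp: fun_eq_iff shifted_def cmv_def cmv_L_def cmv_M_def algebra_simps)
      show "?B u n = ?B v n" if "\<And>m. m \<le> n + 2 \<Longrightarrow> u m = v m" for u v n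
        using that by (simp add: shifted_def cmv_def cmv_L_def cmv_M_def)
      show "?B u \<in> ell2 UNIV" if "u \<in> ell2 UNIV" for u using bounded_opD(1)[OF B(1) that] .
      show "h = (\<lambda>i. 0)" if "?B h = (\<lambda>i. 0)" "h 0 = 0" for h
        by (rule cmv_formal_solution_unique[OF \<gamma> that])
    qed (use cmv_weyl[OF \<gamma> z ap \<open>p \<ge> 1\<close> root] in auto)
    with fred show False by contradiction
  qed
  show ?thesis using 1 2 by blast
qed

text \<open>Shifting an isometry by \<open>z\<close> leaves it bounded below by
  \<open>|1 - |z||\<close>, and the same holds for the adjoint, so no coordinates have to be
  neglected.\<close>

lemma cmv_fredholm_off_circle:
  assumes \<gamma>: "\<And>n. cmod (\<gamma> n) < 1" and z: "cmod z \<noteq> 1"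
  shows "fredholm UNIV (shifted (cmv \<gamma>) z)"
proof -
  note c = cmv_operator[of \<gamma>, OF \<gamma>]
  have B: "bounded_op UNIV (shifted (cmv \<gamma>) z)" "bounded_op UNIV (shifted (cmv_adj \<gamma>) (cnj z))"
    by (intro bounded_op_shifted(1) c)+
  have k: "\<bar>1 - cmod z\<bar> > 0" using z by simp
  show ?thesis
  proof (rule fredholmI[where F = "{}" and base = 0, OF B _ _ _ _ k])
    show "inner (op_of (shifted (cmv \<gamma>) z) x) y = inner x (op_of (shifted (cmv_adj \<gamma>) (cnj z)) y)" for x y
      by (rule shifted_adjoint[OF c(1,2,3)])
    show "\<bar>1 - cmod z\<bar> * norm y \<le> norm (op_of (shifted (cmv \<gamma>) z) y)" for y
      unfolding bounded_op_shifted(2)[OF c(1)] by (rule isometry_lower_bound) (rule cmv_norm(1)[OF \<gamma>])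
    show "\<bar>1 - cmod z\<bar> * norm y \<le> norm (op_of (shifted (cmv_adj \<gamma>) (cnj z)) y)" for y
      using isometry_lower_bound[where T = "op_of (cmv_adj \<gamma>)" and z = "cnj z" and x = y, OF cmv_norm(2)[OF \<gamma>]]
      unfolding bounded_op_shifted(2)[OF c(2)] by simp
    show "u = (\<lambda>i. 0)" if "u \<in> ell2 UNIV" "shifted (cmv \<gamma>) z u = (\<lambda>i. 0)" "u 0 = 0" for u
      by (rule cmv_formal_solution_unique[OF \<gamma> that(2,3)])
  qed (use bounded_opD(1) B in \<open>blast, blast, simp\<close>)
qed

lemma cmv_essential_spectrum:
  assumes "p \<ge> 1" and per: "periodic_verblunsky p \<alpha>" and \<gamma>: "\<And>n. cmod (\<gamma> n) < 1"
    and asym: "cmv_asymptotic \<gamma> (cmv_torus p \<alpha>)"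
  shows "ess_spectrum UNIV (cmv \<gamma>) = ess_spectrum UNIV (cmv \<alpha>)"
proof -
  have \<alpha>: "cmod (\<alpha> n) < 1" for n using per by (simp add: periodic_verblunsky_def)
  have "fredholm UNIV (shifted (cmv \<gamma>) z) \<longleftrightarrow> fredholm UNIV (shifted (cmv \<alpha>) z)" for z
  proof (cases "cmod z = 1")
    case True
    then have "z \<noteq> 0" by auto
    show ?thesis
      using cmv_fredholm_iff[OF \<gamma> True cmv_asymptotic_transfer[OF per \<open>p \<ge> 1\<close> \<gamma> asym \<open>z \<noteq> 0\<close>] \<open>p \<ge> 1\<close>]
        cmv_fredholm_iff[OF \<alpha> True cmv_periodic_transfer[OF per \<open>p \<ge> 1\<close>] \<open>p \<ge> 1\<close>] by simp
  next
    case False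
    then show ?thesis using cmv_fredholm_off_circle \<gamma> \<alpha> by blast
  qed
  then show ?thesis by (simp add: ess_spectrum_def)
qed

theorem theorem1p5:
  "(\<forall>(p::nat) (\<alpha>::nat \<Rightarrow> complex) (\<gamma>::nat \<Rightarrow> complex).
      p \<ge> 1 \<longrightarrow> periodic_verblunsky p \<alpha> \<longrightarrow>
      (\<forall>n. cmod (\<gamma> n) < 1) \<longrightarrow> cmv_asymptotic \<gamma> (cmv_torus p \<alpha>) \<longrightarrow>
      ess_spectrum UNIV (cmv \<gamma>) = ess_spectrum UNIV (cmv \<alpha>)) \<and>
   (\<forall>(p::nat) (a'::int \<Rightarrow> real) (b'::int \<Rightarrow> real) (a::nat \<Rightarrow> real) (b::nat \<Rightarrow> real).
      p \<ge> 1 \<longrightarrow> periodic_jacobi p a' b' \<longrightarrow>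
      (\<forall>n\<ge>1. a n > 0) \<longrightarrow> jacobi_asymptotic a b (jacobi_torus p a' b') \<longrightarrow>
      ess_spectrum {1..} (jacobi_half a b) = spectrum_op UNIV (jacobi_full a' b'))"
  using cmv_essential_spectrum jacobi_essential_spectrum by blast

end
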